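(* Let $a,c,d\ge 1$ be integers. For a symmetry class of plane partitions, consider the boundary words of the $U_q(\mathfrak{sl}_4)$-webs (hourglass plabic graphs) that correspond to plane partitions $p$ in the class, restricted to the fundamental domain of the class. These boundary words are as follows, where $(34)$ denotes the two consecutive letters $3\,4$, $(23)$ the two consecutive letters $2\,3$, and $(\overline{31})$ the two consecutive letters $\overline 3\,\overline 1$, each such pair being treated as a single letter when positions are counted, and where $\{\cdots\}$ denotes a multiset from which one builds a subword using every letter with the multiplicity given by its exponent, subject to the restrictions stated. (1) $\mathrm{SPP}(a,a,c)$: $\;1^a\,\overline{4}^{\,c}\,2^a\,\{4^c,(34)^a\}$, where the $c$ letters $4$ and the $a$ letters $(34)$ may be freely ordered. (2) $\mathrm{CSPP}(a,a,a)$: $\;1^a\,\overline{4}^{\,a}\,\{(\overline{31})^m,\overline{1}^{\,a-m}\}\,\{4^{a-m},(34)^m\}$, where the $m$ letters $(\overline{31})$ and the $a-m$ letters $\overline 1$ of the first multiset may be freely ordered, for $0\le m\le a$, and the second subword obeys the rule: with positions numbered $0,1,\dots,a-1$, if $(\overline{31})$ is in position $i$ of the subword given by $\{(\overline{31})^m,\overline1^{\,a-m}\}$, then $(34)$ is in position $a-i-1$ of the subword given by $\{4^{a-m},(34)^m\}$. (3) $\mathrm{TSPP}(a,a,a)$: $\;1^a\,\{(23)^{a-m},2^m\}\,\{4^{a-m},(34)^m\}$, where the $a-m$ letters $(23)$ and the $m$ letters $2$ of the first multiset may be freely ordered, for all $0\le m\le a$, and the second subword satisfies: for all $0\le m\le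 a$ and $0\le i\le a-m-1$, in the part of the subword of $\{(23)^{a-m},2^m\}$ given by the letters in position $a-m$ to position $a-m-i$, the number of $(23)$'s must be less than or equal to the number of $4$'s in the part of the subword of $\{4^{a-m},(34)^m\}$ given by the letters in position $0$ to position $i$. (4) $\mathrm{TSSCPP}(a,a,a)$, $a=2d$: $\;1^d\,\underbrace{2\,\overline4\,2\cdots\overline4\,2}_{2d-1}\,\{4^{d-1},(34)^{d-1}\}\,(34)$, where the subword $w$ constructed from the $d-1$ letters $4$ and the $d-1$ letters $(34)$ must be such that $4\,w\,(34)$ is Yamanouchi in the letters $4$ and $(34)$, i.e. every initial segment of $4\,w\,(34)$ contains at least as many letters $4$ as letters $(34)$.
   Context: **Plane partitions.** A plane partition $p$ in an $a\times b\times c$ box is a set of unit cubes at positions $(i,j,k)$, $1\le i\le a$, $1\le j\le b$, $1\le k\le c$, such that if $(n,m,\ell)\in p$ then $(i,j,k)\in p$ for all $i\le n,j\le m,k\le \ell$. Put $p_{i,j}=\#\{k:(i,j,k)\in p\}$. Classes: $\mathrm{SPP}(a,a,c)$: $p_{i,j}=p_{j,i}$ for all $i,j$. $\mathrm{CSPP}(a,a,a)$: for all $i$ the $i$th row of $(p_{i,j})$ is conjugate (as an integer partition) to the $i$th column. $\mathrm{TSPP}(a,a,a)$: both symmetric and cyclically symmetric. $\mathrm{TSSCPP}(2d,2d,2d)$: totally symmetric and self-complementary, i.e. also $p_{i,j}+p_{a-i+1,b-j+1}=c$ for all $i,j$ (with $a=b=c=2d$). **Web of a plane partition.** Project the box to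 the plane by $e_1\mapsto(\tfrac{\sqrt3}{2},-\tfrac12)$, $e_2\mapsto(-\tfrac{\sqrt3}{2},-\tfrac12)$, $e_3\mapsto(0,1)$. The box becomes a hexagon with sides, clockwise from its top vertex, NE, E, SE, SW, W, NW (lengths $a,c,b,a,c,b$), and the visible faces of $p$ and of the empty box walls give a tiling of the hexagon by unit rhombi (lozenges), each the union of two unit triangles. The web $W$ of $p$ has an interior vertex in each unit triangle, white if the triangle has a vertical side on its left and black if it has a vertical side on its right. Two adjacent triangles are joined by an hourglass edge (weight 2; two strands twisted so as to cross once) if they form a lozenge, and by a simple edge (weight 1) otherwise. For each unit side on the boundary of the hexagon there is a simple edge crossing it, from the adjacent interior vertex to a boundary vertex of the opposite color. Counting hourglass strands separately, every interior vertex has degree 4. The web is drawn in a disk; the base face $F_0$ is the face adjacent to the boundary of the disk at the topmost point, and boundary vertices are read clockwise starting from $F_0$. **Fundamental domains.** Let $O$ be the centre of the hexagon. Restrict $W$ to: for SPP, the right half of the hexagon, cut by the vertical line from the bottom vertex to the top vertex; for CSPP, TSPP, TSSCPP, the sector with apex $O$ swept clockwise from the upward vertical direction through $120^\circ$, $60^\circ$, $30^\circ$, respectively. $F_0$ remains the topmost face and the boundary is read clockwise from $F_0$: first the part of the hexagon boundary, then (if different from the vertical cut) the slanted cut read towards $O$, then the vertical cut read upward. When a cut crosses a simple edge, the edge is cut off at a boundary vertex whose color is opposite to that of its remaining interior endpoint. When a cut crosses an hourglass edge, the hourglass is replaced by two (split) simple edges from the remaining interior endpoint to two consecutive boundary vertices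 of the opposite color; these contribute two consecutive letters $i\,j$ to the boundary word, written $(ij)$. In the TSSCPP case the slanted cut runs along hourglass edges (it passes along the long diagonals of lozenges); these hourglass edges are removed, and their endpoints become boundary vertices (keeping their color), each incident to the one simple edge going into the sector; the endpoint nearest $O$, whose simple edge crosses the vertical cut, is discarded together with that edge. **Trips.** In such a graph, a trip $\mathsf{trip}_t$ ($t=1,2,3$) walks along edges (hourglass strands counted as separate edges, and traversing a strand passes through the crossing): on arriving at a black vertex it leaves along the $t$-th edge to the right (the $t$-th edge counterclockwise from the arrival edge), and on arriving at a white vertex along the $t$-th edge to the left. It starts and ends at boundary vertices. For a simple edge $s$, $\mathsf{trip}_t(s)$ is the $t$-trip that traverses $s$ from its black to its white endpoint. **Boundary word.** For a simple edge $s$ let $F(s)$ be the face to the right of $s$ when travelling from its black to its white endpoint. The separation label is $\mathsf{sep}(s)=1+\#\{t\in\{1,2,3\}:\mathsf{trip}_t(s)\text{ separates }F(s)\text{ from }F_0\}$. The boundary word is the sequence of separation labels of the edges at the boundary vertices, read clockwise from $F_0$, where a label $j$ is written $j$ if the boundary vertex is black and $\overline{j}$ if it is white.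
   Formalization: In (3) the printed window "position a-m to position a-m-i", 0≤i≤a-m-1, is false (a=3: 1^3 2(23)2 (34)4(34) occurs but violates it); it is corrected to the last i+1 letters, positions a-1 down to a-1-i, for all 0≤i≤a-1. *)

theory Defs
  imports Complex_Main "HOL-Library.Multiset" "HOL-Library.Product_Plus"
begin

section \<open>Plane partitions\<close>

definition plane_partition :: "nat \<Rightarrow> nat \<Rightarrow> nat \<Rightarrow> (nat \<times> nat \<times> nat) set \<Rightarrow> bool" where
  "plane_partition a b c p \<longleftrightarrow>
     p \<subseteq> {1..a} \<times> {1..b} \<times> {1..c} \<and>
     (\<forall>n m l i j k. (n, m, l) \<in> p \<and> i \<in> {1..n} \<and> j \<in> {1..m} \<and> k \<in> {1..l} \<longrightarrow> (i, j, k) \<in> p)"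

definition height :: "(nat \<times> nat \<times> nat) set \<Rightarrow> nat \<Rightarrow> nat \<Rightarrow> nat" where
  "height p i j = card {k. (i, j, k) \<in> p}"

text \<open>The parts \<open>l 1, \<dots>, l n\<close> form an integer partition, and \<open>conjugate n l j\<close> is the \<open>j\<close>-th part of
  its conjugate.\<close>

definition conjugate :: "nat \<Rightarrow> (nat \<Rightarrow> nat) \<Rightarrow> nat \<Rightarrow> nat" where
  "conjugate n l j = card {m \<in> {1..n}. j \<le> l m}"

definition SPP :: "nat \<Rightarrow> nat \<Rightarrow> (nat \<times> nat \<times> nat) set set" where
  "SPP a c = {p. plane_partition a a c p \<and>
     (\<forall>i\<in>{1..a}. \<forall>j\<in>{1..a}. height p i j = height p j i)}"

definition CSPP :: "nat \<Rightarrow> (nat \<times> nat \<times> nat) set set" where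
  "CSPP a = {p. plane_partition a a a p \<and>
     (\<forall>i\<in>{1..a}. \<forall>j\<in>{1..a}. conjugate a (\<lambda>n. height p i n) j = height p j i)}"

definition TSPP :: "nat \<Rightarrow> (nat \<times> nat \<times> nat) set set" where
  "TSPP a = SPP a a \<inter> CSPP a"

definition TSSCPP :: "nat \<Rightarrow> (nat \<times> nat \<times> nat) set set" where
  "TSSCPP a = {p \<in> TSPP a.
     \<forall>i\<in>{1..a}. \<forall>j\<in>{1..a}. height p i j + height p (a + 1 - i) (a + 1 - j) = a}"


section \<open>The triangular lattice\<close>

text \<open>The lattice point \<open>(x, y)\<close> is \<open>x e\<^sub>1 + y e\<^sub>2\<close>; since \<open>e\<^sub>1 + e\<^sub>2 + e\<^sub>3 = 0\<close>, these are all the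
  projections of integer points. \<open>plane\<close> gives the position in the plane.\<close>

type_synonym point = "int \<times> int"

datatype dir = E1 | E2 | E3

fun vec :: "dir \<Rightarrow> point" where
  "vec E1 = (1, 0)"
| "vec E2 = (0, 1)"
| "vec E3 = (-1, -1)"

fun plane :: "point \<Rightarrow> complex" where
  "plane (x, y) = of_int x * Complex (sqrt 3 / 2) (- 1 / 2) + of_int y * Complex (- sqrt 3 / 2) (- 1 / 2)"

definition proj :: "nat \<Rightarrow> nat \<Rightarrow> nat \<Rightarrow> point" where
  "proj i j k = (int i - int k, int j - int k)"

definition hexagon :: "nat \<Rightarrow> nat \<Rightarrow> nat \<Rightarrow> point set" where
  "hexagon a b c = {proj i j k | i j k. i \<le> a \<and> j \<le> b \<and> k \<le> c}"

text \<open>A unit triangle is given by its color and the lower end \<open>P\<close> of its vertical side, which joins \<open>P\<close>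
  to \<open>P + e\<^sub>3\<close> and is on the left of a white and on the right of a black triangle.\<close>

datatype triangle = White point | Black point

fun corners :: "triangle \<Rightarrow> point set" where
  "corners (White P) = {P, P + vec E3, P + vec E3 + vec E1}"
| "corners (Black P) = {P, P + vec E3, P + vec E3 + vec E2}"

text \<open>The unit side \<open>(P, u)\<close> goes from \<open>P\<close> to \<open>P + vec u\<close>. With this orientation it always has a white
  triangle on its right and a black triangle on its left.\<close>

type_synonym side = "point \<times> dir"

fun white_of :: "side \<Rightarrow> triangle" where
  "white_of (P, E1) = White (P - vec E3)"
| "white_of (P, E2) = White (P + vec E2)"
| "white_of (P, E3) = White P"

fun black_of :: "side \<Rightarrow> triangle" where
  "black_of (P, E1) = Black (P + vec E1)"
| "black_of (P, E2) = Black (P - vec E3)"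
| "black_of (P, E3) = Black P"

text \<open>The sides of a triangle in counterclockwise order.\<close>

fun ccw_sides :: "triangle \<Rightarrow> side list" where
  "ccw_sides (White P) = [(P, E3), (P + vec E3 + vec E1, E2), (P + vec E3, E1)]"
| "ccw_sides (Black P) = [(P, E3), (P + vec E3, E2), (P + vec E3 + vec E2, E1)]"

lemma in_ccw_sides_iff:
  "s \<in> set (ccw_sides (White P)) \<longleftrightarrow> white_of s = White P"
  "s \<in> set (ccw_sides (Black P)) \<longleftrightarrow> black_of s = Black P"
  by (cases P; cases s rule: white_of.cases; force simp: algebra_simps)+

lemma side_corners:
  "fst s \<in> corners (white_of s) \<inter> corners (black_of s)"
  "fst s + vec (snd s) \<in> corners (white_of s) \<inter> corners (black_of s)"
  by (cases s rule: white_of.cases; force simp: algebra_simps)+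


section \<open>Webs\<close>

text \<open>A web is dual to a part of the triangular lattice. Its interior vertices are the triangles in
  \<open>interior_vertices W\<close>, and for each side \<open>s\<close> of such a triangle there is an edge crossing \<open>s\<close>, which is an
  hourglass edge if \<open>s \<in> hourglasses W\<close>. If only one of the two triangles at \<open>s\<close> is an interior vertex,
  the edge ends on the other side of \<open>s\<close> at a boundary vertex of the opposite color; if moreover
  \<open>s \<in> hourglasses W\<close>, then the hourglass has been cut, and its two strands are simple edges that end at
  two consecutive boundary vertices.\<close>

record web =
  interior_vertices :: "triangle set"
  hourglasses :: "side set"

definition weight :: "web \<Rightarrow> side \<Rightarrow> nat" where
  "weight W s = (if s \<in> hourglasses W then 2 else 1)"

text \<open>A strand is a side together with the number 0 (for simple edges) or 0, 1 (for hourglass edges, in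
  counterclockwise order around an interior endpoint). The two strands of an uncut hourglass cross once,
  so the counterclockwise order around its white endpoint and the one around its black endpoint give the
  same numbering.\<close>

type_synonym strand = "side \<times> nat"

definition strands :: "web \<Rightarrow> strand set" where
  "strands W = {(s, i). (white_of s \<in> interior_vertices W \<or> black_of s \<in> interior_vertices W) \<and> i < weight W s}"

definition ccw_strands :: "web \<Rightarrow> triangle \<Rightarrow> strand list" where
  "ccw_strands W v = concat (map (\<lambda>s. map (Pair s) [0..<weight W s]) (ccw_sides v))"

definition split_hourglass :: "web \<Rightarrow> side \<Rightarrow> bool" where
  "split_hourglass W s \<longleftrightarrow>
     s \<in> hourglasses W \<and> (white_of s \<in> interior_vertices W \<longleftrightarrow> black_of s \<notin> interior_vertices W)"

text \<open>In the \<open>a \<times> b \<times> c\<close> box with the walls through the origin, a unit square is visible iff the cube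
  behind it belongs to \<open>p\<close> or lies behind a wall, and the cube in front of it does not. The two triangles
  of its projection share the projected diagonal: e.g. the top face of the cube at \<open>(i, j, k)\<close> has the
  diagonal from \<open>(i, j, k)\<close> to \<open>(i - 1, j - 1, k)\<close>, whose projection has direction \<open>- e\<^sub>1 - e\<^sub>2 = e\<^sub>3\<close>.\<close>

definition solid :: "(nat \<times> nat \<times> nat) set \<Rightarrow> nat \<Rightarrow> nat \<Rightarrow> nat \<Rightarrow> bool" where
  "solid p i j k \<longleftrightarrow> i = 0 \<or> j = 0 \<or> k = 0 \<or> (i, j, k) \<in> p"

definition pp_web :: "nat \<Rightarrow> nat \<Rightarrow> nat \<Rightarrow> (nat \<times> nat \<times> nat) set \<Rightarrow> web" where
  "pp_web a b c p = \<lparr>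
     interior_vertices = {v. corners v \<subseteq> hexagon a b c},
     hourglasses =
       {(proj i j k, E1) | i j k. i \<le> a \<and> j \<in> {1..b} \<and> k \<in> {1..c} \<and>
          solid p i j k \<and> \<not> solid p (i + 1) j k} \<union>
       {(proj i j k, E2) | i j k. i \<in> {1..a} \<and> j \<le> b \<and> k \<in> {1..c} \<and>
          solid p i j k \<and> \<not> solid p i (j + 1) k} \<union>
       {(proj i j k, E3) | i j k. i \<in> {1..a} \<and> j \<in> {1..b} \<and> k \<le> c \<and>
          solid p i j k \<and> \<not> solid p i j (k + 1)} \<rparr>"

text \<open>All domains \<open>D\<close> below are convex, so a triangle lies in \<open>D\<close> iff its corners do.\<close>

definition restrict_web :: "web \<Rightarrow> point set \<Rightarrow> web" where
  "restrict_web W D = W\<lparr>interior_vertices := {v \<in> interior_vertices W. corners v \<subseteq> D}\<rparr>"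


section \<open>Trips\<close>

datatype heading = ToBlack | ToWhite

text \<open>\<open>ccw_step W v t e e'\<close>: at \<open>v\<close>, the strand \<open>e'\<close> is the \<open>t\<close>-th one counterclockwise from \<open>e\<close>;
  equivalently, \<open>e\<close> is the \<open>t\<close>-th one clockwise from \<open>e'\<close>.\<close>

definition ccw_step :: "web \<Rightarrow> triangle \<Rightarrow> nat \<Rightarrow> strand \<Rightarrow> strand \<Rightarrow> bool" where
  "ccw_step W v t e e' \<longleftrightarrow>
     (let L = ccw_strands W v
      in \<exists>n < length L. e = L ! n \<and> e' = L ! ((n + t) mod length L))"

inductive trip_step :: "web \<Rightarrow> nat \<Rightarrow> strand \<times> heading \<Rightarrow> strand \<times> heading \<Rightarrow> bool" for W t where
  at_black: "black_of (fst e) \<in> interior_vertices W \<Longrightarrow> ccw_step W (black_of (fst e)) t e e' \<Longrightarrow>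
    trip_step W t (e, ToBlack) (e', ToWhite)"
| at_white: "white_of (fst e) \<in> interior_vertices W \<Longrightarrow> ccw_step W (white_of (fst e)) t e' e \<Longrightarrow>
    trip_step W t (e, ToWhite) (e', ToBlack)"

text \<open>The strands on the \<open>t\<close>-trip that traverses \<open>e\<close> from its black to its white end, followed forward
  and backward as far as possible.\<close>

definition trip :: "web \<Rightarrow> nat \<Rightarrow> strand \<Rightarrow> strand set" where
  "trip W t e = {e'. \<exists>h. (trip_step W t)\<^sup>*\<^sup>* (e, ToWhite) (e', h) \<or> (trip_step W t)\<^sup>*\<^sup>* (e', h) (e, ToWhite)}"


section \<open>Faces and separation labels\<close>

text \<open>By duality, the faces other than the small regions inside hourglasses correspond to the lattice
  points, except that there is one more face between the two simple edges of a split hourglass.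
  Travelling along an edge from its black to its white end, one crosses the side \<open>(P, u)\<close> with \<open>P\<close> on the
  right and \<open>P + vec u\<close> on the left.\<close>

datatype face = Around point | Between side

definition right_face :: "web \<Rightarrow> strand \<Rightarrow> face" where
  "right_face W e = (case e of ((P, u), i) \<Rightarrow>
     if split_hourglass W (P, u) \<and> (i = 0 \<longleftrightarrow> white_of (P, u) \<in> interior_vertices W)
     then Between (P, u) else Around P)"

definition left_face :: "web \<Rightarrow> strand \<Rightarrow> face" where
  "left_face W e = (case e of ((P, u), i) \<Rightarrow>
     if split_hourglass W (P, u) \<and> (i = 0 \<longleftrightarrow> black_of (P, u) \<in> interior_vertices W)
     then Between (P, u) else Around (P + vec u))"

text \<open>One can pass from a face to a neighbouring one without meeting the trip \<open>T\<close> by crossing an edge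
  (for an uncut hourglass: both of its strands) that \<open>T\<close> does not use.\<close>

inductive face_step :: "web \<Rightarrow> strand set \<Rightarrow> face \<Rightarrow> face \<Rightarrow> bool" for W T where
  "(s, i) \<in> strands W \<Longrightarrow>
   \<forall>j. (s, j) \<in> T \<longrightarrow> split_hourglass W s \<and> j \<noteq> i \<Longrightarrow>
   (F = right_face W (s, i) \<and> G = left_face W (s, i)) \<or>
   (F = left_face W (s, i) \<and> G = right_face W (s, i)) \<Longrightarrow>
   face_step W T F G"

definition separates :: "web \<Rightarrow> strand set \<Rightarrow> face \<Rightarrow> face \<Rightarrow> bool" where
  "separates W T F G \<longleftrightarrow> \<not> (face_step W T)\<^sup>*\<^sup>* F G"

definition sep :: "web \<Rightarrow> face \<Rightarrow> strand \<Rightarrow> nat" where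
  "sep W F0 e = 1 + card {t \<in> {1, 2, 3}. separates W (trip W t e) (right_face W e) F0}"


section \<open>Boundary words\<close>

datatype letter = Plain nat | Bar nat

text \<open>An edge whose white end is interior has a black boundary vertex, and vice versa.\<close>

definition boundary_letter :: "web \<Rightarrow> face \<Rightarrow> strand \<Rightarrow> letter" where
  "boundary_letter W F0 e =
     (if white_of (fst e) \<in> interior_vertices W then Plain (sep W F0 e) else Bar (sep W F0 e))"

text \<open>The word is given as a list of blocks, one for each crossed side in the clockwise reading order
  \<open>ss\<close>: a block \<open>[i]\<close> for a simple edge and a block \<open>[i, j]\<close>, i.e. \<open>(ij)\<close>, for a split hourglass.
  \<open>concat\<close> yields the plain sequence of labels. Seen from the interior endpoint, counterclockwise
  is right to left and the clockwise boundary order is left to right, so strand 1 comes first.\<close>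

definition boundary_word :: "web \<Rightarrow> face \<Rightarrow> side list \<Rightarrow> letter list list" where
  "boundary_word W F0 ss =
     map (\<lambda>s. map (\<lambda>i. boundary_letter W F0 (s, i)) (rev [0..<weight W s])) ss"

text \<open>For \<open>a = b = c\<close> the centre \<open>O\<close> of the hexagon is the lattice point \<open>(0, 0)\<close>.\<close>

definition sector :: "real \<Rightarrow> point set" where
  "sector \<theta> = {P. \<exists>r \<phi>. 0 \<le> r \<and> 0 \<le> \<phi> \<and> \<phi> \<le> \<theta> \<and> plane P = rcis r (pi / 2 - \<phi>)}"

definition right_half :: "point set" where
  "right_half = {P. 0 \<le> Re (plane P)}"

lemma sector_iff:
  assumes "0 < \<theta>" "\<theta> \<le> pi"
  shows "P \<in> sector \<theta> \<longleftrightarrow> 0 \<le> Re (plane P) \<and> cos \<theta> * Re (plane P) \<le> sin \<theta> * Im (plane P)"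
proof
  assume "P \<in> sector \<theta>"
  then obtain r \<phi> where *: "0 \<le> r" "0 \<le> \<phi>" "\<phi> \<le> \<theta>" "plane P = rcis r (pi/2 - \<phi>)"
    by (auto simp: sector_def)
  have "0 \<le> sin \<phi>" using * assms by (intro sin_ge_zero) auto
  moreover have "0 \<le> sin (\<theta> - \<phi>)" using * assms by (intro sin_ge_zero) auto
  then have "0 \<le> r * sin (\<theta> - \<phi>)" using * by simp
  ultimately show "0 \<le> Re (plane P) \<and> cos \<theta> * Re (plane P) \<le> sin \<theta> * Im (plane P)"
    using * by (simp add: sin_diff cos_diff algebra_simps)
next
  assume *: "0 \<le> Re (plane P) \<and> cos \<theta> * Re (plane P) \<le> sin \<theta> * Im (plane P)"
  show "P \<in> sector \<theta>"
  proof (cases "plane P = 0")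
    case True
    then show ?thesis using assms by (auto simp: sector_def intro!: exI[of _ 0])
  next
    case False
    define r where "r = cmod (plane P)"
    define \<phi> where "\<phi> = pi/2 - Arg (plane P)"
    have r: "r > 0" using False by (simp add: r_def)
    have eq: "plane P = rcis r (pi/2 - \<phi>)" by (simp add: r_def \<phi>_def rcis_cmod_Arg)
    have bd: "-pi < Arg (plane P)" "Arg (plane P) \<le> pi" by (simp_all add: Arg_bounded)
    have s: "0 \<le> sin \<phi>" using * eq r by (simp add: zero_le_mult_iff cos_diff)
    have b2: "- pi/2 \<le> \<phi>" "\<phi> < 3*pi/2" using bd by (auto simp: \<phi>_def)
    have p0: "0 \<le> \<phi>"
    proof (rule ccontr)
      assume "\<not> 0 \<le> \<phi>"
      then have "sin (-\<phi>) > 0" using b2 pi_gt_zero by (intro sin_gt_zero) linarith+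
      with s show False by simp
    qed
    have p1: "\<phi> \<le> pi"
    proof (rule ccontr)
      assume "\<not> \<phi> \<le> pi"
      then have "sin (\<phi> - pi) > 0" using b2 pi_gt_zero by (intro sin_gt_zero) linarith+
      with s show False by (simp add: sin_diff)
    qed
    have "0 \<le> r * sin (\<theta> - \<phi>)" using * eq by (simp add: sin_diff cos_diff algebra_simps)
    then have s2: "0 \<le> sin (\<theta> - \<phi>)" using r by (simp add: zero_le_mult_iff)
    have "\<phi> \<le> \<theta>"
    proof (rule ccontr)
      assume "\<not> \<phi> \<le> \<theta>"
      then have "sin (\<phi> - \<theta>) > 0" using p1 assms by (intro sin_gt_zero) linarith+
      with s2 show False by (simp add: sin_diff algebra_simps)
    qed
    with p0 r eq show ?thesis
      unfolding sector_def by (intro CollectI exI[of _ r] exI[of _ \<phi>]) auto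
  qed
qed

lemma right_half_iff: "(x, y) \<in> right_half \<longleftrightarrow> y \<le> x"
  by (simp add: right_half_def)

lemma sector_120: "(x, y) \<in> sector (2 * pi / 3) \<longleftrightarrow> y \<le> x \<and> y \<le> 0"
proof -
  have c: "cos (2*pi/3) = -1/2" "sin (2*pi/3) = sqrt 3/2" by (simp_all add: cos_120 sin_120)
  have "(x, y) \<in> sector (2 * pi / 3) \<longleftrightarrow> 0 \<le> sqrt 3 * (of_int x - of_int y) \<and> sqrt 3 * of_int y \<le> (0::real)"
    by (subst sector_iff) (simp_all only: c, auto simp: field_simps)
  also have "\<dots> \<longleftrightarrow> y \<le> x \<and> y \<le> 0" by (auto simp: zero_le_mult_iff mult_le_0_iff)
  finally show ?thesis .
qed

lemma sector_60: "(x, y) \<in> sector (pi / 3) \<longleftrightarrow> y \<le> x \<and> x \<le> 0"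
proof -
  have "(x, y) \<in> sector (pi / 3) \<longleftrightarrow> 0 \<le> sqrt 3 * (of_int x - of_int y) \<and> sqrt 3 * of_int x \<le> (0::real)"
    by (subst sector_iff) (auto simp: cos_60 sin_60 field_simps)
  also have "\<dots> \<longleftrightarrow> y \<le> x \<and> x \<le> 0" by (auto simp: zero_le_mult_iff mult_le_0_iff)
  finally show ?thesis .
qed

lemma sector_30: "(x, y) \<in> sector (pi / 6) \<longleftrightarrow> y \<le> x \<and> 2 * x \<le> y"
proof -
  have "(x, y) \<in> sector (pi / 6) \<longleftrightarrow> 0 \<le> sqrt 3 * (of_int x - of_int y) \<and> 2 * of_int x \<le> (of_int y :: real)"
    by (subst sector_iff) (auto simp: cos_30 sin_30 field_simps)
  also have "\<dots> \<longleftrightarrow> y \<le> x \<and> 2 * x \<le> y" by (auto simp: zero_le_mult_iff)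
  finally show ?thesis .
qed

text \<open>The NE, E and SE sides of the hexagon, read clockwise (the first \<open>n\<close> units of the NE side).\<close>

definition NE_side :: "nat \<Rightarrow> nat \<Rightarrow> side list" where
  "NE_side n c = map (\<lambda>i. (proj i 0 c, E1)) [0..<n]"

definition E_side :: "nat \<Rightarrow> nat \<Rightarrow> side list" where
  "E_side a c = map (\<lambda>k. (proj a 0 k, E3)) (rev [0..<c])"

definition SE_side :: "nat \<Rightarrow> nat \<Rightarrow> side list" where
  "SE_side a b = map (\<lambda>j. (proj a j 0, E2)) [0..<b]"

text \<open>The vertical cut runs from the bottom vertex \<open>proj a a 0\<close> up to the top vertex \<open>proj 0 0 c\<close>.\<close>

definition SPP_word :: "nat \<Rightarrow> nat \<Rightarrow> (nat \<times> nat \<times> nat) set \<Rightarrow> letter list list" where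
  "SPP_word a c p = boundary_word (restrict_web (pp_web a a c p) right_half) (Around (proj 0 0 c))
     (NE_side a c @ E_side a c @ SE_side a a @ map (\<lambda>k. (proj a a k, E3)) [0..<a + c])"

definition CSPP_word :: "nat \<Rightarrow> (nat \<times> nat \<times> nat) set \<Rightarrow> letter list list" where
  "CSPP_word a p =
     boundary_word (restrict_web (pp_web a a a p) (sector (2 * pi / 3))) (Around (proj 0 0 a))
     (NE_side a a @ E_side a a @
      map (\<lambda>i. (proj i 0 0, E1)) (rev [0..<a]) @ map (\<lambda>k. (proj 0 0 k, E3)) [0..<a])"

text \<open>The slanted cut runs from the vertex \<open>proj a 0 a\<close> of the hexagon to \<open>O\<close>, in direction \<open>e\<^sub>2\<close>.\<close>

definition TSPP_word :: "nat \<Rightarrow> (nat \<times> nat \<times> nat) set \<Rightarrow> letter list list" where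
  "TSPP_word a p =
     boundary_word (restrict_web (pp_web a a a p) (sector (pi / 3))) (Around (proj 0 0 a))
     (NE_side a a @ map (\<lambda>i. (proj i 0 i, E2)) (rev [1..<a + 1]) @ map (\<lambda>k. (proj 0 0 k, E3)) [0..<a])"

text \<open>For the box of size \<open>a = 2d\<close>, the slanted cut runs from the midpoint \<open>proj d 0 (2 * d)\<close> of the NE
  side to \<open>O\<close>, along the long diagonals of \<open>d\<close> lozenges, from \<open>proj i 0 (2 * i)\<close> to
  \<open>proj (i - 1) 0 (2 * (i - 1))\<close>. It bisects the two triangles of each lozenge, so these are not in the
  sector: the hourglass edge between them disappears, they become boundary vertices, and the edges going
  from them into the sector cross \<open>(proj i 0 (2 * i), E2)\<close> (black endpoint) and
  \<open>(proj (i - 1) 0 (2 * (i - 1)), E3)\<close> (white endpoint). For \<open>i = 1\<close> the latter side is on the vertical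
  cut; neither of its triangles is in the sector, its edge is discarded, and so the list of sides on the
  slanted cut loses its last element and the list for the vertical cut starts at 1.\<close>

definition TSSCPP_word :: "nat \<Rightarrow> (nat \<times> nat \<times> nat) set \<Rightarrow> letter list list" where
  "TSSCPP_word d p =
     boundary_word (restrict_web (pp_web (2 * d) (2 * d) (2 * d) p) (sector (pi / 6)))
     (Around (proj 0 0 (2 * d)))
     (NE_side d (2 * d) @
      butlast (concat (map (\<lambda>i. [(proj i 0 (2 * i), E2), (proj (i - 1) 0 (2 * (i - 1)), E3)])
        (rev [1..<d + 1]))) @
      map (\<lambda>k. (proj 0 0 k, E3)) [1..<2 * d])"

definition yamanouchi :: "'a \<Rightarrow> 'a \<Rightarrow> 'a list \<Rightarrow> bool" where
  "yamanouchi x y w \<longleftrightarrow> (\<forall>n \<le> length w. count_list (take n w) y \<le> count_list (take n w) x)"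

end

theory Submission
  imports Defs
begin

text \<open>The proof rests on the height function of a plane partition. Lift every lattice point of the hexagon
  to the visible point \<open>(i, j, k)\<close> of the surface above it. Along a side in direction \<open>e\<^sub>u\<close> the coordinate
  number \<open>u\<close> grows by 1 and the other two stay, unless the side is the diagonal of a lozenge; then the
  web has an hourglass across it, coordinate \<open>u\<close> stays and the other two drop by 1. The increments around a
  triangle add up to 0, so every triangle has exactly one hourglass (\<open>hourglass_cases\<close>).

  The trips are level lines. In a triangle, \<open>trip\<^sub>1\<close> and \<open>trip\<^sub>3\<close> always pass from a side to a
  neighbouring one in such a way that they keep straight on between two adjacent lattice lines,
  wherever the hourglasses are. And \<open>trip\<^sub>2\<close> crosses each lozenge from a side to the
  opposite one, so it follows a level line of one coordinate of the surface. In both cases a trip stays among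
  the strands of a \<open>track\<close>: those strands of a fixed family across which a potential (an affine function, or a
  coordinate of the surface) passes a fixed threshold. It is the whole track: from each strand of the
  track one can run on, with a monotone measure, until the track leaves the sector, and the potential is
  monotone along the part of the boundary where this happens, so that there is only one exit
  (\<open>ends_unique\<close>, \<open>trip_eq_track\<close>).

  Hence a trip separates two faces if the potential puts them on different sides of the threshold
  (\<open>separates_track\<close>), and does not separate them if a walk through faces on the same side joins them
  (\<open>linked_face_steps\<close>); pieces of the boundary are such walks, since the potentials are monotone
  there. The only other trips are those that turn back in a cut hourglass; they isolate nothing but the face between
  the two strands. Comparing potentials at a boundary face and at \<open>F\<^sub>0\<close> yields all labels, and
  each boundary word depends only on the set of boundary sides that carry an hourglass.

  On the cuts these sides are read off from the set \<open>B\<close> of the numbers \<open>p\<^sub>i\<^sub>i - i\<close>: the vertical cut has an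
  hourglass \<open>q\<close> units above the projection of the origin of the box iff \<open>q \<in> B\<close>, the slanted cut repeats this in the cyclically symmetric case
  and shows the negative elements of \<open>B\<close> in the totally symmetric case. It remains to see which sets occur.
  For \<open>SPP\<close> it is every \<open>a\<close>-subset of \<open>{-a..<c}\<close>. For \<open>TSPP\<close> it is those with at most \<open>n + 1\<close>
  elements in \<open>{-n - 1..n}\<close> for all \<open>n\<close>: necessity is \<open>TSPP_window\<close>, and conversely the order ideal
  generated by the permutations of the points \<open>(i, i, p\<^sub>i\<^sub>i)\<close> has the right diagonal (\<open>TSPP_realised\<close>). These ideals realise
  every nonnegative part, which settles \<open>CSPP\<close>. For \<open>TSSCPP\<close> the set is moreover invariant under \<open>s \<mapsto> -1 - s\<close>,
  which turns the window condition into the Yamanouchi condition (\<open>TSSCPP_realised\<close>).\<close>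

section \<open>Webs of stepped surfaces\<close>

fun next_dir :: "dir \<Rightarrow> dir" where
  "next_dir E1 = E2" | "next_dir E2 = E3" | "next_dir E3 = E1"

fun prev_dir :: "dir \<Rightarrow> dir" where
  "prev_dir E1 = E3" | "prev_dir E2 = E1" | "prev_dir E3 = E2"

lemma dir_cases: "u = r \<or> u = next_dir r \<or> u = prev_dir r"
  by (cases u; cases r) auto

lemma dir_simps [simp]:
  "next_dir r \<noteq> r" "prev_dir r \<noteq> r" "r \<noteq> next_dir r" "r \<noteq> prev_dir r" "next_dir r \<noteq> prev_dir r" "prev_dir r \<noteq> next_dir r"
  "next_dir (next_dir r) = prev_dir r" "prev_dir (prev_dir r) = next_dir r"
  "next_dir (prev_dir r) = r" "prev_dir (next_dir r) = r"
  by (cases r; simp)+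

text \<open>Here \<open>K\<close> is the third coordinate of the surface point above a lattice point; the other two follow, because
  \<open>(i, j, k)\<close> projects to \<open>(i - k, j - k)\<close>.\<close>

fun coord :: "(point \<Rightarrow> int) \<Rightarrow> dir \<Rightarrow> point \<Rightarrow> int" where
  "coord K E1 (x, y) = x + K (x, y)"
| "coord K E2 (x, y) = y + K (x, y)"
| "coord K E3 (x, y) = K (x, y)"

text \<open>Consecutive values belong to the two lattice lines that bound a strip in the given direction.\<close>

fun offset :: "dir \<Rightarrow> point \<Rightarrow> int" where
  "offset E1 (x, y) = y"
| "offset E2 (x, y) = x"
| "offset E3 (x, y) = x - y"

definition crosses :: "(point \<Rightarrow> int) \<Rightarrow> int \<Rightarrow> side \<Rightarrow> bool" where
  "crosses f n s \<longleftrightarrow> (f (fst s) < n \<longleftrightarrow> \<not> f (fst s + vec (snd s)) < n)"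

datatype family = Strip dir | Ribbon dir

fun trip_number :: "family \<Rightarrow> nat" where
  "trip_number (Strip r) = 1"
| "trip_number (Ribbon r) = 2"

text \<open>The heading with which the trip \<open>trip_number\<close> traverses the strands of a family that cross a side in direction \<open>u\<close>.
  A strip in direction \<open>r\<close> is run through towards \<open>- e\<^sub>r\<close>.\<close>

fun forward :: "family \<Rightarrow> dir \<Rightarrow> heading" where
  "forward (Strip r) u = (if u = next_dir r then ToWhite else ToBlack)"
| "forward (Ribbon r) u = (if u = r then ToWhite else ToBlack)"

text \<open>A multiple of an affine function of the midpoint of a side, chosen such that it strictly increases in the
  forward direction of the family.\<close>

fun advance :: "family \<Rightarrow> side \<Rightarrow> int" where
  "advance (Strip E1) (P, u) = - offset E2 P - offset E2 (P + vec u)"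
| "advance (Strip E2) (P, u) = - offset E1 P - offset E1 (P + vec u)"
| "advance (Strip E3) (P, u) = offset E1 P + offset E1 (P + vec u)"
| "advance (Ribbon E1) (P, u) = offset E1 P + offset E1 (P + vec u)"
| "advance (Ribbon E2) (P, u) = - offset E2 P - offset E2 (P + vec u)"
| "advance (Ribbon E3) (P, u) = offset E3 P + offset E3 (P + vec u)"

fun at_heading :: "heading \<Rightarrow> side \<Rightarrow> triangle" where
  "at_heading ToWhite s = white_of s"
| "at_heading ToBlack s = black_of s"

fun flip :: "heading \<Rightarrow> heading" where
  "flip ToWhite = ToBlack" | "flip ToBlack = ToWhite"

fun dir_of :: "family \<Rightarrow> dir" where
  "dir_of (Strip r) = r" | "dir_of (Ribbon r) = r"

text \<open>A web with a height function. The first condition alone makes \<open>K\<close> the height function of a surface that consists of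
  unit squares; the second says that the hourglasses of the web are the lozenges of this surface.\<close>

locale stepped_web =
  fixes K :: "point \<Rightarrow> int" and D :: "point set" and H :: "side set"
  assumes stepped: "coord K u (P + vec u) \<in> {coord K u P, coord K u P + 1}"
    and hourglass_iff: "P \<in> D \<Longrightarrow> P + vec u \<in> D \<Longrightarrow> (P, u) \<in> H \<longleftrightarrow> coord K u (P + vec u) = coord K u P"
begin

definition W :: web where
  "W = \<lparr>interior_vertices = {v. corners v \<subseteq> D}, hourglasses = H\<rparr>"

abbreviation V where "V \<equiv> {v. corners v \<subseteq> D}"

lemma W_simps [simp]: "interior_vertices W = V" "hourglasses W = H"
  by (simp_all add: W_def)

lemma weight_simps: "s \<in> H \<Longrightarrow> weight W s = 2" "s \<notin> H \<Longrightarrow> weight W s = 1"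
  by (simp_all add: weight_def)

fun potential :: "family \<Rightarrow> point \<Rightarrow> int" where
  "potential (Strip r) = offset r"
| "potential (Ribbon r) = coord K r"

text \<open>The two families. \<open>Strip r\<close> consists of the strands that \<open>trip\<^sub>1\<close> uses in the strips in direction \<open>r\<close>, and
  \<open>Ribbon r\<close> of those that \<open>trip\<^sub>2\<close> uses when it enters and leaves lozenges through sides in direction \<open>r\<close>.
  Both take strand 0 of an hourglass across a side in direction \<open>next_dir r\<close> and strand 1 for \<open>prev_dir r\<close>.\<close>

fun runs_on :: "family \<Rightarrow> strand \<Rightarrow> bool" where
  "runs_on (Strip r) (s, i) \<longleftrightarrow> snd s = next_dir r \<and> i = 0 \<or> snd s = prev_dir r \<and> i = weight W s - 1"
| "runs_on (Ribbon r) (s, i) \<longleftrightarrow>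
     (if s \<in> H then snd s = next_dir r \<and> i = 0 \<or> snd s = prev_dir r \<and> i = 1 else snd s = r \<and> i = 0)"

definition track :: "family \<Rightarrow> int \<Rightarrow> strand set" where
  "track f n = {(s, i) \<in> strands W. runs_on f (s, i) \<and> crosses (potential f) n s}"

lemma stepped_sides:
  "K (x - 1, y - 1) \<in> {K (x, y), K (x, y) + 1}"
  "K (x, y + 1) \<in> {K (x, y), K (x, y) - 1}"
  "K (x + 1, y) \<in> {K (x, y), K (x, y) - 1}"
  using stepped[of E3 "(x, y)"] stepped[of E2 "(x, y)"] stepped[of E1 "(x, y)"] by auto

lemma hourglass_sides:
  "(x, y) \<in> D \<Longrightarrow> (x - 1, y - 1) \<in> D \<Longrightarrow> ((x, y), E3) \<in> H \<longleftrightarrow> K (x - 1, y - 1) = K (x, y)"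
  "(x, y) \<in> D \<Longrightarrow> (x, y + 1) \<in> D \<Longrightarrow> ((x, y), E2) \<in> H \<longleftrightarrow> K (x, y + 1) = K (x, y) - 1"
  "(x, y) \<in> D \<Longrightarrow> (x + 1, y) \<in> D \<Longrightarrow> ((x, y), E1) \<in> H \<longleftrightarrow> K (x + 1, y) = K (x, y) - 1"
  using hourglass_iff[of "(x, y)" E3] hourglass_iff[of "(x, y)" E2] hourglass_iff[of "(x, y)" E1] by auto

text \<open>Around a triangle, the increment of \<open>K\<close> is \<open>-1\<close> for each hourglass, and an additional \<open>1\<close> for the side in direction
  \<open>e\<^sub>3\<close>; the sum is 0.\<close>

lemma hourglass_cases:
  assumes "corners v \<subseteq> D" and "ccw_sides v = [a, b, c]"
  shows "a \<in> H \<and> b \<notin> H \<and> c \<notin> H \<or> a \<notin> H \<and> b \<in> H \<and> c \<notin> H \<or> a \<notin> H \<and> b \<notin> H \<and> c \<in> H"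
proof (cases v)
  case (White P)
  obtain x y where P: "P = (x, y)" by (cases P)
  have D: "(x, y) \<in> D" "(x - 1, y - 1) \<in> D" "(x, y - 1) \<in> D"
    using assms(1) by (auto simp: White P)
  have abc: "a = ((x, y), E3)" "b = ((x, y - 1), E2)" "c = ((x - 1, y - 1), E1)"
    using assms(2) by (auto simp: White P)
  show ?thesis
    using stepped_sides(1)[of x y] stepped_sides(2)[of x "y - 1"] stepped_sides(3)[of "x - 1" "y - 1"]
      hourglass_sides(1)[of x y] hourglass_sides(2)[of x "y - 1"] hourglass_sides(3)[of "x - 1" "y - 1"] D
    by (simp add: abc) linarith
next
  case (Black P)
  obtain x y where P: "P = (x, y)" by (cases P)
  have D: "(x, y) \<in> D" "(x - 1, y - 1) \<in> D" "(x - 1, y) \<in> D"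
    using assms(1) by (auto simp: Black P)
  have abc: "a = ((x, y), E3)" "b = ((x - 1, y - 1), E2)" "c = ((x - 1, y), E1)"
    using assms(2) by (auto simp: Black P)
  show ?thesis
    using stepped_sides(1)[of x y] stepped_sides(2)[of "x - 1" "y - 1"] stepped_sides(3)[of "x - 1" y]
      hourglass_sides(1)[of x y] hourglass_sides(2)[of "x - 1" "y - 1"] hourglass_sides(3)[of "x - 1" y] D
    by (simp add: abc) linarith
qed

lemma length_ccw_strands:
  assumes "corners v \<subseteq> D"
  shows "length (ccw_strands W v) = 4"
proof -
  obtain a b c where abc: "ccw_sides v = [a, b, c]" by (cases v) auto
  show ?thesis
    using hourglass_cases[OF assms abc] by (auto simp: ccw_strands_def abc weight_simps)
qed

lemma distinct_ccw_strands: "distinct (ccw_strands W v)"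
proof -
  obtain a b c where abc: "ccw_sides v = [a, b, c]" by (cases v) auto
  have "a \<noteq> b" "b \<noteq> c" "a \<noteq> c" using abc by (cases v; auto)+
  then show ?thesis by (auto simp: ccw_strands_def abc distinct_map inj_on_def)
qed

subsection \<open>Trip steps\<close>

lemma ccw_step_right_unique:
  "ccw_step W v t e e1 \<Longrightarrow> ccw_step W v t e e2 \<Longrightarrow> e1 = e2"
  using distinct_ccw_strands[of v] by (auto simp: ccw_step_def Let_def nth_eq_iff_index_eq)

lemma ccw_step_left_unique:
  assumes "ccw_step W v t e1 e" "ccw_step W v t e2 e"
  shows "e1 = e2"
proof -
  define L where "L = ccw_strands W v"
  obtain m n where *: "m < length L" "n < length L" "e1 = L ! m" "e2 = L ! n"
     "L ! ((m + t) mod length L) = L ! ((n + t) mod length L)"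
    using assms by (auto simp: ccw_step_def Let_def L_def)
  moreover have "0 < length L" using *(1) by linarith
  then have "(m + t) mod length L < length L" "(n + t) mod length L < length L" by simp_all
  moreover have "distinct L" by (simp add: L_def distinct_ccw_strands)
  ultimately have "(m + t) mod length L = (n + t) mod length L"
    by (simp only: nth_eq_iff_index_eq)
  then have "m mod length L = n mod length L"
    by (simp add: mod_eq_iff_dvd_symdiff_nat)
  then show ?thesis using * by simp
qed

lemma ccw_step_sides:
  assumes "ccw_step W v t e e'"
  shows "fst e \<in> set (ccw_sides v)" "fst e' \<in> set (ccw_sides v)"
proof -
  obtain n where n: "n < length (ccw_strands W v)" "e = ccw_strands W v ! n"
    "e' = ccw_strands W v ! ((n + t) mod length (ccw_strands W v))"
    using assms unfolding ccw_step_def Let_def by blast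
  then have "(n + t) mod length (ccw_strands W v) < length (ccw_strands W v)"
    by (intro mod_less_divisor) linarith
  with n have "e \<in> set (ccw_strands W v)" "e' \<in> set (ccw_strands W v)"
    by (simp_all only: nth_mem)
  then show "fst e \<in> set (ccw_sides v)" "fst e' \<in> set (ccw_sides v)"
    by (auto simp: ccw_strands_def)
qed

lemma side_of_black:
  assumes "s \<in> set (ccw_sides (black_of s'))"
  shows "black_of s = black_of s'"
proof -
  obtain Q where "black_of s' = Black Q" by (cases s' rule: black_of.cases) auto
  then show ?thesis using assms in_ccw_sides_iff(2)[of s Q] by simp
qed

lemma side_of_white:
  assumes "s \<in> set (ccw_sides (white_of s'))"
  shows "white_of s = white_of s'"
proof -
  obtain Q where "white_of s' = White Q" by (cases s' rule: white_of.cases) auto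
  then show ?thesis using assms in_ccw_sides_iff(1)[of s Q] by simp
qed

lemma ccw_step_black: "ccw_step W (black_of s) t e e' \<Longrightarrow> black_of (fst e) = black_of s \<and> black_of (fst e') = black_of s"
  using ccw_step_sides side_of_black by metis

lemma ccw_step_white: "ccw_step W (white_of s) t e e' \<Longrightarrow> white_of (fst e) = white_of s \<and> white_of (fst e') = white_of s"
  using ccw_step_sides side_of_white by metis

lemma trip_step_iff:
  "trip_step W t (e, h) (e', h') \<longleftrightarrow>
     h = ToBlack \<and> h' = ToWhite \<and> black_of (fst e) \<in> V \<and> ccw_step W (black_of (fst e)) t e e' \<or>
     h = ToWhite \<and> h' = ToBlack \<and> white_of (fst e) \<in> V \<and> ccw_step W (white_of (fst e)) t e' e"
  unfolding trip_step.simps[of W t "(e, h)"] W_simps by blast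

lemma trip_step_right_unique:
  assumes "trip_step W t st st1" "trip_step W t st st2"
  shows "st1 = st2"
  using assms by (auto elim!: trip_step.cases dest: ccw_step_right_unique ccw_step_left_unique)

lemma trip_step_left_unique:
  assumes "trip_step W t st1 st" "trip_step W t st2 st"
  shows "st1 = st2"
proof -
  obtain e h where st: "st = (e, h)" by (cases st)
  show ?thesis
  proof (cases h)
    case ToWhite
    then obtain e1 e2 where *: "st1 = (e1, ToBlack)" "st2 = (e2, ToBlack)"
      "ccw_step W (black_of (fst e1)) t e1 e" "ccw_step W (black_of (fst e2)) t e2 e"
      using assms st by (auto elim!: trip_step.cases)
    then have "black_of (fst e1) = black_of (fst e2)"
      using ccw_step_black[OF *(3)] ccw_step_black[OF *(4)] by simp
    then show ?thesis using * ccw_step_left_unique by metis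
  next
    case ToBlack
    then obtain e1 e2 where *: "st1 = (e1, ToWhite)" "st2 = (e2, ToWhite)"
      "ccw_step W (white_of (fst e1)) t e e1" "ccw_step W (white_of (fst e2)) t e e2"
      using assms st by (auto elim!: trip_step.cases)
    then have "white_of (fst e1) = white_of (fst e2)"
      using ccw_step_white[OF *(3)] ccw_step_white[OF *(4)] by simp
    then show ?thesis using * ccw_step_right_unique by metis
  qed
qed

lemma ccw_step_4:
  assumes "ccw_strands W v = [a, b, c, d]"
  shows "ccw_step W v 1 e e' \<longleftrightarrow> (e, e') \<in> {(a, b), (b, c), (c, d), (d, a)}"
    and "ccw_step W v 2 e e' \<longleftrightarrow> (e, e') \<in> {(a, c), (b, d), (c, a), (d, b)}"
    and "ccw_step W v 3 e e' \<longleftrightarrow> (e, e') \<in> {(a, d), (b, a), (c, b), (d, c)}"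
proof -
  have ex4: "(\<exists>n < Suc (Suc (Suc (Suc 0))). P n) \<longleftrightarrow> P 0 \<or> P 1 \<or> P 2 \<or> P 3" for P :: "nat \<Rightarrow> bool"
    by (auto simp: less_Suc_eq numeral_eq_Suc)
  show "ccw_step W v 1 e e' \<longleftrightarrow> (e, e') \<in> {(a, b), (b, c), (c, d), (d, a)}"
    by (simp add: ccw_step_def Let_def assms ex4 del: ex_simps)
  show "ccw_step W v 2 e e' \<longleftrightarrow> (e, e') \<in> {(a, c), (b, d), (c, a), (d, b)}"
    by (simp add: ccw_step_def Let_def assms ex4 del: ex_simps)
  show "ccw_step W v 3 e e' \<longleftrightarrow> (e, e') \<in> {(a, d), (b, a), (c, b), (d, c)}"
    by (simp add: ccw_step_def Let_def assms ex4 del: ex_simps)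
qed

lemma ccw_step_reverse:
  assumes v: "corners v \<subseteq> D" and t: "t \<in> {1, 2, 3}"
  shows "ccw_step W v t e e' \<longleftrightarrow> ccw_step W v (4 - t) e' e"
proof -
  obtain a b c d where "ccw_strands W v = [a, b, c, d]"
    using length_ccw_strands[OF v] by (auto simp: length_Suc_conv eval_nat_numeral)
  note st = ccw_step_4[OF this, of e e'] ccw_step_4[OF this, of e' e]
  show ?thesis
    using t by (elim insertE emptyE) (auto simp add: st st(1,4)[unfolded One_nat_def])
qed

text \<open>Every vertex has degree 4, so \<open>t\<close> steps counterclockwise are \<open>4 - t\<close> steps clockwise. Therefore \<open>trip\<^sub>3\<close> is
  \<open>trip\<^sub>1\<close> traversed backwards.\<close>

lemma trip_step_reverse:
  assumes "t \<in> {1, 2, 3}"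
  shows "trip_step W t (e, h) (e', h') \<longleftrightarrow> trip_step W (4 - t) (e', flip h') (e, flip h)"
proof -
  note rev = ccw_step_reverse[OF _ assms]
  have black: "black_of (fst e) = black_of (fst e')" if "ccw_step W (black_of (fst d)) t' e e'" for d t' e e'
    using ccw_step_black[OF that] by simp
  have white: "white_of (fst e) = white_of (fst e')" if "ccw_step W (white_of (fst d)) t' e e'" for d t' e e'
    using ccw_step_white[OF that] by simp
  show ?thesis
  proof (cases h; cases h')
    assume h: "h = ToBlack" "h' = ToWhite"
    show ?thesis
      unfolding trip_step_iff h flip.simps using rev black by (metis heading.distinct(1) mem_Collect_eq)
  next
    assume h: "h = ToWhite" "h' = ToBlack"
    show ?thesis
      unfolding trip_step_iff h flip.simps using rev white by (metis heading.distinct(1) mem_Collect_eq)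
  qed (simp_all add: trip_step_iff)
qed

subsection \<open>Tracks\<close>

definition is_edge :: "side \<Rightarrow> bool" where
  "is_edge s \<longleftrightarrow> white_of s \<in> V \<or> black_of s \<in> V"

lemma strands_W_iff: "(s, i) \<in> strands W \<longleftrightarrow> is_edge s \<and> i < weight W s"
  by (simp only: strands_def W_simps is_edge_def mem_Collect_eq prod.case)

lemma is_edge_in_D:
  assumes "is_edge s"
  shows "fst s \<in> D" "fst s + vec (snd s) \<in> D"
  using assms side_corners[of s] unfolding is_edge_def by blast+

lemma hourglass_no_cross:
  assumes "is_edge (P, u)" "(P, u) \<in> H"
  shows "coord K u (P + vec u) = coord K u P"
  using is_edge_in_D[OF assms(1)] hourglass_iff[of P u] assms(2) by simp

lemma simple_coord:
  assumes "is_edge (P, u)" "(P, u) \<notin> H"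
  shows "coord K r (P + vec u) = (if r = u then coord K r P + 1 else coord K r P)"
proof -
  have "coord K u (P + vec u) = coord K u P + 1"
    using is_edge_in_D[OF assms(1)] hourglass_iff[of P u] stepped[of u P] assms(2) by simp
  then show ?thesis by (cases P; cases u; cases r) auto
qed

lemma hourglass_coord:
  assumes "is_edge (P, u)" "(P, u) \<in> H"
  shows "coord K r (P + vec u) = (if r = u then coord K r P else coord K r P - 1)"
  using hourglass_no_cross[OF assms] by (cases P; cases u; cases r) auto

text \<open>The only strand across a given side that can belong to the family.\<close>

definition carrier :: "family \<Rightarrow> side \<Rightarrow> nat" where
  "carrier f s = (if s \<in> H \<and> snd s = prev_dir (dir_of f) then 1 else 0)"

lemma carrier_unique: "(s, i) \<in> track f n \<Longrightarrow> i = carrier f s"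
  by (cases f; cases "dir_of f") (auto simp: track_def carrier_def weight_simps split: if_splits)

lemma track_crosses: "(s, i) \<in> track f n \<Longrightarrow> crosses (potential f) n s"
  by (simp add: track_def)

lemma crossing_carried:
  assumes "is_edge s" "crosses (potential f) n s"
  shows "(s, carrier f s) \<in> track f n"
proof -
  obtain P u where s: "s = (P, u)" by (cases s)
  obtain x y where P: "P = (x, y)" by (cases P)
  have "runs_on f (s, carrier f s)"
  proof (cases f)
    case (Strip r)
    then have "u \<noteq> r" using assms(2) by (cases u; cases r; simp add: s P crosses_def)
    then show ?thesis
      by (cases u; cases r; cases "s \<in> H") (simp_all add: Strip carrier_def weight_simps s)
  next
    case (Ribbon r)
    show ?thesis
    proof (cases "s \<in> H")
      case True
      then have "u \<noteq> r" using assms(2) hourglass_coord[of P u r] assms(1) by (auto simp: s Ribbon crosses_def)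
      then show ?thesis using True
        by (cases u; cases r) (simp_all add: Ribbon carrier_def s)
    next
      case False
      then have "u = r" using assms(2) simple_coord[of P u r] assms(1) by (auto simp: s Ribbon crosses_def split: if_splits)
      then show ?thesis using False by (simp add: Ribbon carrier_def s)
    qed
  qed
  moreover have "carrier f s < weight W s" by (auto simp: carrier_def weight_def)
  ultimately show ?thesis using assms by (simp add: track_def strands_W_iff)
qed

lemma track_iff: "(s, i) \<in> track f n \<longleftrightarrow> is_edge s \<and> i = carrier f s \<and> crosses (potential f) n s"
proof
  assume track: "(s, i) \<in> track f n"
  then have "is_edge s" by (simp add: track_def strands_W_iff)
  then show "is_edge s \<and> i = carrier f s \<and> crosses (potential f) n s"
    using carrier_unique[OF track] track_crosses[OF track] by blast
qed (use crossing_carried in blast)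

text \<open>The side of a triangle in a given direction; this form of \<open>ccw_sides\<close> lets the symmetry of the three directions
  be used.\<close>

fun side_at :: "triangle \<Rightarrow> dir \<Rightarrow> side" where
  "side_at (White P) E1 = (P + vec E3, E1)"
| "side_at (White P) E2 = (P + vec E3 + vec E1, E2)"
| "side_at (White P) E3 = (P, E3)"
| "side_at (Black P) E1 = (P + vec E3 + vec E2, E1)"
| "side_at (Black P) E2 = (P + vec E3, E2)"
| "side_at (Black P) E3 = (P, E3)"

lemma ccw_sides_side_at: "ccw_sides v = [side_at v E3, side_at v E2, side_at v E1]"
  by (cases v) simp_all

lemma snd_side_at [simp]: "snd (side_at v u) = u"
  by (cases v; cases u) simp_all

lemma side_at_cases:
  assumes "s \<in> set (ccw_sides v)"
  shows "s = side_at v (snd s)"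
  using assms unfolding ccw_sides_side_at by auto

lemma is_edge_at:
  assumes "corners v \<subseteq> D" "s \<in> set (ccw_sides v)"
  shows "is_edge s"
proof (cases v)
  case (White Q)
  then have "white_of s = v" using assms(2) in_ccw_sides_iff(1) by blast
  then show ?thesis using assms(1) unfolding is_edge_def by simp
next
  case (Black Q)
  then have "black_of s = v" using assms(2) in_ccw_sides_iff(2) by blast
  then show ?thesis using assms(1) unfolding is_edge_def by simp
qed

lemma one_hourglass:
  assumes "corners v \<subseteq> D"
  obtains u where "\<And>u'. side_at v u' \<in> H \<longleftrightarrow> u' = u"
proof -
  consider "side_at v E3 \<in> H \<and> side_at v E2 \<notin> H \<and> side_at v E1 \<notin> H"
    | "side_at v E3 \<notin> H \<and> side_at v E2 \<in> H \<and> side_at v E1 \<notin> H"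
    | "side_at v E3 \<notin> H \<and> side_at v E2 \<notin> H \<and> side_at v E1 \<in> H"
    using hourglass_cases[OF assms ccw_sides_side_at] by blast
  then show thesis
  proof cases
    case 1 then show thesis using that[of E3] by (metis dir.exhaust)
  next
    case 2 then show thesis using that[of E2] by (metis dir.exhaust)
  next
    case 3 then show thesis using that[of E1] by (metis dir.exhaust)
  qed
qed

lemma ccw_steps:
  assumes "\<And>u'. side_at v u' \<in> H \<longleftrightarrow> u' = u"
  shows "ccw_step W v 1 e e' \<longleftrightarrow> (e, e') \<in>
      {((side_at v u, 0), (side_at v u, 1)), ((side_at v u, 1), (side_at v (prev_dir u), 0)),
       ((side_at v (prev_dir u), 0), (side_at v (next_dir u), 0)), ((side_at v (next_dir u), 0), (side_at v u, 0))}" (is ?one)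
    and "ccw_step W v 2 e e' \<longleftrightarrow> (e, e') \<in>
      {((side_at v u, 0), (side_at v (prev_dir u), 0)), ((side_at v (prev_dir u), 0), (side_at v u, 0)),
       ((side_at v u, 1), (side_at v (next_dir u), 0)), ((side_at v (next_dir u), 0), (side_at v u, 1))}" (is ?two)
proof -
  have *: "ccw_strands W v = concat (map (\<lambda>u'. if u' = u then [(side_at v u', 0), (side_at v u', 1)]
      else [(side_at v u', 0)]) [E3, E2, E1])"
    using assms by (simp add: ccw_strands_def ccw_sides_side_at weight_def numeral_2_eq_2)
  have "?one \<and> ?two"
  proof (cases u)
    case E1
    with * have L: "ccw_strands W v = [(side_at v E3, 0), (side_at v E2, 0), (side_at v E1, 0), (side_at v E1, 1)]" by simp
    show ?thesis unfolding ccw_step_4(1,2)[OF L] E1 next_dir.simps prev_dir.simps by blast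
  next
    case E2
    with * have L: "ccw_strands W v = [(side_at v E3, 0), (side_at v E2, 0), (side_at v E2, 1), (side_at v E1, 0)]" by simp
    show ?thesis unfolding ccw_step_4(1,2)[OF L] E2 next_dir.simps prev_dir.simps by blast
  next
    case E3
    with * have L: "ccw_strands W v = [(side_at v E3, 0), (side_at v E3, 1), (side_at v E2, 0), (side_at v E1, 0)]" by simp
    show ?thesis unfolding ccw_step_4(1,2)[OF L] E3 next_dir.simps prev_dir.simps by blast
  qed
  then show ?one ?two by blast+
qed

text \<open>A function returns to its initial value around a triangle, so it passes a threshold on none or on two of the three sides.\<close>

lemma crosses_parity:
  "crosses g n (side_at v r) \<longleftrightarrow> crosses g n (side_at v (next_dir r)) \<noteq> crosses g n (side_at v (prev_dir r))"
proof -
  obtain x y where "v = White (x, y) \<or> v = Black (x, y)" by (metis surj_pair triangle.exhaust)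
  then show ?thesis by (elim disjE; cases r) (auto simp: crosses_def)
qed

fun heading_to :: "triangle \<Rightarrow> heading" where
  "heading_to (White P) = ToWhite" | "heading_to (Black P) = ToBlack"

lemma advance_strip:
  "if heading_to v = ToWhite
   then advance (Strip r) (side_at v (next_dir r)) < advance (Strip r) (side_at v (prev_dir r))
   else advance (Strip r) (side_at v (prev_dir r)) < advance (Strip r) (side_at v (next_dir r))"
proof -
  obtain x y where "v = White (x, y) \<or> v = Black (x, y)" by (metis surj_pair triangle.exhaust)
  then show ?thesis by (elim disjE; cases r) auto
qed

lemma advance_ribbon:
  assumes "u \<noteq> r"
  shows "if heading_to v = ToWhite
   then advance (Ribbon r) (side_at v r) < advance (Ribbon r) (side_at v u)
   else advance (Ribbon r) (side_at v u) < advance (Ribbon r) (side_at v r)"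
proof -
  obtain x y where "v = White (x, y) \<or> v = Black (x, y)" by (metis surj_pair triangle.exhaust)
  then show ?thesis using assms by (elim disjE; cases r; cases u) auto
qed

text \<open>A track that enters a triangle leaves it again, and by a step of the trip. For a strip, the two sides are those not in direction
  \<open>r\<close>, whose strands in the family are neighbours around the triangle. For a ribbon, they are the side in
  direction \<open>r\<close> and the one with the hourglass, whose strand in the family is the opposite one.\<close>

lemma track_at:
  assumes v: "corners v \<subseteq> D" and g: "g \<in> track f n" "fst g \<in> set (ccw_sides v)"
  shows "\<exists>g'\<in>track f n. fst g' \<in> set (ccw_sides v) \<and> forward f (snd (fst g')) = flip (forward f (snd (fst g))) \<and>
    (if forward f (snd (fst g)) = heading_to v then advance f (fst g) < advance f (fst g')
     else advance f (fst g') < advance f (fst g)) \<and>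
    (if forward f (snd (fst g)) = ToBlack then ccw_step W v (trip_number f) g g' else ccw_step W v (trip_number f) g' g)"
proof -
  obtain u where u: "side_at v u' \<in> H \<longleftrightarrow> u' = u" for u' using one_hourglass[OF v] by blast
  note steps = ccw_steps[OF u]
  have mem: "side_at v w \<in> set (ccw_sides v)" for w by (cases w) (simp_all add: ccw_sides_side_at del: ccw_sides.simps)
  have edge: "is_edge (side_at v w)" for w using is_edge_at[OF v mem] .
  have track: "(side_at v w, carrier f (side_at v w)) \<in> track f n" if "crosses (potential f) n (side_at v w)" for w
    using that edge by (simp add: track_iff)
  have hv: "heading_to v = ToWhite \<or> heading_to v = ToBlack" by (cases v) simp_all
  obtain w where w: "g = (side_at v w, carrier f (side_at v w))" "crosses (potential f) n (side_at v w)"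
    using g side_at_cases[OF g(2)] by (cases g) (metis track_iff fst_conv)
  show ?thesis
  proof (cases f)
    case (Strip r)
    have "\<not> crosses (potential f) n (side_at v r)"
      by (cases "side_at v r") (use snd_side_at[of v r] in \<open>cases r; auto simp: Strip crosses_def\<close>)
    then have cr: "crosses (potential f) n (side_at v (next_dir r))" "crosses (potential f) n (side_at v (prev_dir r))"
      and "w \<noteq> r"
      using crosses_parity[of "potential f" n v r] w(2) dir_cases[of w r] by auto
    have carriers: "carrier f (side_at v (next_dir r)) = 0"
      "carrier f (side_at v (prev_dir r)) = (if prev_dir r = u then 1 else 0)"
      by (simp_all add: carrier_def Strip u)
    have step: "ccw_step W v (trip_number f) (side_at v (prev_dir r), carrier f (side_at v (prev_dir r)))
        (side_at v (next_dir r), carrier f (side_at v (next_dir r)))"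
      unfolding carriers unfolding Strip trip_number.simps steps(1)
      using dir_cases[of r u] by (elim disjE) simp_all
    have fw: "forward f (next_dir r) = ToWhite" "forward f (prev_dir r) = ToBlack" by (simp_all add: Strip)
    have "w = next_dir r \<or> w = prev_dir r" using \<open>w \<noteq> r\<close> dir_cases[of w r] by blast
    then show ?thesis
    proof
      assume "w = next_dir r"
      then show ?thesis
        using step fw w(1) advance_strip[of v r, folded Strip] mem hv
        by (intro bexI[OF _ track[OF cr(2)]]) (auto simp del: ccw_sides.simps)
    next
      assume "w = prev_dir r"
      then show ?thesis
        using step fw w(1) advance_strip[of v r, folded Strip] mem hv
        by (intro bexI[OF _ track[OF cr(1)]]) (auto simp del: ccw_sides.simps)
    qed
  next
    case (Ribbon r)
    have simple: "\<not> crosses (potential f) n (side_at v w')" if "w' \<noteq> u" "w' \<noteq> r" for w'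
      using simple_coord[of "fst (side_at v w')" w' r] edge[of w'] u[of w'] that snd_side_at[of v w']
      by (cases "side_at v w'") (auto simp: Ribbon crosses_def)
    have hourglass: "\<not> crosses (potential f) n (side_at v u)" if "u = r"
    proof -
      obtain P where P: "side_at v u = (P, u)" using snd_side_at[of v u] by (metis prod.collapse)
      then show ?thesis using hourglass_coord[of P u r] edge[of u] u[of u] that by (simp add: Ribbon crosses_def)
    qed
    have parity: "crosses (potential f) n (side_at v u) \<longleftrightarrow>
        crosses (potential f) n (side_at v (next_dir u)) \<noteq> crosses (potential f) n (side_at v (prev_dir u))"
      by (rule crosses_parity)
    have "u \<noteq> r"
    proof
      assume "u = r"
      then show False using hourglass simple[of w] w(2) by blast
    qed
    then have cr: "crosses (potential f) n (side_at v r)" "crosses (potential f) n (side_at v u)" and "w = r \<or> w = u"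
      using parity simple[of "next_dir u"] simple[of "prev_dir u"] simple[of w] w(2) dir_cases[of r u] by auto
    have carriers: "carrier f (side_at v r) = 0" "carrier f (side_at v u) = (if u = prev_dir r then 1 else 0)"
      using \<open>u \<noteq> r\<close> by (auto simp: carrier_def Ribbon u)
    have step: "ccw_step W v (trip_number f) (side_at v u, carrier f (side_at v u)) (side_at v r, carrier f (side_at v r))"
      "ccw_step W v (trip_number f) (side_at v r, carrier f (side_at v r)) (side_at v u, carrier f (side_at v u))"
      unfolding carriers unfolding Ribbon trip_number.simps steps(2)
      using dir_cases[of u r] \<open>u \<noteq> r\<close> by (elim disjE; simp)+
    have fw: "forward f r = ToWhite" "forward f u = ToBlack" using \<open>u \<noteq> r\<close> by (simp_all add: Ribbon)
    note adv = advance_ribbon[OF \<open>u \<noteq> r\<close>, of v, folded Ribbon]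
    from \<open>w = r \<or> w = u\<close> show ?thesis
    proof
      assume "w = r"
      then show ?thesis
        using step fw w(1) adv mem hv by (intro bexI[OF _ track[OF cr(2)]]) (auto simp del: ccw_sides.simps)
    next
      assume "w = u"
      then show ?thesis
        using step fw w(1) adv mem hv by (intro bexI[OF _ track[OF cr(1)]]) (auto simp del: ccw_sides.simps)
    qed
  qed
qed

end

subsection \<open>A track with one end is a trip\<close>

text \<open>A relation that is functional in both directions splits into chains and cycles.\<close>

lemma comparable_if_connected:
  assumes ru: "\<And>a b c. r a b \<Longrightarrow> r a c \<Longrightarrow> b = c"
    and lu: "\<And>a b c. r b a \<Longrightarrow> r c a \<Longrightarrow> b = c"
    and "(\<lambda>a b. r a b \<or> r b a)\<^sup>*\<^sup>* a b"
  shows "r\<^sup>*\<^sup>* a b \<or> r\<^sup>*\<^sup>* b a"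
  using assms(3)
proof induction
  case (step y z)
  from step.IH show ?case
  proof
    assume ay: "r\<^sup>*\<^sup>* a y"
    show ?thesis
    proof (cases "r y z")
      case True then show ?thesis using ay by (meson rtranclp.rtrancl_into_rtrancl)
    next
      case False
      with step.hyps have zy: "r z y" by blast
      from ay show ?thesis
      proof (cases rule: rtranclp.cases)
        case rtrancl_refl then show ?thesis using zy by blast
      next
        case (rtrancl_into_rtrancl u)
        then show ?thesis using lu[of u y z] zy by blast
      qed
    qed
  next
    assume ya: "r\<^sup>*\<^sup>* y a"
    show ?thesis
    proof (cases "r z y")
      case True then show ?thesis using ya by (meson converse_rtranclp_into_rtranclp)
    next
      case False
      with step.hyps have yz: "r y z" by blast
      from ya show ?thesis
      proof (cases rule: converse_rtranclpE)
        case base then show ?thesis using yz by blast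
      next
        case (step u)
        then show ?thesis using ru[of y u z] yz by blast
      qed
    qed
  qed
qed simp

context stepped_web
begin

abbreviation state :: "family \<Rightarrow> strand \<Rightarrow> strand \<times> heading" where
  "state f g \<equiv> (g, forward f (snd (fst g)))"

lemma flip_flip [simp]: "flip (flip h) = h" by (cases h) auto

lemma white_side: "s \<in> set (ccw_sides (white_of s))"
  using in_ccw_sides_iff(1) by (cases s rule: white_of.cases) (metis white_of.simps)+

lemma black_side: "s \<in> set (ccw_sides (black_of s))"
  using in_ccw_sides_iff(2) by (cases s rule: white_of.cases) (metis black_of.simps)+

lemma track_next:
  assumes "g \<in> track f n" and "at_heading (forward f (snd (fst g))) (fst g) \<in> V"
  shows "\<exists>g'\<in>track f n. advance f (fst g) < advance f (fst g') \<and> trip_step W (trip_number f) (state f g) (state f g')"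
proof -
  define h v where "h = forward f (snd (fst g))" and "v = at_heading h (fst g)"
  have hv: "heading_to v = h"
    by (cases h; cases "fst g" rule: white_of.cases) (simp_all add: v_def)
  have "fst g \<in> set (ccw_sides v)" by (cases h) (simp_all only: v_def at_heading.simps white_side black_side)
  moreover have "corners v \<subseteq> D" using assms(2) unfolding v_def h_def by blast
  ultimately obtain g' where g': "g' \<in> track f n" "fst g' \<in> set (ccw_sides v)" "forward f (snd (fst g')) = flip h"
      "advance f (fst g) < advance f (fst g')"
      "if h = ToBlack then ccw_step W v (trip_number f) g g' else ccw_step W v (trip_number f) g' g"
    using track_at[OF _ assms(1), of v] unfolding h_def[symmetric] hv by auto
  have "trip_step W (trip_number f) (g, h) (g', flip h)"
    using g'(5) assms(2) unfolding trip_step_iff h_def[symmetric] v_def by (cases h) (simp_all only: at_heading.simps flip.simps heading.simps if_True if_False simp_thms)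
  then show ?thesis using g' by (auto simp: h_def)
qed

lemma track_previous:
  assumes "g \<in> track f n" and "at_heading (flip (forward f (snd (fst g)))) (fst g) \<in> V"
  shows "\<exists>g'\<in>track f n. advance f (fst g') < advance f (fst g) \<and> trip_step W (trip_number f) (state f g') (state f g)"
proof -
  define h v where "h = forward f (snd (fst g))" and "v = at_heading (flip h) (fst g)"
  have hv: "heading_to v = flip h"
    by (cases h; cases "fst g" rule: white_of.cases) (simp_all add: v_def)
  have "fst g \<in> set (ccw_sides v)" by (cases h) (simp_all only: v_def at_heading.simps flip.simps white_side black_side)
  moreover have v: "v \<in> V" using assms(2) unfolding v_def h_def by blast
  moreover have "h \<noteq> flip h" by (cases h) simp_all
  ultimately obtain g' where g': "g' \<in> track f n" "fst g' \<in> set (ccw_sides v)" "forward f (snd (fst g')) = flip h"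
      "advance f (fst g') < advance f (fst g)"
      "if h = ToBlack then ccw_step W v (trip_number f) g g' else ccw_step W v (trip_number f) g' g"
    using track_at[OF _ assms(1), of v] unfolding h_def[symmetric] hv by auto
  have "at_heading (flip h) (fst g') = v"
  proof (cases h)
    case ToWhite
    then show ?thesis using g'(2) side_of_black[of "fst g'" "fst g"] by (simp add: v_def del: ccw_sides.simps)
  next
    case ToBlack
    then show ?thesis using g'(2) side_of_white[of "fst g'" "fst g"] by (simp add: v_def del: ccw_sides.simps)
  qed
  then have "trip_step W (trip_number f) (g', flip h) (g, h)"
    using g'(5) v unfolding trip_step_iff by (cases h) (simp_all only: at_heading.simps flip.simps heading.simps if_True if_False simp_thms)
  then show ?thesis using g' by (auto simp: h_def)
qed

lemma track_forward_closed:
  assumes "g \<in> track f n" and "trip_step W (trip_number f) (state f g) st"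
  shows "\<exists>g'\<in>track f n. st = state f g'"
proof -
  have "at_heading (forward f (snd (fst g))) (fst g) \<in> V"
    using assms(2) by (auto elim!: trip_step.cases)
  from track_next[OF assms(1) this] assms(2) show ?thesis
    using trip_step_right_unique by blast
qed

lemma track_backward_closed:
  assumes "g \<in> track f n" and "trip_step W (trip_number f) st (state f g)"
  shows "\<exists>g'\<in>track f n. st = state f g'"
proof -
  obtain e h where st: "st = (e, h)" by (cases st)
  have "at_heading (flip (forward f (snd (fst g)))) (fst g) \<in> V"
  proof (cases "forward f (snd (fst g))")
    case ToWhite
    with assms(2) have *: "black_of (fst e) \<in> V" "ccw_step W (black_of (fst e)) (trip_number f) e g"
      unfolding st trip_step_iff by (metis heading.distinct(1))+
    then show ?thesis using ccw_step_black[OF *(2)] ToWhite by simp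
  next
    case ToBlack
    with assms(2) have *: "white_of (fst e) \<in> V" "ccw_step W (white_of (fst e)) (trip_number f) g e"
      unfolding st trip_step_iff by (metis heading.distinct(1))+
    then show ?thesis using ccw_step_white[OF *(2)] ToBlack by simp
  qed
  from track_previous[OF assms(1) this] assms(2) show ?thesis
    using trip_step_left_unique by blast
qed

text \<open>A trip through a strand that may be traversed in either direction.\<close>

definition thread :: "nat \<Rightarrow> strand \<times> heading \<Rightarrow> strand set" where
  "thread t st = {e'. \<exists>h. (trip_step W t)\<^sup>*\<^sup>* st (e', h) \<or> (trip_step W t)\<^sup>*\<^sup>* (e', h) st}"

lemma trip_conv_thread: "trip W t e = thread t (e, ToWhite)"
  by (simp add: trip_def thread_def)

lemma trip_steps_reverse:
  assumes "t \<in> {1, 2, 3}"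
  shows "(trip_step W t)\<^sup>*\<^sup>* (e, h) (e', h') \<Longrightarrow> (trip_step W (4 - t))\<^sup>*\<^sup>* (e', flip h') (e, flip h)"
proof (induction "(e', h')" arbitrary: e' h' rule: rtranclp_induct)
  case (step y)
  obtain e1 h1 where y: "y = (e1, h1)" by (cases y)
  have "trip_step W (4 - t) (e', flip h') (e1, flip h1)"
    using step.hyps(2) trip_step_reverse[OF assms] by (simp add: y)
  then show ?case using step.hyps(3)[OF y] by (meson converse_rtranclp_into_rtranclp)
qed simp

lemma thread_reverse:
  assumes "t \<in> {1, 2, 3}"
  shows "thread t (e, h) = thread (4 - t) (e, flip h)"
proof -
  have sub: "thread t (e, h) \<subseteq> thread (4 - t) (e, flip h)" if t: "t \<in> {1, 2, 3}" for t h
  proof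
    fix e' assume "e' \<in> thread t (e, h)"
    then obtain h' where "(trip_step W t)\<^sup>*\<^sup>* (e, h) (e', h') \<or> (trip_step W t)\<^sup>*\<^sup>* (e', h') (e, h)"
      by (auto simp: thread_def)
    then have "(trip_step W (4 - t))\<^sup>*\<^sup>* (e', flip h') (e, flip h) \<or>
        (trip_step W (4 - t))\<^sup>*\<^sup>* (e, flip h) (e', flip h')"
      using trip_steps_reverse[OF t] by blast
    then show "e' \<in> thread (4 - t) (e, flip h)"
      unfolding thread_def by blast
  qed
  have "4 - t \<in> {1, 2, 3}" "4 - (4 - t) = t" using assms by auto
  then show ?thesis using sub[OF assms, of h] sub[of "4 - t" "flip h"] by simp
qed

lemma thread_subset_track:
  assumes "g \<in> track f n"
  shows "thread (trip_number f) (state f g) \<subseteq> track f n"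
proof -
  have fw: "\<exists>g'\<in>track f n. st = state f g'" if "(trip_step W (trip_number f))\<^sup>*\<^sup>* (state f g) st" for st
    using that assms by (induction rule: rtranclp_induct) (use track_forward_closed in blast)+
  have bw: "\<exists>g'\<in>track f n. st = state f g'" if "(trip_step W (trip_number f))\<^sup>*\<^sup>* st (state f g)" for st
    using that assms by (induction rule: converse_rtranclp_induct) (use track_backward_closed in blast)+
  show ?thesis
  proof
    fix e' assume "e' \<in> thread (trip_number f) (state f g)"
    then obtain h where "\<exists>g'\<in>track f n. (e', h) = state f g'"
      unfolding thread_def using fw bw by blast
    then show "e' \<in> track f n" by (simp only: prod.inject) blast
  qed
qed

text \<open>All strands of a track are followed to a common end: in the forward direction (\<open>True\<close>) or backward
  (\<open>False\<close>). The ends are those strands at which the track leaves the domain.\<close>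

fun end_heading :: "bool \<Rightarrow> heading \<Rightarrow> heading" where
  "end_heading True h = h" | "end_heading False h = flip h"

definition track_ends :: "bool \<Rightarrow> family \<Rightarrow> int \<Rightarrow> strand set" where
  "track_ends b f n = {g \<in> track f n. at_heading (end_heading b (forward f (snd (fst g)))) (fst g) \<notin> V}"

text \<open>The measure \<open>advance\<close> is bounded, so following the track leads from every strand to an end. If there is just one
  end, the track is connected, and hence a single trip.\<close>

lemma thread_eq_track:
  assumes g: "g \<in> track f n"
    and bounded: "\<And>g. g \<in> track f n \<Longrightarrow> \<bar>advance f (fst g)\<bar> \<le> N"
    and ends: "\<And>g g'. g \<in> track_ends b f n \<Longrightarrow> g' \<in> track_ends b f n \<Longrightarrow> g = g'"
  shows "thread (trip_number f) (state f g) = track f n"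
proof
  let ?r = "trip_step W (trip_number f)"
  let ?s = "\<lambda>a b. ?r a b \<or> ?r b a"
  have reach: "\<exists>g'\<in>track_ends b f n. ?s\<^sup>*\<^sup>* (state f g) (state f g')" if "g \<in> track f n" for g
    using that
  proof (induction "nat (if b then N - advance f (fst g) else N + advance f (fst g))" arbitrary: g rule: less_induct)
    case less
    show ?case
    proof (cases "g \<in> track_ends b f n")
      case False
      then have "\<exists>g'\<in>track f n. (if b then advance f (fst g) < advance f (fst g') else advance f (fst g') < advance f (fst g)) \<and>
          ?s (state f g) (state f g')"
        using track_next[OF less.prems] track_previous[OF less.prems] less.prems
        by (cases b) (auto simp: track_ends_def)
      then obtain g' where g': "g' \<in> track f n" "?s (state f g) (state f g')"
        "if b then advance f (fst g) < advance f (fst g') else advance f (fst g') < advance f (fst g)"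
        by blast
      have "\<exists>g''\<in>track_ends b f n. ?s\<^sup>*\<^sup>* (state f g') (state f g'')"
        using less.hyps[OF _ g'(1)] bounded[OF g'(1)] bounded[OF less.prems] g'(3) by (auto split: if_splits)
      then show ?thesis using g'(2) converse_rtranclp_into_rtranclp[of ?s "state f g" "state f g'"] by blast
    qed auto
  qed
  have symm: "?s\<^sup>*\<^sup>* a c" if "?s\<^sup>*\<^sup>* c a" for a c
    using that by (induction rule: rtranclp_induct) (auto intro: converse_rtranclp_into_rtranclp)
  show "track f n \<subseteq> thread (trip_number f) (state f g)"
  proof
    fix g' assume g': "g' \<in> track f n"
    obtain z z' where "z \<in> track_ends b f n" "?s\<^sup>*\<^sup>* (state f g) (state f z)"
      and "z' \<in> track_ends b f n" "?s\<^sup>*\<^sup>* (state f g') (state f z')"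
      using reach[OF g] reach[OF g'] by blast
    then have "?s\<^sup>*\<^sup>* (state f g) (state f g')"
      using ends[of z z'] symm rtranclp_trans[of ?s "state f g" "state f z" "state f g'"] by blast
    then have "?r\<^sup>*\<^sup>* (state f g) (state f g') \<or> ?r\<^sup>*\<^sup>* (state f g') (state f g)"
      by (intro comparable_if_connected) (use trip_step_right_unique trip_step_left_unique in blast)+
    then show "g' \<in> thread (trip_number f) (state f g)"
      unfolding thread_def by blast
  qed
qed (rule thread_subset_track[OF g])

lemma trip_eq_thread:
  assumes "t = (if forward f (snd (fst g)) = ToWhite then trip_number f else 4 - trip_number f)"
  shows "trip W t g = thread (trip_number f) (state f g)"
proof (cases "forward f (snd (fst g))")
  case ToWhite then show ?thesis using assms by (simp add: trip_conv_thread)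
next
  case ToBlack
  have "trip_number f \<in> {1, 2, 3}" by (cases f) auto
  from thread_reverse[OF this, of g ToBlack] ToBlack assms show ?thesis
    by (simp add: trip_conv_thread)
qed

end

context stepped_web
begin

subsection \<open>Separation by tracks\<close>

text \<open>The side of the threshold on which a face lies. The face inside a split hourglass is separated from one of
  its two neighbours by the carrier and shares its shade with the other one; which one this is depends on the color of the
  interior endpoint, because the strands are numbered counterclockwise around it.\<close>

fun shade :: "family \<Rightarrow> int \<Rightarrow> face \<Rightarrow> bool" where
  "shade f n (Around Q) \<longleftrightarrow> potential f Q < n"
| "shade f n (Between s) \<longleftrightarrow>
     potential f (if (snd s = prev_dir (dir_of f)) = (white_of s \<notin> V) then fst s else fst s + vec (snd s)) < n"

lemma split_iff: "split_hourglass W s \<longleftrightarrow> s \<in> H \<and> (white_of s \<in> V \<longleftrightarrow> black_of s \<notin> V)"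
  by (simp add: split_hourglass_def)

lemma right_face_W: "right_face W (s, i) =
    (if split_hourglass W s \<and> (i = 0 \<longleftrightarrow> white_of s \<in> V) then Between s else Around (fst s))"
  by (cases s) (simp add: right_face_def)

lemma left_face_W: "left_face W (s, i) =
    (if split_hourglass W s \<and> (i = 0 \<longleftrightarrow> black_of s \<in> V) then Between s else Around (fst s + vec (snd s)))"
  by (cases s) (simp add: left_face_def)

lemma face_step_shade:
  assumes "face_step W (track f n) F G"
  shows "shade f n F \<longleftrightarrow> shade f n G"
  using assms
proof cases
  case (1 s i)
  have edge: "is_edge s" "i < weight W s" using 1(1) by (simp_all add: strands_W_iff)
  have "shade f n (right_face W (s, i)) = shade f n (left_face W (s, i))"
  proof (cases "crosses (potential f) n s")
    case False
    then show ?thesis by (auto simp: right_face_W left_face_W crosses_def)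
  next
    case True
    from crossing_carried[OF edge(1) this] 1(2) have *: "split_hourglass W s" "carrier f s \<noteq> i" by auto
    then have "weight W s = 2" by (simp add: split_iff weight_simps)
    then have i: "i = 1 - carrier f s" using *(2) edge(2) by (auto simp: carrier_def split: if_splits)
    show ?thesis
      using * by (cases "snd s = prev_dir (dir_of f)"; cases "white_of s \<in> V")
        (simp_all add: right_face_W left_face_W split_iff carrier_def i del: mem_Collect_eq)
  qed
  then show ?thesis using 1(3) by auto
qed

text \<open>A step between faces that avoids the track does not change the shade.\<close>

lemma separates_track:
  assumes "shade f n F \<noteq> shade f n G"
  shows "separates W (track f n) F G"
proof -
  have "shade f n F = shade f n G" if "(face_step W (track f n))\<^sup>*\<^sup>* F G"
    using that by induction (use face_step_shade in auto)
  then show ?thesis using assms by (auto simp: separates_def)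
qed

subsection \<open>Walks that avoid a trip\<close>

lemma face_step_sym: "face_step W T F G \<Longrightarrow> face_step W T G F"
  by (auto elim!: face_step.cases intro: face_step.intros)

lemma face_steps_sym: "(face_step W T)\<^sup>*\<^sup>* F G \<Longrightarrow> (face_step W T)\<^sup>*\<^sup>* G F"
  by (induction rule: rtranclp_induct) (auto intro: face_step_sym converse_rtranclp_into_rtranclp)

lemma cross_unused_side:
  assumes "is_edge s" and "\<And>j. (s, j) \<notin> T"
  shows "(face_step W T)\<^sup>*\<^sup>* (Around (fst s)) (Around (fst s + vec (snd s)))"
proof -
  have step: "face_step W T (right_face W (s, i)) (left_face W (s, i))" if "i < weight W s" for i
    using assms that by (intro face_step.intros[of s i]) (simp_all add: strands_W_iff)
  show ?thesis
  proof (cases "split_hourglass W s")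
    case False
    then show ?thesis using step[of 0] by (auto simp: right_face_W left_face_W weight_def)
  next
    case True
    then have w: "weight W s = 2" by (simp add: split_iff weight_simps)
    show ?thesis
    proof (cases "white_of s \<in> V")
      case t: True
      then have "face_step W T (Around (fst s)) (Between s)" "face_step W T (Between s) (Around (fst s + vec (snd s)))"
        using step[of 1] step[of 0] True unfolding w right_face_W left_face_W split_iff by auto
      then show ?thesis by auto
    next
      case f: False
      then have "face_step W T (Around (fst s)) (Between s)" "face_step W T (Between s) (Around (fst s + vec (snd s)))"
        using step[of 1] step[of 0] True unfolding w right_face_W left_face_W split_iff by auto
      then show ?thesis by auto
    qed
  qed
qed

definition adjacent :: "point \<Rightarrow> point \<Rightarrow> bool" where
  "adjacent A B \<longleftrightarrow> (\<exists>u. B = A + vec u \<and> is_edge (A, u) \<or> A = B + vec u \<and> is_edge (B, u))"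

text \<open>Walks along sides of the domain through lattice points with the property \<open>R\<close>; in the dual picture these are walks
  through faces.\<close>

definition linked :: "(point \<Rightarrow> bool) \<Rightarrow> point \<Rightarrow> point \<Rightarrow> bool" where
  "linked R = (\<lambda>A B. R A \<and> R B \<and> adjacent A B)\<^sup>*\<^sup>*"

lemma linked_refl [simp, intro]: "linked R A A"
  by (simp add: linked_def)

lemma linked_trans: "linked R A B \<Longrightarrow> linked R B C \<Longrightarrow> linked R A C"
  unfolding linked_def by (rule rtranclp_trans)

lemma linked_adjacent: "R A \<Longrightarrow> R B \<Longrightarrow> adjacent A B \<Longrightarrow> linked R A B"
  unfolding linked_def by blast

lemma linked_mono: "linked R A B \<Longrightarrow> (\<And>Q. R Q \<Longrightarrow> R' Q) \<Longrightarrow> linked R' A B"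
  unfolding linked_def by (erule rtranclp_mono[THEN predicate2D, rotated]) auto

lemma linked_face_steps:
  assumes "linked R A B"
    and "\<And>s j. (s, j) \<in> T \<Longrightarrow> R (fst s) \<Longrightarrow> R (fst s + vec (snd s)) \<Longrightarrow> False"
  shows "(face_step W T)\<^sup>*\<^sup>* (Around A) (Around B)"
  using assms(1) unfolding linked_def
proof (induction rule: rtranclp_induct)
  case (step Y Z)
  have "(face_step W T)\<^sup>*\<^sup>* (Around Y) (Around Z)"
  proof -
    from step.hyps(2) obtain u where R: "R Y" "R Z"
      and "Z = Y + vec u \<and> is_edge (Y, u) \<or> Y = Z + vec u \<and> is_edge (Z, u)"
      by (auto simp: adjacent_def)
    then show ?thesis
    proof (elim disjE conjE)
      assume *: "Z = Y + vec u" "is_edge (Y, u)"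
      have "(face_step W T)\<^sup>*\<^sup>* (Around (fst (Y, u))) (Around (fst (Y, u) + vec (snd (Y, u))))"
        by (rule cross_unused_side[OF *(2)]) (use assms(2)[of "(Y, u)"] R * in auto)
      then show ?thesis using * by simp
    next
      assume *: "Y = Z + vec u" "is_edge (Z, u)"
      have "(face_step W T)\<^sup>*\<^sup>* (Around (fst (Z, u))) (Around (fst (Z, u) + vec (snd (Z, u))))"
        by (rule cross_unused_side[OF *(2)]) (use assms(2)[of "(Z, u)"] R * in auto)
      then show ?thesis using * face_steps_sym by simp
    qed
  qed
  with step.IH show ?case by (rule rtranclp_trans)
qed simp

subsection \<open>Trips that turn back in a cut hourglass\<close>

lemma hourglass_turn:
  assumes "v \<in> V" "s \<in> set (ccw_sides v)" "s \<in> H"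
  shows "ccw_step W v 1 (s, 0) (s, 1)" "ccw_step W v 3 (s, 1) (s, 0)"
proof -
  have v: "corners v \<subseteq> D" using assms(1) by blast
  obtain u where u: "side_at v u' \<in> H \<longleftrightarrow> u' = u" for u' using one_hourglass[OF v] by blast
  have "s = side_at v u" using side_at_cases[OF assms(2)] u[of "snd s"] assms(3) by metis
  then show one: "ccw_step W v 1 (s, 0) (s, 1)" using ccw_steps(1)[OF u] by simp
  show "ccw_step W v 3 (s, 1) (s, 0)" using ccw_step_reverse[OF v, of 1] one by simp
qed

text \<open>Entering or leaving the domain through one strand of a cut hourglass, this trip uses the other strand on
  the opposite way.\<close>

lemma trip_turn:
  assumes split: "split_hourglass W s" and ti: "(t, i) \<in> {(1, 1), (3, 0)}"
  shows "trip W t (s, i) = {(s, 0), (s, 1)}"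
proof -
  define j :: nat where "j = 1 - i"
  have H: "s \<in> H" using split by (simp add: split_iff)
  have ij: "{(s, i), (s, j)} = {(s, 0), (s, 1)}" using ti by (auto simp: j_def)
  show ?thesis
  proof (cases "white_of s \<in> V")
    case True
    then have black: "black_of s \<notin> V" using split by (simp only: split_iff)
    have "ccw_step W (white_of s) t (s, j) (s, i)"
      using hourglass_turn[OF True white_side H] ti by (auto simp: j_def)
    then have step: "trip_step W t ((s, i), ToWhite) ((s, j), ToBlack)"
      using True by (simp only: trip_step_iff fst_conv simp_thms heading.simps)
    have stop: "\<not> trip_step W t ((s, j), ToBlack) st" for st
      by (cases st) (use black in \<open>simp only: trip_step_iff fst_conv heading.simps simp_thms\<close>)
    have start: "\<not> trip_step W t st ((s, i), ToWhite)" for st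
    proof
      assume "trip_step W t st ((s, i), ToWhite)"
      then obtain e where "black_of (fst e) \<in> V" "ccw_step W (black_of (fst e)) t e (s, i)"
        by (cases st) (simp only: trip_step_iff heading.simps simp_thms, blast)
      then show False using ccw_step_black black by (metis fst_conv)
    qed
    have "(trip_step W t)\<^sup>*\<^sup>* ((s, i), ToWhite) st \<longleftrightarrow> st = ((s, i), ToWhite) \<or> st = ((s, j), ToBlack)" for st
    proof
      assume "(trip_step W t)\<^sup>*\<^sup>* ((s, i), ToWhite) st"
      then show "st = ((s, i), ToWhite) \<or> st = ((s, j), ToBlack)"
        by induction (use step stop trip_step_right_unique in blast)+
    qed (use step in blast)
    moreover have "(trip_step W t)\<^sup>*\<^sup>* st ((s, i), ToWhite) \<longleftrightarrow> st = ((s, i), ToWhite)" for st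
      using start by (blast elim: rtranclp.cases)
    ultimately have "trip W t (s, i) = {(s, i), (s, j)}"
      unfolding trip_def by auto
    then show ?thesis by (simp only: ij)
  next
    case False
    then have black: "black_of s \<in> V" using split by (simp only: split_iff simp_thms)
    have "ccw_step W (black_of s) t (s, j) (s, i)"
      using hourglass_turn[OF black black_side H] ti by (auto simp: j_def)
    then have step: "trip_step W t ((s, j), ToBlack) ((s, i), ToWhite)"
      using black by (simp only: trip_step_iff fst_conv simp_thms heading.simps)
    have stop: "\<not> trip_step W t ((s, i), ToWhite) st" for st
      by (cases st) (use False in \<open>simp only: trip_step_iff fst_conv heading.simps simp_thms\<close>)
    have start: "\<not> trip_step W t st ((s, j), ToBlack)" for st
    proof
      assume "trip_step W t st ((s, j), ToBlack)"
      then obtain e where "white_of (fst e) \<in> V" "ccw_step W (white_of (fst e)) t (s, j) e"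
        by (cases st) (simp only: trip_step_iff heading.simps simp_thms, blast)
      then show False using ccw_step_white False by (metis fst_conv)
    qed
    have "(trip_step W t)\<^sup>*\<^sup>* st ((s, i), ToWhite) \<longleftrightarrow> st = ((s, i), ToWhite) \<or> st = ((s, j), ToBlack)" for st
    proof
      assume "(trip_step W t)\<^sup>*\<^sup>* st ((s, i), ToWhite)"
      then show "st = ((s, i), ToWhite) \<or> st = ((s, j), ToBlack)"
        by (induction rule: converse_rtranclp_induct) (use step start trip_step_left_unique in blast)+
    qed (use step in blast)
    moreover have "(trip_step W t)\<^sup>*\<^sup>* ((s, i), ToWhite) st \<longleftrightarrow> st = ((s, i), ToWhite)" for st
      using stop by (blast elim: converse_rtranclpE)
    ultimately have "trip W t (s, i) = {(s, i), (s, j)}"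
      unfolding trip_def by auto
    then show ?thesis by (simp only: ij)
  qed
qed

lemma turn_separates_Between:
  assumes "split_hourglass W s"
  shows "separates W {(s, 0), (s, 1)} (Between s) (Around Q)"
proof -
  have w: "weight W s = 2" using assms by (simp add: split_iff weight_simps)
  have stuck: "\<not> face_step W {(s, 0), (s, 1)} (Between s) G" for G
  proof
    assume "face_step W {(s, 0), (s, 1)} (Between s) G"
    then show False
    proof cases
      case (1 s' i)
      then have "s' = s" by (auto simp: right_face_W left_face_W split: if_splits)
      then have "i < 2" using 1(1) by (simp add: strands_W_iff w)
      moreover have "i \<noteq> 0" "i \<noteq> 1" using 1(2) \<open>s' = s\<close> by auto
      ultimately show False by simp
    qed
  qed
  show ?thesis
    unfolding separates_def using stuck by (auto elim: converse_rtranclpE)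
qed

end

section \<open>Labels on the boundary of the domains\<close>

text \<open>The direction in which a track is followed to its end. With this choice, all tracks end on the
  NE side, on the vertical cut, or on the slanted cut of the \<open>120\<close> degree sector.\<close>

fun flows_forward :: "family \<Rightarrow> bool" where
  "flows_forward (Strip r) = (r = E1)" | "flows_forward (Ribbon r) = (r = E2)"

text \<open>The four domains have the following in common. Black triangles border on the exterior only along vertical sides without
  hourglasses, or along the slanted cut of the \<open>120\<close> degree sector, which runs on the line \<open>y = 0\<close> from \<open>O\<close> outwards (\<open>slanted\<close>).
  The sides in direction \<open>e\<^sub>1\<close> and \<open>e\<^sub>3\<close> along which white triangles border on the exterior lie on the NE side and on the vertical cut.
  The constant \<open>N\<close> bounds the domain.\<close>

locale cut_web = stepped_web +
  fixes c N :: int and slanted :: bool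
  assumes top: "(- c, - c) \<in> D" "K (- c, - c) = c"
    and bounded: "(x, y) \<in> D \<Longrightarrow> \<bar>x\<bar> \<le> N \<and> \<bar>y\<bar> \<le> N"
    and in_box: "P \<in> D \<Longrightarrow> 0 \<le> coord K r P" "P \<in> D \<Longrightarrow> K P \<le> c"
    and black_boundary: "black_of ((x, y), u) \<in> V \<Longrightarrow> white_of ((x, y), u) \<notin> V \<Longrightarrow>
      u = E3 \<and> ((x, y), u) \<notin> H \<or> u = E1 \<and> slanted \<and> y = 0 \<and> 0 \<le> x"
    and NE_boundary: "white_of ((x, y), E1) \<in> V \<Longrightarrow> black_of ((x, y), E1) \<notin> V \<Longrightarrow> y = - c \<and> ((x, y), E1) \<notin> H"
    and vertical_boundary: "white_of ((x, y), E3) \<in> V \<Longrightarrow> black_of ((x, y), E3) \<notin> V \<Longrightarrow> x = y"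
    and slanted_top: "slanted \<Longrightarrow> (t, t) \<in> D \<Longrightarrow> t \<le> 0"
begin

lemma along_E1:
  assumes "x \<le> x'"
  shows "K (x', y) \<le> K (x, y) \<and> x + K (x, y) \<le> x' + K (x', y)"
  using assms
proof (induction x' rule: int_ge_induct)
  case (step i)
  then show ?case using stepped_sides(3)[of i y] by auto
qed simp

lemma along_E3:
  assumes "t \<le> t'"
  shows "K (t', t') \<le> K (t, t) \<and> t + K (t, t) \<le> t' + K (t', t')"
  using assms
proof (induction t' rule: int_ge_induct)
  case (step i)
  then show ?case using stepped_sides(1)[of "i + 1" "i + 1"] by auto
qed simp

lemma end_sides:
  assumes "(((x, y), u), i) \<in> track_ends (flows_forward f) f n"
  shows "(case f of
      Strip E1 \<Rightarrow> u = E3 \<and> x = y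
    | Strip E2 \<Rightarrow> u = E3 \<and> x = y \<or> u = E1 \<and> slanted \<and> y = 0 \<and> 0 \<le> x
    | Strip E3 \<Rightarrow> u = E1 \<and> y = - c
    | Ribbon E1 \<Rightarrow> u = E1 \<and> y = - c \<and> ((x, y), u) \<notin> H
    | Ribbon E2 \<Rightarrow> u = E3 \<and> x = y \<and> ((x, y), u) \<in> H
    | Ribbon E3 \<Rightarrow> u = E3 \<and> x = y \<and> ((x, y), u) \<notin> H
        \<or> u = E1 \<and> slanted \<and> y = 0 \<and> 0 \<le> x \<and> ((x, y), u) \<in> H)"
proof -
  define w b where wb: "w = (white_of ((x, y), u) \<in> V)" "b = (black_of ((x, y), u) \<in> V)"
  have edge: "w \<or> b" and on: "runs_on f (((x, y), u), i)"
    using assms unfolding track_ends_def track_def wb by (auto simp only: strands_W_iff is_edge_def mem_Collect_eq prod.case)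
  have fin: "\<not> (if end_heading (flows_forward f) (forward f u) = ToWhite then w else b)"
    using assms unfolding track_ends_def wb
    by (cases "end_heading (flows_forward f) (forward f u)") (simp_all only: mem_Collect_eq fst_conv snd_conv at_heading.simps heading.simps if_True if_False simp_thms)
  have bd: "b \<Longrightarrow> \<not> w \<Longrightarrow> u = E3 \<and> ((x, y), u) \<notin> H \<or> u = E1 \<and> slanted \<and> y = 0 \<and> 0 \<le> x"
    "u = E1 \<Longrightarrow> w \<Longrightarrow> \<not> b \<Longrightarrow> y = - c \<and> ((x, y), u) \<notin> H"
    "u = E3 \<Longrightarrow> w \<Longrightarrow> \<not> b \<Longrightarrow> x = y"
    using black_boundary[of x y u] NE_boundary[of x y] vertical_boundary[of x y] unfolding wb by blast+
  show ?thesis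
  proof (cases f)
    case (Strip r)
    then show ?thesis using edge on fin bd by (cases r; cases u) (auto split: if_splits)
  next
    case (Ribbon r)
    then show ?thesis using edge on fin bd by (cases r; cases u) (auto split: if_splits)
  qed
qed

text \<open>Along the part of the boundary where the track may end the potential is monotone, so it passes the threshold only once.\<close>

lemma ends_unique:
  assumes "g \<in> track_ends (flows_forward f) f n" "g' \<in> track_ends (flows_forward f) f n"
  shows "g = g'"
proof -
  obtain x y u i where g: "g = (((x, y), u), i)" by (metis surj_pair)
  obtain x' y' u' i' where g': "g' = (((x', y'), u'), i')" by (metis surj_pair)
  have tr: "(((x, y), u), i) \<in> track f n" "(((x', y'), u'), i') \<in> track f n"
    using assms by (simp_all add: track_ends_def g g')
  note e = end_sides[OF assms(1)[unfolded g]] end_sides[OF assms(2)[unfolded g']]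
  note cr = track_crosses[OF tr(1)] track_crosses[OF tr(2)]
  have edge: "is_edge ((x, y), u)" "is_edge ((x', y'), u')" using tr by (simp_all add: track_def strands_W_iff)
  have inD: "(x, y) \<in> D" "(x', y') \<in> D"
    using is_edge_in_D[OF edge(1)] is_edge_in_D[OF edge(2)] by simp_all
  have "((x, y), u) = ((x', y'), u')"
  proof (cases f)
    case (Strip r)
    then show ?thesis using e cr inD slanted_top[of x] slanted_top[of x']
      by (cases r) (auto simp: crosses_def)
  next
    case (Ribbon r)
    have "x = x'" if "u = E1" "u' = E1" "y = y'" "crosses (coord K E1) n ((x, y), u)" "crosses (coord K E1) n ((x', y'), u')"
      using that along_E1[of x "x' - 1" y] along_E1[of x' "x - 1" y] along_E1[of "x + 1" x' y] along_E1[of "x' + 1" x y]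
        stepped_sides(3)[of x y] stepped_sides(3)[of x' y]
      by (cases x x' rule: linorder_cases) (auto simp: crosses_def)
    moreover have "x = x'" if "u = E1" "u' = E1" "y = y'" "crosses (coord K E3) n ((x, y), u)" "crosses (coord K E3) n ((x', y'), u')"
      using that along_E1[of "x + 1" x' y] along_E1[of "x' + 1" x y]
        stepped_sides(3)[of x y] stepped_sides(3)[of x' y]
      by (cases x x' rule: linorder_cases) (auto simp: crosses_def)
    moreover have "x = x'" if "u = E3" "u' = E3" "x = y" "x' = y'" "crosses (coord K E2) n ((x, y), u)" "crosses (coord K E2) n ((x', y'), u')"
      using that along_E3[of x "x' - 1"] along_E3[of x' "x - 1"]
        stepped_sides(1)[of x x] stepped_sides(1)[of x' x']
      by (cases x x' rule: linorder_cases) (auto simp: crosses_def)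
    moreover have "x = x'" if "u = E3" "u' = E3" "x = y" "x' = y'" "crosses (coord K E3) n ((x, y), u)" "crosses (coord K E3) n ((x', y'), u')"
      using that along_E3[of x "x' - 1"] along_E3[of x' "x - 1"]
        stepped_sides(1)[of x x] stepped_sides(1)[of x' x']
      by (cases x x' rule: linorder_cases) (auto simp: crosses_def)
    moreover have False if "z \<le> 0" "0 \<le> v" "crosses (coord K E3) n ((z, z), E3)" "((v, 0), E1) \<in> H"
        "crosses (coord K E3) n ((v, 0), E1)" "(v, 0) \<in> D" for z v
      using that along_E3[of z 0] along_E1[of 0 v 0] stepped_sides(3)[of v 0] stepped_sides(1)[of z z]
      by (auto simp: crosses_def)
    ultimately show ?thesis using e cr inD slanted_top[of x] slanted_top[of x'] unfolding Ribbon
      by (cases r) auto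
  qed
  moreover have "i = carrier f ((x, y), u)" "i' = carrier f ((x', y'), u')"
    using tr carrier_unique by blast+
  ultimately show ?thesis by (simp add: g g')
qed

lemma advance_bounded:
  assumes "g \<in> track f n"
  shows "\<bar>advance f (fst g)\<bar> \<le> 4 * N"
proof -
  obtain x y u i where g: "g = (((x, y), u), i)" by (metis surj_pair)
  have "is_edge ((x, y), u)" using assms by (simp add: g track_def strands_W_iff)
  from is_edge_in_D[OF this] have D: "(x, y) \<in> D" "(x, y) + vec u \<in> D" by simp_all
  show ?thesis
  proof (cases f)
    case (Strip r)
    then show ?thesis using bounded[OF D(1)] D(2) bounded[of "x + 1" y] bounded[of x "y + 1"] bounded[of "x - 1" "y - 1"]
      by (cases r; cases u) (auto simp: g)
  next
    case (Ribbon r)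
    then show ?thesis using bounded[OF D(1)] D(2) bounded[of "x + 1" y] bounded[of x "y + 1"] bounded[of "x - 1" "y - 1"]
      by (cases r; cases u) (auto simp: g)
  qed
qed

lemma trip_eq_track:
  assumes "is_edge s" "crosses (potential f) n s" "i = carrier f s"
    and "t = (if forward f (snd s) = ToWhite then trip_number f else 4 - trip_number f)"
  shows "trip W t (s, i) = track f n"
proof -
  have "(s, i) \<in> track f n" using crossing_carried assms by blast
  from thread_eq_track[OF this advance_bounded ends_unique] trip_eq_thread[of t f "(s, i)"] assms(4)
  show ?thesis by simp
qed

definition F0 :: face where "F0 = Around (- c, - c)"

lemma sep_conv:
  "sep W F0 e = 1 + of_bool (separates W (trip W 1 e) (right_face W e) F0) +
    of_bool (separates W (trip W 2 e) (right_face W e) F0) + of_bool (separates W (trip W 3 e) (right_face W e) F0)"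
proof -
  have "{t \<in> {1, 2, 3}. P t} = (if P 1 then {1} else {}) \<union> (if P 2 then {2} else {}) \<union> (if P 3 then {3} else {})"
    for P :: "nat \<Rightarrow> bool" by auto
  then show ?thesis by (simp add: sep_def)
qed

lemma trip_separates:
  assumes "is_edge s" "crosses (potential f) n s" "i = carrier f s"
    and "t = (if forward f (snd s) = ToWhite then trip_number f else 4 - trip_number f)"
    and "shade f n (right_face W (s, i)) \<noteq> (potential f (- c, - c) < n)"
  shows "separates W (trip W t (s, i)) (right_face W (s, i)) F0"
  unfolding trip_eq_track[OF assms(1-4)] using assms(5) by (intro separates_track) (simp add: F0_def)

lemma walk_not_separates:
  assumes "linked R A (- c, - c)" and "\<And>s j. (s, j) \<in> T \<Longrightarrow> R (fst s) \<Longrightarrow> R (fst s + vec (snd s)) \<Longrightarrow> False"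
  shows "\<not> separates W T (Around A) F0"
  using linked_face_steps[OF assms] by (simp add: separates_def F0_def)

lemma trip_not_separates:
  assumes "is_edge s" "crosses (potential f) n s" "i = carrier f s"
    and "t = (if forward f (snd s) = ToWhite then trip_number f else 4 - trip_number f)"
    and "linked (\<lambda>Q. potential f Q < n \<longleftrightarrow> b) A (- c, - c)"
  shows "\<not> separates W (trip W t (s, i)) (Around A) F0"
  unfolding trip_eq_track[OF assms(1-4)]
  by (rule walk_not_separates[OF assms(5)]) (use track_crosses in \<open>auto simp: crosses_def\<close>)

lemma trip_not_separates_Between:
  assumes "split_hourglass W s" "crosses (potential f) n s" "i = carrier f s"
    and "t = (if forward f (snd s) = ToWhite then trip_number f else 4 - trip_number f)"
    and "linked (\<lambda>Q. potential f Q < n \<longleftrightarrow> b) (fst s) (- c, - c)"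
    and "i = (if white_of s \<in> V then 0 else 1)"
  shows "\<not> separates W (trip W t (s, i)) (Between s) F0"
proof -
  have edge: "is_edge s" using assms(1) unfolding split_iff is_edge_def by blast
  have w: "weight W s = 2" using assms(1) by (simp add: split_iff weight_simps)
  have "face_step W (trip W t (s, i)) (right_face W (s, 1 - i)) (left_face W (s, 1 - i))"
    unfolding trip_eq_track[OF edge assms(2-4)]
  proof (rule face_step.intros[of s "1 - i"])
    show "(s, 1 - i) \<in> strands W" using edge w by (simp add: strands_W_iff)
    show "\<forall>j. (s, j) \<in> track f n \<longrightarrow> split_hourglass W s \<and> j \<noteq> 1 - i"
    proof (intro allI impI)
      fix j assume "(s, j) \<in> track f n"
      then have "j = i" using carrier_unique assms(3) by simp
      then show "split_hourglass W s \<and> j \<noteq> 1 - i" using assms(1,6) by (simp split: if_splits)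
    qed
  qed simp
  moreover have "right_face W (s, 1 - i) = Around (fst s)" "left_face W (s, 1 - i) = Between s"
    using assms(1,6) unfolding right_face_W left_face_W split_iff by auto
  ultimately have "face_step W (trip W t (s, i)) (Between s) (Around (fst s))"
    using face_step_sym by simp
  moreover have "\<not> separates W (trip W t (s, i)) (Around (fst s)) F0"
    by (rule trip_not_separates[OF edge assms(2-5)])
  ultimately show ?thesis
    unfolding separates_def by (meson converse_rtranclp_into_rtranclp)
qed


subsection \<open>Labels of boundary edges\<close>

lemma right_face_simple: "s \<notin> H \<Longrightarrow> right_face W (s, 0) = Around (fst s)"
  by (simp add: right_face_W split_iff)

lemma boundary_split: "s \<in> H \<Longrightarrow> (white_of s \<in> V \<longleftrightarrow> black_of s \<notin> V) \<Longrightarrow> split_hourglass W s"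
  by (simp only: split_iff simp_thms)

lemma right_face_white:
  assumes "s \<in> H" "white_of s \<in> V" "black_of s \<notin> V"
  shows "right_face W (s, 0) = Between s" "right_face W (s, 1) = Around (fst s)"
  using assms unfolding right_face_W split_iff by auto

lemma right_face_black:
  assumes "s \<in> H" "black_of s \<in> V" "white_of s \<notin> V"
  shows "right_face W (s, 1) = Between s" "right_face W (s, 0) = Around (fst s)"
  using assms unfolding right_face_W split_iff by auto

text \<open>All three trips end beyond the edge in clockwise order: no potential reaches its threshold on the NE side between
  \<open>F\<^sub>0\<close> and the edge.\<close>

lemma sep_NE:
  assumes v: "white_of ((x, - c), E1) \<in> V" "black_of ((x, - c), E1) \<notin> V"
    and walk: "linked (\<lambda>Q. snd Q = - c \<and> fst Q \<le> x) (x, - c) (- c, - c)"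
  shows "sep W F0 (((x, - c), E1), 0) = 1"
proof -
  let ?s = "((x, - c), E1)"
  have H: "?s \<notin> H" using NE_boundary[OF v] by simp
  have e: "is_edge ?s" using v(1) unfolding is_edge_def by blast
  note w = linked_mono[OF walk] and rf = right_face_simple[OF H]
  have "\<not> separates W (trip W 1 (?s, 0)) (Around (x, - c)) F0"
    by (rule trip_not_separates[OF e, where f = "Strip E3" and n = "x + c + 1" and b = True])
      (auto simp: crosses_def carrier_def intro!: w)
  moreover have "\<not> separates W (trip W 3 (?s, 0)) (Around (x, - c)) F0"
    by (rule trip_not_separates[OF e, where f = "Strip E2" and n = "x + 1" and b = True])
      (auto simp: crosses_def carrier_def H intro!: w)
  moreover have "\<not> separates W (trip W 2 (?s, 0)) (Around (x, - c)) F0"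
  proof (rule trip_not_separates[OF e, where f = "Ribbon E1" and n = "x + K (x, - c) + 1" and b = True])
    show "crosses (potential (Ribbon E1)) (x + K (x, - c) + 1) ?s"
      using simple_coord[OF e H, of E1] by (simp add: crosses_def)
    show "linked (\<lambda>Q. (potential (Ribbon E1) Q < x + K (x, - c) + 1) = True) (x, - c) (- c, - c)"
      using along_E1[of _ x "- c"] by (intro w) fastforce
  qed (auto simp: carrier_def H)
  ultimately show ?thesis by (simp add: sep_conv rf)
qed

text \<open>All three trips separate: both affine potentials are larger than at \<open>F\<^sub>0\<close>, and the height \<open>K\<close> is below its
  maximum \<open>c\<close>, which is attained at \<open>F\<^sub>0\<close>.\<close>

lemma sep_vertical_simple:
  assumes e: "is_edge ((x, y), E3)" and H: "((x, y), E3) \<notin> H" and less: "- c < x" "- c < y"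
  shows "sep W F0 (((x, y), E3), 0) = 4"
proof -
  let ?s = "((x, y), E3)"
  note rf = right_face_simple[OF H]
  have K: "K (x - 1, y - 1) = K (x, y) + 1" using simple_coord[OF e H, of E3] by simp
  then have Kc: "K (x, y) < c" using is_edge_in_D[OF e] in_box(2)[of "(x - 1, y - 1)"] by simp
  have "separates W (trip W 1 (?s, 0)) (right_face W (?s, 0)) F0"
    by (rule trip_separates[OF e, where f = "Strip E2" and n = x]) (use less in \<open>auto simp: crosses_def carrier_def rf\<close>)
  moreover have "separates W (trip W 3 (?s, 0)) (right_face W (?s, 0)) F0"
    by (rule trip_separates[OF e, where f = "Strip E1" and n = y]) (use less in \<open>auto simp: crosses_def carrier_def rf H\<close>)
  moreover have "separates W (trip W 2 (?s, 0)) (right_face W (?s, 0)) F0"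
    by (rule trip_separates[OF e, where f = "Ribbon E3" and n = "K (x, y) + 1"])
      (use K Kc in \<open>auto simp: crosses_def carrier_def rf H top\<close>)
  ultimately show ?thesis by (simp add: sep_conv)
qed

text \<open>Of the two strands, the first one in clockwise order is number 1. Its \<open>trip\<^sub>1\<close> turns back and does not
  separate the face on its right from \<open>F\<^sub>0\<close>; this face is left around the triangle at the hourglass. All other trips through the two strands separate.\<close>

lemma sep_vertical_hourglass:
  assumes v: "white_of ((t, t), E3) \<in> V" "black_of ((t, t), E3) \<notin> V"
    and H: "((t, t), E3) \<in> H" and less: "- c < t"
    and walk: "linked (\<lambda>Q. fst Q < t) (t - 1, t - 1) (- c, - c)"
  shows "sep W F0 (((t, t), E3), 1) = 3" "sep W F0 (((t, t), E3), 0) = 4"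
proof -
  let ?s = "((t, t), E3)"
  have e: "is_edge ?s" using v(1) unfolding is_edge_def by blast
  have split: "split_hourglass W ?s" using boundary_split H v by blast
  note rf = right_face_white[OF H v]
  have K: "K (t - 1, t - 1) = K (t, t)" using hourglass_coord[OF e H, of E3] by simp
  have pos: "0 < t + K (t, t)" using in_box(1)[of "(t - 1, t - 1)" E1] is_edge_in_D[OF e] K by simp
  have white: "white_of ((t, t - 1), E2) \<in> V" "white_of ((t - 1, t - 1), E1) \<in> V"
    using v(1) by simp_all
  have edges: "is_edge ((t, t - 1), E2)" "is_edge ((t - 1, t - 1), E1)"
    using white unfolding is_edge_def by blast+
  have "linked (\<lambda>Q. Q \<noteq> (t - 1, t - 1)) (t, t) (t, t - 1)"
    by (rule linked_adjacent) (use edges in \<open>auto simp: adjacent_def intro!: exI[of _ E2]\<close>)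
  \<comment> \<open>around the third corner of the white triangle at the hourglass\<close>
  then have w1: "(face_step W {(?s, 0), (?s, 1)})\<^sup>*\<^sup>* (Around (t, t)) (Around (t, t - 1))"
    by (rule linked_face_steps) auto
  have "linked (\<lambda>Q. Q \<noteq> (t, t)) (t, t - 1) (t - 1, t - 1)"
    by (rule linked_adjacent) (use edges in \<open>auto simp: adjacent_def intro!: exI[of _ E1]\<close>)
  moreover have "linked (\<lambda>Q. Q \<noteq> (t, t)) (t - 1, t - 1) (- c, - c)"
    using linked_mono[OF walk] by force
  ultimately have "linked (\<lambda>Q. Q \<noteq> (t, t)) (t, t - 1) (- c, - c)"
    by (rule linked_trans)
  then have w2: "(face_step W {(?s, 0), (?s, 1)})\<^sup>*\<^sup>* (Around (t, t - 1)) F0"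
    unfolding F0_def by (rule linked_face_steps) auto
  have "\<not> separates W (trip W 1 (?s, 1)) (right_face W (?s, 1)) F0"
    using rtranclp_trans[OF w1 w2] trip_turn[OF split, of 1 1] unfolding rf by (simp add: separates_def)
  moreover have "separates W (trip W 3 (?s, 1)) (right_face W (?s, 1)) F0"
    by (rule trip_separates[OF e, where f = "Strip E1" and n = t]) (use less H in \<open>auto simp: crosses_def carrier_def rf[simplified]\<close>)
  moreover have "separates W (trip W 2 (?s, 1)) (right_face W (?s, 1)) F0"
    by (rule trip_separates[OF e, where f = "Ribbon E1" and n = "t + K (t, t)"])
      (use K H pos in \<open>auto simp: crosses_def carrier_def rf[simplified] top\<close>)
  ultimately show "sep W F0 (?s, 1) = 3" by (simp add: sep_conv)
  have "separates W (trip W 1 (?s, 0)) (right_face W (?s, 0)) F0"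
    by (rule trip_separates[OF e, where f = "Strip E2" and n = t]) (use less H v in \<open>auto simp: crosses_def carrier_def rf\<close>)
  moreover have "separates W (trip W 2 (?s, 0)) (right_face W (?s, 0)) F0"
    by (rule trip_separates[OF e, where f = "Ribbon E2" and n = "t + K (t, t)"])
      (use K H pos v in \<open>auto simp: crosses_def carrier_def rf top\<close>)
  moreover have "separates W (trip W 3 (?s, 0)) (right_face W (?s, 0)) F0"
    using turn_separates_Between[OF split, of "(- c, - c)"] trip_turn[OF split, of 3 0] unfolding rf F0_def by simp
  ultimately show "sep W F0 (?s, 0) = 4" by (simp add: sep_conv)
qed

text \<open>Only \<open>trip\<^sub>3\<close> separates; it runs straight up to the NE side. The other two cross levels that are not reached on the
  given walk.\<close>

lemma sep_E2_simple:
  assumes v: "white_of ((x, y), E2) \<in> V" "black_of ((x, y), E2) \<notin> V"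
    and H: "((x, y), E2) \<notin> H" and less: "y < x"
    and walk: "linked (\<lambda>Q. snd Q \<le> y \<and> coord K E2 Q \<le> coord K E2 (x, y)) (x, y) (- c, - c)"
  shows "sep W F0 (((x, y), E2), 0) = 2"
proof -
  let ?s = "((x, y), E2)"
  have e: "is_edge ?s" using v(1) unfolding is_edge_def by blast
  note w = linked_mono[OF walk] and rf = right_face_simple[OF H]
  have "\<not> separates W (trip W 1 (?s, 0)) (Around (x, y)) F0"
    by (rule trip_not_separates[OF e, where f = "Strip E1" and n = "y + 1" and b = True])
      (auto simp: crosses_def carrier_def intro!: w)
  moreover have "separates W (trip W 3 (?s, 0)) (right_face W (?s, 0)) F0"
    by (rule trip_separates[OF e, where f = "Strip E3" and n = "x - y"])
      (use less in \<open>auto simp: crosses_def carrier_def rf H\<close>)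
  moreover have "\<not> separates W (trip W 2 (?s, 0)) (Around (x, y)) F0"
  proof (rule trip_not_separates[OF e, where f = "Ribbon E2" and n = "coord K E2 (x, y) + 1" and b = True])
    show "crosses (potential (Ribbon E2)) (coord K E2 (x, y) + 1) ?s"
      using simple_coord[OF e H, of E2] by (simp add: crosses_def)
    show "linked (\<lambda>Q. (potential (Ribbon E2) Q < coord K E2 (x, y) + 1) = True) (x, y) (- c, - c)"
      by (intro w) auto
  qed (auto simp: carrier_def H)
  ultimately show ?thesis by (simp add: sep_conv rf)
qed

lemma sep_E2_hourglass:
  assumes v: "white_of ((x, y), E2) \<in> V" "black_of ((x, y), E2) \<notin> V"
    and H: "((x, y), E2) \<in> H" and less: "y < x"
    and walk: "linked (\<lambda>Q. snd Q \<le> y \<and> K (x, y) \<le> K Q) (x, y) (- c, - c)"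
  shows "sep W F0 (((x, y), E2), 1) = 2" "sep W F0 (((x, y), E2), 0) = 3"
proof -
  let ?s = "((x, y), E2)"
  have e: "is_edge ?s" using v(1) unfolding is_edge_def by blast
  have split: "split_hourglass W ?s" using boundary_split H v by blast
  note w = linked_mono[OF walk] and rf = right_face_white[OF H v]
  have K: "K (x, y + 1) = K (x, y) - 1" using hourglass_coord[OF e H, of E3] by simp
  have pos: "0 < x + K (x, y)" using in_box(1)[of "(x, y + 1)" E1] is_edge_in_D[OF e] K by simp
  have "\<not> separates W {(?s, 0), (?s, 1)} (Around (x, y)) F0"
    by (rule walk_not_separates[OF walk]) auto
  then have "\<not> separates W (trip W 1 (?s, 1)) (Around (x, y)) F0"
    using trip_turn[OF split, of 1 1] by simp
  moreover have "separates W (trip W 3 (?s, 1)) (right_face W (?s, 1)) F0"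
    by (rule trip_separates[OF e, where f = "Strip E3" and n = "x - y"])
      (use less H in \<open>auto simp: crosses_def carrier_def rf[simplified]\<close>)
  moreover have "\<not> separates W (trip W 2 (?s, 1)) (Around (x, y)) F0"
  proof (rule trip_not_separates[OF e, where f = "Ribbon E3" and n = "K (x, y)" and b = False])
    show "linked (\<lambda>Q. (potential (Ribbon E3) Q < K (x, y)) = False) (x, y) (- c, - c)"
      by (intro w) auto
  qed (use H K in \<open>auto simp: carrier_def crosses_def\<close>)
  ultimately show "sep W F0 (?s, 1) = 2" by (simp add: sep_conv rf[simplified])
  have "\<not> separates W (trip W 1 (?s, 0)) (Between ?s) F0"
    by (rule trip_not_separates_Between[OF split, where f = "Strip E1" and n = "y + 1" and b = True])
      (use v in \<open>auto simp: crosses_def carrier_def intro!: w\<close>)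
  moreover have "separates W (trip W 2 (?s, 0)) (right_face W (?s, 0)) F0"
    by (rule trip_separates[OF e, where f = "Ribbon E1" and n = "x + K (x, y)"])
      (use K H pos v in \<open>auto simp: crosses_def carrier_def rf top\<close>)
  moreover have "separates W (trip W 3 (?s, 0)) (right_face W (?s, 0)) F0"
    using turn_separates_Between[OF split, of "(- c, - c)"] trip_turn[OF split, of 3 0] unfolding rf F0_def by simp
  ultimately show "sep W F0 (?s, 0) = 3" by (simp add: sep_conv rf)
qed

text \<open>No trip separates, because the given walk to \<open>F\<^sub>0\<close> (in the application, counterclockwise along the cuts) stays on
  one side of all three thresholds.\<close>

lemma sep_E1_simple:
  assumes v: "black_of ((x, y), E1) \<in> V" "white_of ((x, y), E1) \<notin> V" and H: "((x, y), E1) \<notin> H"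
    and walk: "linked (\<lambda>Q. fst Q \<le> x \<and> fst Q - snd Q \<le> x - y \<and> coord K E1 Q \<le> coord K E1 (x, y)) (x, y) (- c, - c)"
  shows "sep W F0 (((x, y), E1), 0) = 1"
proof -
  let ?s = "((x, y), E1)"
  have e: "is_edge ?s" using v(1) unfolding is_edge_def by blast
  note w = linked_mono[OF walk] and rf = right_face_simple[OF H]
  have "\<not> separates W (trip W 1 (?s, 0)) (Around (x, y)) F0"
    by (rule trip_not_separates[OF e, where f = "Strip E3" and n = "x - y + 1" and b = True])
      (auto simp: crosses_def carrier_def intro!: w)
  moreover have "\<not> separates W (trip W 3 (?s, 0)) (Around (x, y)) F0"
    by (rule trip_not_separates[OF e, where f = "Strip E2" and n = "x + 1" and b = True])
      (auto simp: crosses_def carrier_def H intro!: w)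
  moreover have "\<not> separates W (trip W 2 (?s, 0)) (Around (x, y)) F0"
  proof (rule trip_not_separates[OF e, where f = "Ribbon E1" and n = "coord K E1 (x, y) + 1" and b = True])
    show "crosses (potential (Ribbon E1)) (coord K E1 (x, y) + 1) ?s"
      using simple_coord[OF e H, of E1] by (simp add: crosses_def)
    show "linked (\<lambda>Q. (potential (Ribbon E1) Q < coord K E1 (x, y) + 1) = True) (x, y) (- c, - c)"
      by (intro w) auto
  qed (auto simp: carrier_def H)
  ultimately show ?thesis by (simp add: sep_conv rf)
qed

lemma sep_E1_hourglass:
  assumes v: "black_of ((x, y), E1) \<in> V" "white_of ((x, y), E1) \<notin> V" and H: "((x, y), E1) \<in> H"
    and walk: "linked (\<lambda>Q. fst Q \<le> x \<and> fst Q - snd Q \<le> x - y \<and> K (x, y) \<le> K Q) (x, y) (- c, - c)"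
  shows "sep W F0 (((x, y), E1), 1) = 3" "sep W F0 (((x, y), E1), 0) = 1"
proof -
  let ?s = "((x, y), E1)"
  have e: "is_edge ?s" using v(1) unfolding is_edge_def by blast
  have split: "split_hourglass W ?s" using boundary_split H v by blast
  note w = linked_mono[OF walk] and rf = right_face_black[OF H v]
  have K: "K (x + 1, y) = K (x, y) - 1" using hourglass_coord[OF e H, of E3] by simp
  have pos: "0 < y + K (x, y)" using in_box(1)[of "(x + 1, y)" E2] is_edge_in_D[OF e] K by simp
  have "separates W (trip W 1 (?s, 1)) (right_face W (?s, 1)) F0"
    using turn_separates_Between[OF split, of "(- c, - c)"] trip_turn[OF split, of 1 1] unfolding rf F0_def by simp
  moreover have "separates W (trip W 2 (?s, 1)) (right_face W (?s, 1)) F0"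
    by (rule trip_separates[OF e, where f = "Ribbon E2" and n = "y + K (x, y)"])
      (use K H pos v in \<open>auto simp: crosses_def carrier_def rf[simplified] top\<close>)
  moreover have "\<not> separates W (trip W 3 (?s, 1)) (Between ?s) F0"
    by (rule trip_not_separates_Between[OF split, where f = "Strip E2" and n = "x + 1" and b = True])
      (use v H in \<open>auto simp: crosses_def carrier_def intro!: w\<close>)
  ultimately show "sep W F0 (?s, 1) = 3" by (simp add: sep_conv rf[simplified])
  have "\<not> separates W (trip W 1 (?s, 0)) (Around (x, y)) F0"
    by (rule trip_not_separates[OF e, where f = "Strip E3" and n = "x - y + 1" and b = True])
      (auto simp: crosses_def carrier_def intro!: w)
  moreover have "\<not> separates W (trip W 2 (?s, 0)) (Around (x, y)) F0"
  proof (rule trip_not_separates[OF e, where f = "Ribbon E3" and n = "K (x, y)" and b = False])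
    show "linked (\<lambda>Q. (potential (Ribbon E3) Q < K (x, y)) = False) (x, y) (- c, - c)"
      by (intro w) auto
  qed (use H K in \<open>auto simp: carrier_def crosses_def\<close>)
  moreover have "\<not> separates W {(?s, 0), (?s, 1)} (Around (x, y)) F0"
    by (rule walk_not_separates[OF walk]) auto
  then have "\<not> separates W (trip W 3 (?s, 0)) (Around (x, y)) F0"
    using trip_turn[OF split, of 3 0] by simp
  ultimately show "sep W F0 (?s, 0) = 1" by (simp add: sep_conv rf)
qed

end

section \<open>The surface of a plane partition\<close>

text \<open>The solid region, extended to all of \<open>\<int>\<^sup>3\<close> with the walls infinitely thick. This makes it a downward closed
  set, and its surface is defined above all lattice points of the plane without any boundary cases.\<close>

definition filled :: "(nat \<times> nat \<times> nat) set \<Rightarrow> int \<Rightarrow> int \<Rightarrow> int \<Rightarrow> bool" where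
  "filled p x y z \<longleftrightarrow> x \<le> 0 \<or> y \<le> 0 \<or> z \<le> 0 \<or> (nat x, nat y, nat z) \<in> p"

fun surface :: "(nat \<times> nat \<times> nat) set \<Rightarrow> point \<Rightarrow> int" where
  "surface p (x, y) = int (LEAST n. \<not> filled p (x + int n) (y + int n) (int n)) - 1"

lemma hexagon_iff:
  "(x, y) \<in> hexagon a b c \<longleftrightarrow>
     - int c \<le> x \<and> x \<le> int a \<and> - int c \<le> y \<and> y \<le> int b \<and> - int b \<le> x - y \<and> x - y \<le> int a"
proof
  assume *: "- int c \<le> x \<and> x \<le> int a \<and> - int c \<le> y \<and> y \<le> int b \<and> - int b \<le> x - y \<and> x - y \<le> int a"
  define k where "k = max 0 (max (- x) (- y))"
  have "(x, y) = proj (nat (x + k)) (nat (y + k)) (nat k)" "nat (x + k) \<le> a" "nat (y + k) \<le> b" "nat k \<le> c"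
    using * by (auto simp: k_def proj_def)
  then show "(x, y) \<in> hexagon a b c" unfolding hexagon_def by blast
qed (auto simp: hexagon_def proj_def)

locale boxed_partition =
  fixes a b c :: nat and p :: "(nat \<times> nat \<times> nat) set"
  assumes pp: "plane_partition a b c p"
begin

lemma in_p_bounds: "(i, j, k) \<in> p \<Longrightarrow> i \<in> {1..a} \<and> j \<in> {1..b} \<and> k \<in> {1..c}"
  using pp by (auto simp: plane_partition_def)

lemma in_p_mono:
  "(n, m, l) \<in> p \<Longrightarrow> 1 \<le> i \<Longrightarrow> i \<le> n \<Longrightarrow> 1 \<le> j \<Longrightarrow> j \<le> m \<Longrightarrow> 1 \<le> k \<Longrightarrow> k \<le> l \<Longrightarrow> (i, j, k) \<in> p"
  using pp unfolding plane_partition_def by (metis atLeastAtMost_iff)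

lemma filled_mono:
  assumes "filled p x' y' z'" "x \<le> x'" "y \<le> y'" "z \<le> z'"
  shows "filled p x y z"
proof (cases "x \<le> 0 \<or> y \<le> 0 \<or> z \<le> 0")
  case False
  then have "(nat x', nat y', nat z') \<in> p" using assms by (auto simp: filled_def)
  then have "(nat x, nat y, nat z) \<in> p" by (rule in_p_mono) (use False assms in auto)
  then show ?thesis by (simp add: filled_def)
qed (auto simp: filled_def)

lemma not_filled_outside:
  "0 < x \<Longrightarrow> 0 < y \<Longrightarrow> 0 < z \<Longrightarrow> int a < x \<or> int b < y \<or> int c < z \<Longrightarrow> \<not> filled p x y z"
  using in_p_bounds by (force simp: filled_def)

text \<open>The points above \<open>(x, y)\<close> are \<open>(x + k, y + k, k)\<close>, and the solid ones form an initial segment. All properties of the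
  surface follow from this characterization.\<close>

lemma le_surface_iff: "k \<le> surface p (x, y) \<longleftrightarrow> filled p (x + k) (y + k) k"
proof -
  define P where "P n \<longleftrightarrow> \<not> filled p (x + int n) (y + int n) (int n)" for n
  define m where "m = (LEAST n. P n)"
  have "P (nat \<bar>x\<bar> + nat \<bar>y\<bar> + c + 1)"
    unfolding P_def by (rule not_filled_outside) auto
  then have m: "P m" unfolding m_def by (rule LeastI)
  have below: "\<not> P n" if "n < m" for n using that not_less_Least unfolding m_def by blast
  have "m \<noteq> 0"
  proof
    assume "m = 0" with m show False by (simp add: P_def filled_def)
  qed
  have s: "surface p (x, y) = int m - 1" by (simp add: m_def P_def[abs_def])
  show ?thesis
  proof
    assume "k \<le> surface p (x, y)"
    then have "k \<le> int m - 1" by (simp only: s)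
    moreover have "filled p (x + int (m - 1)) (y + int (m - 1)) (int (m - 1))"
      using below[of "m - 1"] \<open>m \<noteq> 0\<close> by (simp add: P_def)
    ultimately show "filled p (x + k) (y + k) k"
      by (elim filled_mono) (use \<open>m \<noteq> 0\<close> in auto)
  next
    assume f: "filled p (x + k) (y + k) k"
    show "k \<le> surface p (x, y)"
    proof (rule ccontr)
      assume "\<not> k \<le> surface p (x, y)"
      then have "int m \<le> k" by (simp only: s)
      then have "filled p (x + int m) (y + int m) (int m)" by (intro filled_mono[OF f]) auto
      then show False using m by (simp add: P_def)
    qed
  qed
qed

declare surface.simps [simp del]

lemma surface_filled: "filled p (x + surface p (x, y)) (y + surface p (x, y)) (surface p (x, y))"
  using le_surface_iff[of "surface p (x, y)" x y] by simp

lemma surface_not_filled: "\<not> filled p (x + surface p (x, y) + 1) (y + surface p (x, y) + 1) (surface p (x, y) + 1)"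
  using le_surface_iff[of "surface p (x, y) + 1" x y] by (simp add: add.assoc)

lemma surface_eqI:
  assumes "filled p (x + k) (y + k) k" "\<not> filled p (x + k + 1) (y + k + 1) (k + 1)"
  shows "surface p (x, y) = k"
  using le_surface_iff[of k x y] le_surface_iff[of "k + 1" x y] assms by (simp add: add.assoc)

lemma surface_step:
  "surface p (x - 1, y - 1) \<in> {surface p (x, y), surface p (x, y) + 1}"
  "surface p (x, y + 1) \<in> {surface p (x, y), surface p (x, y) - 1}"
  "surface p (x + 1, y) \<in> {surface p (x, y), surface p (x, y) - 1}"
proof -
  define k where "k = surface p (x, y)"
  have f: "filled p (x + k) (y + k) k" "\<not> filled p (x + k + 1) (y + k + 1) (k + 1)"
    using surface_filled surface_not_filled by (simp_all add: k_def)
  have "k \<le> surface p (x - 1, y - 1)" unfolding le_surface_iff by (rule filled_mono[OF f(1)]) auto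
  moreover have "\<not> k + 2 \<le> surface p (x - 1, y - 1)"
    unfolding le_surface_iff
    using f(2) filled_mono[of "x - 1 + (k + 2)" "y - 1 + (k + 2)" "k + 2" "x + k + 1" "y + k + 1" "k + 1"] by auto
  ultimately show "surface p (x - 1, y - 1) \<in> {surface p (x, y), surface p (x, y) + 1}"
    by (auto simp: k_def)
  have "k - 1 \<le> surface p (x, y + 1)" unfolding le_surface_iff by (rule filled_mono[OF f(1)]) auto
  moreover have "\<not> k + 1 \<le> surface p (x, y + 1)"
    unfolding le_surface_iff
    using f(2) filled_mono[of "x + (k + 1)" "y + 1 + (k + 1)" "k + 1" "x + k + 1" "y + k + 1" "k + 1"] by auto
  ultimately show "surface p (x, y + 1) \<in> {surface p (x, y), surface p (x, y) - 1}"
    by (auto simp: k_def)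
  have "k - 1 \<le> surface p (x + 1, y)" unfolding le_surface_iff by (rule filled_mono[OF f(1)]) auto
  moreover have "\<not> k + 1 \<le> surface p (x + 1, y)"
    unfolding le_surface_iff
    using f(2) filled_mono[of "x + 1 + (k + 1)" "y + (k + 1)" "k + 1" "x + k + 1" "y + k + 1" "k + 1"] by auto
  ultimately show "surface p (x + 1, y) \<in> {surface p (x, y), surface p (x, y) - 1}"
    by (auto simp: k_def)
qed

lemma coord_surface_bounds:
  assumes "P \<in> hexagon a b c"
  shows "0 \<le> coord (surface p) r P" and "coord (surface p) E1 P \<le> int a"
    and "coord (surface p) E2 P \<le> int b" and "coord (surface p) E3 P \<le> int c"
proof -
  obtain x y where P: "P = (x, y)" by (cases P)
  have h: "- int c \<le> x" "x \<le> int a" "- int c \<le> y" "y \<le> int b" "- int b \<le> x - y" "x - y \<le> int a"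
    using assms by (auto simp: P hexagon_iff)
  have "0 \<le> surface p (x, y)" "- x \<le> surface p (x, y)" "- y \<le> surface p (x, y)"
    unfolding le_surface_iff by (simp_all add: filled_def)
  then show "0 \<le> coord (surface p) r P" by (cases r) (auto simp: P)
  have "\<not> int a - x + 1 \<le> surface p (x, y)"
    unfolding le_surface_iff by (rule not_filled_outside) (use h in auto)
  then show "coord (surface p) E1 P \<le> int a" by (simp add: P)
  have "\<not> int b - y + 1 \<le> surface p (x, y)"
    unfolding le_surface_iff by (rule not_filled_outside) (use h in auto)
  then show "coord (surface p) E2 P \<le> int b" by (simp add: P)
  have "\<not> int c + 1 \<le> surface p (x, y)"
    unfolding le_surface_iff by (rule not_filled_outside) (use h in auto)
  then show "coord (surface p) E3 P \<le> int c" by (simp add: P)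
qed

abbreviation H where "H \<equiv> hourglasses (pp_web a b c p)"

lemma solid_filled: "solid p i j k \<longleftrightarrow> filled p (int i) (int j) (int k)"
  by (auto simp: solid_def filled_def)

text \<open>A face orthogonal to the first axis is visible at the surface point \<open>(i, j, k)\<close> iff the step in direction \<open>e\<^sub>1\<close> from
  there leaves the solid region, that is, iff the surface drops. The next two lemmas are analogous.\<close>

lemma hourglass_E1_iff:
  assumes "(x, y) \<in> hexagon a b c" "(x + 1, y) \<in> hexagon a b c"
  shows "((x, y), E1) \<in> H \<longleftrightarrow> surface p (x + 1, y) = surface p (x, y) - 1"
proof
  assume "((x, y), E1) \<in> H"
  then obtain i j k where ijk: "(x, y) = proj i j k" "solid p i j k" "\<not> solid p (i + 1) j k"
    by (auto simp: pp_web_def)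
  have K: "surface p (x, y) = int k"
    by (rule surface_eqI) (use ijk filled_mono in \<open>auto simp: solid_filled proj_def\<close>)
  have "\<not> surface p (x, y) \<le> surface p (x + 1, y)"
    unfolding le_surface_iff using ijk by (simp add: solid_filled proj_def K algebra_simps)
  then show "surface p (x + 1, y) = surface p (x, y) - 1" using surface_step[of x y] K by auto
next
  define k where "k = surface p (x, y)"
  assume "surface p (x + 1, y) = surface p (x, y) - 1"
  then have "\<not> surface p (x, y) \<le> surface p (x + 1, y)" using surface_step[of x y] by auto
  then have nf: "\<not> filled p (x + k + 1) (y + k) k" unfolding le_surface_iff by (simp add: k_def algebra_simps)
  have f: "filled p (x + k) (y + k) k" using surface_filled by (simp add: k_def)
  have pos: "0 < x + k + 1" "0 < y + k" "0 < k" using nf by (auto simp: filled_def)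
  have bounds: "0 \<le> x + k" "0 \<le> y + k" "0 \<le> k" "x + k \<le> int a" "y + k \<le> int b" "k \<le> int c"
    using coord_surface_bounds[OF assms(1)] coord_surface_bounds(1)[OF assms(1), of E1]
      coord_surface_bounds(1)[OF assms(1), of E2] coord_surface_bounds(1)[OF assms(1), of E3]
    by (simp_all add: k_def)
  show "((x, y), E1) \<in> H"
    unfolding pp_web_def
    by simp (rule exI[of _ "nat (x + k)"], rule exI[of _ "nat (y + k)"], rule exI[of _ "nat k"],
      use pos bounds f nf in \<open>auto simp: solid_filled proj_def algebra_simps\<close>)
qed

lemma hourglass_E2_iff:
  assumes "(x, y) \<in> hexagon a b c" "(x, y + 1) \<in> hexagon a b c"
  shows "((x, y), E2) \<in> H \<longleftrightarrow> surface p (x, y + 1) = surface p (x, y) - 1"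
proof
  assume "((x, y), E2) \<in> H"
  then obtain i j k where ijk: "(x, y) = proj i j k" "solid p i j k" "\<not> solid p i (j + 1) k"
    by (auto simp: pp_web_def)
  have K: "surface p (x, y) = int k"
    by (rule surface_eqI) (use ijk filled_mono in \<open>auto simp: solid_filled proj_def\<close>)
  have "\<not> surface p (x, y) \<le> surface p (x, y + 1)"
    unfolding le_surface_iff using ijk by (simp add: solid_filled proj_def K algebra_simps)
  then show "surface p (x, y + 1) = surface p (x, y) - 1" using surface_step[of x y] K by auto
next
  define k where "k = surface p (x, y)"
  assume "surface p (x, y + 1) = surface p (x, y) - 1"
  then have "\<not> surface p (x, y) \<le> surface p (x, y + 1)" using surface_step[of x y] by auto
  then have nf: "\<not> filled p (x + k) (y + k + 1) k" unfolding le_surface_iff by (simp add: k_def algebra_simps)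
  have f: "filled p (x + k) (y + k) k" using surface_filled by (simp add: k_def)
  have pos: "0 < x + k" "0 < y + k + 1" "0 < k" using nf by (auto simp: filled_def)
  have bounds: "0 \<le> x + k" "0 \<le> y + k" "0 \<le> k" "x + k \<le> int a" "y + k \<le> int b" "k \<le> int c"
    using coord_surface_bounds[OF assms(1)] coord_surface_bounds(1)[OF assms(1), of E1]
      coord_surface_bounds(1)[OF assms(1), of E2] coord_surface_bounds(1)[OF assms(1), of E3]
    by (simp_all add: k_def)
  show "((x, y), E2) \<in> H"
    unfolding pp_web_def
    by simp (rule exI[of _ "nat (x + k)"], rule exI[of _ "nat (y + k)"], rule exI[of _ "nat k"],
      use pos bounds f nf in \<open>auto simp: solid_filled proj_def algebra_simps\<close>)
qed

lemma hourglass_E3_iff: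
  assumes "(x, y) \<in> hexagon a b c" "(x - 1, y - 1) \<in> hexagon a b c"
  shows "((x, y), E3) \<in> H \<longleftrightarrow> surface p (x - 1, y - 1) = surface p (x, y)"
proof
  assume "((x, y), E3) \<in> H"
  then obtain i j k where ijk: "(x, y) = proj i j k" "solid p i j k" "\<not> solid p i j (k + 1)"
    by (auto simp: pp_web_def)
  have K: "surface p (x, y) = int k"
    by (rule surface_eqI) (use ijk filled_mono in \<open>auto simp: solid_filled proj_def\<close>)
  have "\<not> surface p (x, y) + 1 \<le> surface p (x - 1, y - 1)"
    unfolding le_surface_iff using ijk by (simp add: solid_filled proj_def K algebra_simps)
  then show "surface p (x - 1, y - 1) = surface p (x, y)" using surface_step[of x y] K by auto
next
  define k where "k = surface p (x, y)"
  assume "surface p (x - 1, y - 1) = surface p (x, y)"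
  then have "\<not> surface p (x, y) + 1 \<le> surface p (x - 1, y - 1)" using surface_step[of x y] by auto
  then have nf: "\<not> filled p (x + k) (y + k) (k + 1)" unfolding le_surface_iff by (simp add: k_def algebra_simps)
  have f: "filled p (x + k) (y + k) k" using surface_filled by (simp add: k_def)
  have pos: "0 < x + k" "0 < y + k" "0 < k + 1" using nf by (auto simp: filled_def)
  have bounds: "0 \<le> x + k" "0 \<le> y + k" "0 \<le> k" "x + k \<le> int a" "y + k \<le> int b" "k \<le> int c"
    using coord_surface_bounds[OF assms(1)] coord_surface_bounds(1)[OF assms(1), of E1]
      coord_surface_bounds(1)[OF assms(1), of E2] coord_surface_bounds(1)[OF assms(1), of E3]
    by (simp_all add: k_def)
  show "((x, y), E3) \<in> H"
    unfolding pp_web_def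
    by simp (rule exI[of _ "nat (x + k)"], rule exI[of _ "nat (y + k)"], rule exI[of _ "nat k"],
      use pos bounds f nf in \<open>auto simp: solid_filled proj_def algebra_simps\<close>)
qed

lemma stepped_web_surface:
  assumes "D \<subseteq> hexagon a b c"
  shows "stepped_web (surface p) D H"
proof
  fix u :: dir and P :: point
  obtain x y where P: "P = (x, y)" by (cases P)
  show "coord (surface p) u (P + vec u) \<in> {coord (surface p) u P, coord (surface p) u P + 1}"
    using surface_step[of x y] by (cases u) (auto simp: P)
  show "(P, u) \<in> H \<longleftrightarrow> coord (surface p) u (P + vec u) = coord (surface p) u P"
    if "P \<in> D" "P + vec u \<in> D"
  proof -
    have "P \<in> hexagon a b c" "P + vec u \<in> hexagon a b c" using that assms by auto
    then show ?thesis
      using hourglass_E1_iff[of x y] hourglass_E2_iff[of x y] hourglass_E3_iff[of x y]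
      by (cases u) (auto simp: P)
  qed
qed

lemma restrict_web_eq:
  assumes "hexagon a b c \<inter> R = D"
  shows "restrict_web (pp_web a b c p) R = stepped_web.W D H"
proof -
  have "stepped_web (surface p) D H" by (rule stepped_web_surface) (use assms in auto)
  from stepped_web.W_def[OF this] show ?thesis
    using assms by (auto simp: restrict_web_def pp_web_def)
qed

lemma surface_top: "surface p (- int c, - int c) = int c"
proof -
  have "(- int c, - int c) \<in> hexagon a b c" by (simp add: hexagon_iff)
  from coord_surface_bounds(1)[OF this, of E1] coord_surface_bounds(4)[OF this]
  show ?thesis by simp
qed

end

section \<open>Boundary words and hourglasses on the cuts\<close>

context stepped_web
begin

lemma along_E2:
  assumes "y \<le> y'"
  shows "K (x, y') \<le> K (x, y) \<and> y + K (x, y) \<le> y' + K (x, y')"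
  using assms
proof (induction y' rule: int_ge_induct)
  case (step i)
  then show ?case using stepped_sides(2)[of x i] by auto
qed simp

lemma adjacent_sym: "adjacent A B \<longleftrightarrow> adjacent B A"
  by (auto simp: adjacent_def)

lemma adjacent_edge: "is_edge (A, u) \<Longrightarrow> adjacent (A + vec u) A"
  by (auto simp: adjacent_def)

lemma linked_int:
  assumes "lo \<le> hi" "\<And>t. lo \<le> t \<Longrightarrow> t < hi \<Longrightarrow> adjacent (q (t + 1)) (q t)"
    and "\<And>t. lo \<le> t \<Longrightarrow> t \<le> hi \<Longrightarrow> R (q t)"
  shows "linked R (q hi) (q (lo::int))"
  using assms
proof (induction hi rule: int_ge_induct)
  case (step i)
  then have "linked R (q i) (q lo)" by auto
  moreover have "linked R (q (i + 1)) (q i)" using step by (intro linked_adjacent) auto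
  ultimately show ?case using linked_trans by blast
qed simp

lemma walk_E1:
  assumes "x0 \<le> x1" "\<And>t. x0 \<le> t \<Longrightarrow> t < x1 \<Longrightarrow> is_edge ((t, y), E1)"
    and "\<And>t. x0 \<le> t \<Longrightarrow> t \<le> x1 \<Longrightarrow> R (t, y)"
  shows "linked R (x1, y) (x0, y)"
  using assms by (intro linked_int[of x0 x1 "\<lambda>t. (t, y)"]) (use adjacent_edge[of _ E1] in force)+

lemma walk_E2:
  assumes "y0 \<le> y1" "\<And>t. y0 \<le> t \<Longrightarrow> t < y1 \<Longrightarrow> is_edge ((x, t), E2)"
    and "\<And>t. y0 \<le> t \<Longrightarrow> t \<le> y1 \<Longrightarrow> R (x, t)"
  shows "linked R (x, y1) (x, y0)"
  using assms by (intro linked_int[of y0 y1 "\<lambda>t. (x, t)"]) (use adjacent_edge[of _ E2] in force)+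

lemma walk_E3:
  assumes "lo \<le> hi" "\<And>t. lo < t \<Longrightarrow> t \<le> hi \<Longrightarrow> is_edge ((x + t, y + t), E3)"
    and "\<And>t. lo \<le> t \<Longrightarrow> t \<le> hi \<Longrightarrow> R (x + t, y + t)"
  shows "linked R (x + hi, y + hi) (x + lo, y + lo)"
proof (rule linked_int[of lo hi "\<lambda>t. (x + t, y + t)"])
  fix t assume "lo \<le> t" "t < hi"
  then have "adjacent ((x + (t + 1), y + (t + 1)) + vec E3) (x + (t + 1), y + (t + 1))"
    using assms(2)[of "t + 1"] by (intro adjacent_edge) auto
  then show "adjacent (x + (t + 1), y + (t + 1)) (x + t, y + t)"
    by (simp add: adjacent_sym)
qed (use assms in auto)

end

context cut_web
begin

definition block :: "side \<Rightarrow> letter list" where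
  "block s = map (\<lambda>i. boundary_letter W F0 (s, i)) (rev [0..<weight W s])"

lemma boundary_word_block: "boundary_word W F0 ss = map block ss"
  by (simp add: boundary_word_def block_def[abs_def])

lemma block_eq:
  "block s = (if s \<in> H then [boundary_letter W F0 (s, 1), boundary_letter W F0 (s, 0)] else [boundary_letter W F0 (s, 0)])"
  by (simp add: block_def weight_def numeral_2_eq_2)

lemma letter_white: "white_of s \<in> V \<Longrightarrow> boundary_letter W F0 (s, i) = Plain (sep W F0 (s, i))"
  unfolding boundary_letter_def W_simps fst_conv by (simp only: if_True)

lemma letter_black: "white_of s \<notin> V \<Longrightarrow> boundary_letter W F0 (s, i) = Bar (sep W F0 (s, i))"
  unfolding boundary_letter_def W_simps fst_conv by (simp only: if_False)

lemma is_edge_white: "white_of s \<in> V \<Longrightarrow> is_edge s"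
  and is_edge_black: "black_of s \<in> V \<Longrightarrow> is_edge s"
  unfolding is_edge_def by blast+

lemma block_NE:
  assumes v: "white_of ((x, - c), E1) \<in> V" "black_of ((x, - c), E1) \<notin> V" and x: "- c \<le> x"
    and side: "\<And>t. - c \<le> t \<Longrightarrow> t < x \<Longrightarrow> white_of ((t, - c), E1) \<in> V"
  shows "block ((x, - c), E1) = [Plain 1]"
proof -
  have "linked (\<lambda>Q. snd Q = - c \<and> fst Q \<le> x) (x, - c) (- c, - c)"
    by (rule walk_E1) (use x side is_edge_white in auto)
  from sep_NE[OF v this] show ?thesis
    using NE_boundary[OF v] by (simp only: block_eq letter_white[OF v(1)] if_False simp_thms)
qed

lemma block_E3_black:
  assumes v: "black_of ((x, y), E3) \<in> V" "white_of ((x, y), E3) \<notin> V" and "- c < x" "- c < y"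
  shows "block ((x, y), E3) = [Bar 4]"
proof -
  have H: "((x, y), E3) \<notin> H" using black_boundary[OF v] by simp
  show ?thesis
    using sep_vertical_simple[OF is_edge_black[OF v(1)] H assms(3,4)]
    by (simp only: block_eq letter_black[OF v(2)] H if_False simp_thms)
qed

lemma block_vertical:
  assumes v: "white_of ((t, t), E3) \<in> V" "black_of ((t, t), E3) \<notin> V" and t: "- c < t"
    and side: "\<And>t'. - c < t' \<Longrightarrow> t' < t \<Longrightarrow> white_of ((t', t'), E3) \<in> V"
  shows "block ((t, t), E3) = (if ((t, t), E3) \<in> H then [Plain 3, Plain 4] else [Plain 4])"
proof (cases "((t, t), E3) \<in> H")
  case False
  then show ?thesis
    using sep_vertical_simple[OF is_edge_white[OF v(1)] False t t]
    by (simp only: block_eq letter_white[OF v(1)] if_False simp_thms)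
next
  case True
  have "linked (\<lambda>Q. fst Q < t) (0 + (t - 1), 0 + (t - 1)) (0 + - c, 0 + - c)"
    by (rule walk_E3) (use t side is_edge_white in auto)
  then have walk: "linked (\<lambda>Q. fst Q < t) (t - 1, t - 1) (- c, - c)" by simp
  show ?thesis
    using sep_vertical_hourglass[OF v True t walk] True
    by (simp only: block_eq letter_white[OF v(1)] if_True simp_thms)
qed

lemma block_E2:
  assumes v: "white_of ((x, y), E2) \<in> V" "black_of ((x, y), E2) \<notin> V" and "y < x"
    and walk: "linked (\<lambda>Q. snd Q \<le> y \<and> coord K E2 Q \<le> coord K E2 (x, y) \<and> K (x, y) \<le> K Q) (x, y) (- c, - c)"
  shows "block ((x, y), E2) = (if ((x, y), E2) \<in> H then [Plain 2, Plain 3] else [Plain 2])"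
proof (cases "((x, y), E2) \<in> H")
  case False
  show ?thesis
    using sep_E2_simple[OF v False assms(3) linked_mono[OF walk]] False
    by (simp only: block_eq letter_white[OF v(1)] if_False simp_thms)
next
  case True
  show ?thesis
    using sep_E2_hourglass[OF v True assms(3) linked_mono[OF walk]] True
    by (simp only: block_eq letter_white[OF v(1)] if_True simp_thms)
qed

lemma block_E1:
  assumes v: "black_of ((x, y), E1) \<in> V" "white_of ((x, y), E1) \<notin> V"
    and walk: "linked (\<lambda>Q. fst Q \<le> x \<and> fst Q - snd Q \<le> x - y \<and>
      coord K E1 Q \<le> coord K E1 (x, y) \<and> K (x, y) \<le> K Q) (x, y) (- c, - c)"
  shows "block ((x, y), E1) = (if ((x, y), E1) \<in> H then [Bar 3, Bar 1] else [Bar 1])"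
proof (cases "((x, y), E1) \<in> H")
  case False
  show ?thesis
    using sep_E1_simple[OF v False linked_mono[OF walk]] False
    by (simp only: block_eq letter_black[OF v(2)] if_False simp_thms)
next
  case True
  show ?thesis
    using sep_E1_hourglass[OF v True linked_mono[OF walk]] True
    by (simp only: block_eq letter_black[OF v(2)] if_True simp_thms)
qed

lemma NE_values:
  assumes "(x, - c) \<in> D"
  shows "K (x, - c) = c"
  using in_box(1)[OF assms, of E2] in_box(2)[OF assms] by simp

end

context boxed_partition
begin

lemma NE_side_simple:
  assumes "(x, - int c) \<in> hexagon a b c" "(x + 1, - int c) \<in> hexagon a b c"
  shows "((x, - int c), E1) \<notin> H"
  using hourglass_E1_iff[OF assms] coord_surface_bounds[OF assms(1)] coord_surface_bounds(1)[OF assms(1), of E2]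
    coord_surface_bounds[OF assms(2)] coord_surface_bounds(1)[OF assms(2), of E2] by simp

text \<open>The E side is the edge at \<open>i = a\<close>, \<open>j = 0\<close> of the box, which lies in a wall.\<close>

lemma E_side_simple:
  assumes "(x, y) \<in> hexagon a b c" "(x - 1, y - 1) \<in> hexagon a b c" "x - y = int a"
  shows "((x, y), E3) \<notin> H"
proof -
  have "y + surface p (x, y) \<le> 0" using coord_surface_bounds(2)[OF assms(1)] assms(3) by simp
  then have "surface p (x, y) + 1 \<le> surface p (x - 1, y - 1)"
    unfolding le_surface_iff by (simp add: filled_def)
  then show ?thesis using hourglass_E3_iff[OF assms(1,2)] by simp
qed

text \<open>The properties of heights hold on every part of the hexagon; only the shape of the boundary has to be checked for a
  particular domain.\<close>

lemma cut_web_surface: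
  assumes "D \<subseteq> hexagon a b c" "(- int c, - int c) \<in> D"
    and black: "\<And>x y u. corners (black_of ((x, y), u)) \<subseteq> D \<Longrightarrow> \<not> corners (white_of ((x, y), u)) \<subseteq> D \<Longrightarrow>
      u = E3 \<and> ((x, y), u) \<notin> H \<or> u = E1 \<and> slanted \<and> y = 0 \<and> 0 \<le> x"
    and NE: "\<And>x y. corners (white_of ((x, y), E1)) \<subseteq> D \<Longrightarrow> \<not> corners (black_of ((x, y), E1)) \<subseteq> D \<Longrightarrow> y = - int c"
    and vertical: "\<And>x y. corners (white_of ((x, y), E3)) \<subseteq> D \<Longrightarrow> \<not> corners (black_of ((x, y), E3)) \<subseteq> D \<Longrightarrow> x = y"
    and slanted: "\<And>t. slanted \<Longrightarrow> (t, t) \<in> D \<Longrightarrow> t \<le> 0"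
  shows "cut_web (surface p) D H (int c) (int a + int b + int c) slanted"
proof -
  interpret stepped_web "surface p" D H by (rule stepped_web_surface) (rule assms(1))
  have sub: "P \<in> hexagon a b c" if "P \<in> D" for P using that assms(1) by blast
  show ?thesis
  proof
    show "(- int c, - int c) \<in> D" by (rule assms(2))
    show "surface p (- int c, - int c) = int c" by (rule surface_top)
  next
    fix x y assume "(x, y) \<in> D"
    then show "\<bar>x\<bar> \<le> int a + int b + int c \<and> \<bar>y\<bar> \<le> int a + int b + int c"
      using sub[of "(x, y)"] by (auto simp: hexagon_iff)
  next
    fix P r assume "P \<in> D" then show "0 \<le> coord (surface p) r P" using sub coord_surface_bounds(1) by blast
  next
    fix P assume "P \<in> D" then show "surface p P \<le> int c" using sub coord_surface_bounds(4) by (cases P) fastforce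
  next
    fix x y u assume "black_of ((x, y), u) \<in> V" "white_of ((x, y), u) \<notin> V"
    then show "u = E3 \<and> ((x, y), u) \<notin> H \<or> u = E1 \<and> slanted \<and> y = 0 \<and> 0 \<le> x"
      using black unfolding mem_Collect_eq by blast
  next
    fix x y assume w: "white_of ((x, y), E1) \<in> V" "black_of ((x, y), E1) \<notin> V"
    then have y: "y = - int c" using NE unfolding mem_Collect_eq by blast
    have "is_edge ((x, y), E1)" using w unfolding is_edge_def by blast
    from is_edge_in_D[OF this] show "y = - int c \<and> ((x, y), E1) \<notin> H"
      using NE_side_simple[OF sub sub, of x] by (simp add: y)
  next
    fix x y assume "white_of ((x, y), E3) \<in> V" "black_of ((x, y), E3) \<notin> V"
    then show "x = y" using vertical unfolding mem_Collect_eq by blast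
  next
    fix t assume "slanted" "(t, t) \<in> D" then show "t \<le> 0" by (rule slanted)
  qed
qed

end

lemma map_eq_replicate: "(\<And>x. x \<in> set xs \<Longrightarrow> f x = y) \<Longrightarrow> map f xs = replicate (length xs) y"
  by (induction xs) auto

lemma SPP_word_eq:
  assumes "plane_partition a a c p" "1 \<le> a" "1 \<le> c"
  shows "SPP_word a c p = replicate a [Plain 1] @ replicate c [Bar 4] @ replicate a [Plain 2] @
    map (\<lambda>k. if (proj a a k, E3) \<in> hourglasses (pp_web a a c p) then [Plain 3, Plain 4] else [Plain 4]) [0..<a + c]"
proof -
  interpret boxed_partition a a c p by unfold_locales (rule assms)
  define D :: "point set" where "D = {(x, y). y \<le> x \<and> - int c \<le> y \<and> x \<le> int a \<and> x - y \<le> int a}"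
  have D: "(x, y) \<in> D \<longleftrightarrow> y \<le> x \<and> - int c \<le> y \<and> x \<le> int a \<and> x - y \<le> int a" for x y
    by (simp add: D_def)
  have hex: "hexagon a a c \<inter> right_half = D"
    by (auto simp: hexagon_iff right_half_iff D)
  have sub: "P \<in> hexagon a a c" if "P \<in> D" for P using that hex by blast
  interpret stepped_web "surface p" D H by (rule stepped_web_surface) (use hex in blast)
  interpret cut_web "surface p" D H "int c" "int a + int a + int c" False
  proof (rule cut_web_surface)
    show "D \<subseteq> hexagon a a c" using hex by blast
  next
    fix x y u assume "corners (black_of ((x, y), u)) \<subseteq> D" "\<not> corners (white_of ((x, y), u)) \<subseteq> D"
    then show "u = E3 \<and> ((x, y), u) \<notin> H \<or> u = E1 \<and> False \<and> y = 0 \<and> 0 \<le> x"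
      using E_side_simple[OF sub sub, of x y] by (cases u) (auto simp: D)
  qed (auto simp: D)
  have W: "restrict_web (pp_web a a c p) right_half = W" by (rule restrict_web_eq[OF hex])
  have F0: "Around (proj 0 0 c) = F0" by (simp add: F0_def proj_def)
  have vertical: "block ((t, t), E3) = (if ((t, t), E3) \<in> H then [Plain 3, Plain 4] else [Plain 4])"
    if "- int c < t" "t \<le> int a" for t
    using that assms(2) by (intro block_vertical) (auto simp: D)
  have "map block (NE_side a c) = replicate (length (NE_side a c)) [Plain 1]"
    by (rule map_eq_replicate) (auto simp: NE_side_def proj_def D intro!: block_NE[unfolded One_nat_def])
  moreover have "map block (E_side a c) = replicate (length (E_side a c)) [Bar 4]"
    by (rule map_eq_replicate) (use assms in \<open>auto simp: E_side_def proj_def D intro!: block_E3_black\<close>)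
  moreover have "map block (SE_side a a) = replicate (length (SE_side a a)) [Plain 2]"
  proof (rule map_eq_replicate)
    fix s assume "s \<in> set (SE_side a a)"
    then obtain j where j: "j < a" "s = ((int a, int j), E2)" by (auto simp: SE_side_def proj_def)
    have in_D: "(int a, int j) \<in> D" "(int a, int j + 1) \<in> D" using j by (auto simp: D)
    have K: "surface p (int a, int j) = 0" "surface p (int a, int j + 1) = 0"
      using coord_surface_bounds(1,2)[OF sub[OF in_D(1)]] coord_surface_bounds(1)[OF sub[OF in_D(1)], of E3]
       coord_surface_bounds(1,2)[OF sub[OF in_D(2)]] coord_surface_bounds(1)[OF sub[OF in_D(2)], of E3] by auto
    then have H: "s \<notin> H" using hourglass_E2_iff[OF sub sub, OF in_D] by (simp add: j)
    let ?R = "\<lambda>Q. snd Q \<le> int j \<and> coord (surface p) E2 Q \<le> coord (surface p) E2 (int a, int j) \<and>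
      surface p (int a, int j) \<le> surface p Q"
    have nonneg: "0 \<le> surface p Q" if "Q \<in> D" for Q
      using coord_surface_bounds(1)[OF sub[OF that], of E3] by (cases Q) simp
    have "linked ?R (int a, int j) (int a, 0)"
      by (rule walk_E2) (use j K nonneg along_E2[of _ "int j" "int a"] in \<open>auto simp: D is_edge_def\<close>)
    moreover have "linked ?R (int a + 0, 0 + 0) (int a + - int c, 0 + - int c)"
    proof (rule walk_E3)
      fix t :: int assume t: "- int c \<le> t" "t \<le> 0"
      then have in_D: "(int a + t, t) \<in> D" by (auto simp: D)
      then show "?R (int a + t, 0 + t)"
        using coord_surface_bounds(2)[OF sub[OF in_D]] nonneg[OF in_D] t K by simp
    qed (use j in \<open>auto simp: D is_edge_def\<close>)
    moreover have "linked ?R (int a + - int c, - int c) (- int c, - int c)"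
    proof (rule walk_E1)
      fix t assume t: "- int c \<le> t" "t \<le> int a + - int c"
      then have in_D: "(t, - int c) \<in> D" by (auto simp: D)
      then show "?R (t, - int c)" using NE_values[OF in_D] K by simp
    qed (auto simp: D is_edge_def)
    ultimately have "linked ?R (int a, int j) (- int c, - int c)"
      using linked_trans by (metis (no_types, lifting) add_0 add.right_neutral)
    then have "block s = (if s \<in> H then [Plain 2, Plain 3] else [Plain 2])"
      using j unfolding j(2) by (intro block_E2) (auto simp: D)
    then show "block s = [Plain 2]" using H by simp
  qed
  moreover have "map block (map (\<lambda>k. (proj a a k, E3)) [0..<a + c]) =
    map (\<lambda>k. if (proj a a k, E3) \<in> H then [Plain 3, Plain 4] else [Plain 4]) [0..<a + c]"
    unfolding map_map by (rule map_cong[OF refl]) (auto simp: proj_def vertical)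
  ultimately show ?thesis
    unfolding SPP_word_def W F0 boundary_word_block map_append
    by (simp add: NE_side_def E_side_def SE_side_def)
qed

lemma CSPP_word_eq:
  assumes "plane_partition a a a p" "1 \<le> a"
  shows "CSPP_word a p = replicate a [Plain 1] @ replicate a [Bar 4] @
    map (\<lambda>i. if (proj i 0 0, E1) \<in> hourglasses (pp_web a a a p) then [Bar 3, Bar 1] else [Bar 1]) (rev [0..<a]) @
    map (\<lambda>k. if (proj 0 0 k, E3) \<in> hourglasses (pp_web a a a p) then [Plain 3, Plain 4] else [Plain 4]) [0..<a]"
proof -
  interpret boxed_partition "a" "a" "a" p by unfold_locales (rule assms)
  define D :: "point set" where "D = {(x, y). y \<le> x \<and> y \<le> 0 \<and> - int a \<le> y \<and> x \<le> int a \<and> x - y \<le> int a}"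
  have D: "(x, y) \<in> D \<longleftrightarrow> y \<le> x \<and> y \<le> 0 \<and> - int a \<le> y \<and> x \<le> int a \<and> x - y \<le> int a" for x y
    by (simp add: D_def)
  have hex: "hexagon a a a \<inter> sector (2 * pi / 3) = D"
    by (auto simp: hexagon_iff sector_120 D)
  have sub: "P \<in> hexagon a a a" if "P \<in> D" for P using that hex by blast
  interpret stepped_web "surface p" D H by (rule stepped_web_surface) (use hex in blast)
  interpret cut_web "surface p" D H "int a" "int a + int a + int a" True
  proof (rule cut_web_surface)
    show "D \<subseteq> hexagon a a a" using hex by blast
  next
    fix x y u assume "corners (black_of ((x, y), u)) \<subseteq> D" "\<not> corners (white_of ((x, y), u)) \<subseteq> D"
    then show "u = E3 \<and> ((x, y), u) \<notin> H \<or> u = E1 \<and> True \<and> y = 0 \<and> 0 \<le> x"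
      using E_side_simple[OF sub sub, of x y] by (cases u) (auto simp: D)
  qed (auto simp: D)
  have W: "restrict_web (pp_web a a a p) (sector (2 * pi / 3)) = W" by (rule restrict_web_eq[OF hex])
  have F0: "Around (proj 0 0 a) = F0" by (simp add: F0_def proj_def)
  have vertical: "block ((t, t), E3) = (if ((t, t), E3) \<in> H then [Plain 3, Plain 4] else [Plain 4])"
    if "- int a < t" "t \<le> 0" for t
    using that assms(2) by (intro block_vertical) (auto simp: D)
  have "map block (NE_side a a) = replicate (length (NE_side a a)) [Plain 1]"
    by (rule map_eq_replicate) (auto simp: NE_side_def proj_def D intro!: block_NE[unfolded One_nat_def])
  moreover have "map block (E_side a a) = replicate (length (E_side a a)) [Bar 4]"
    by (rule map_eq_replicate) (use assms in \<open>auto simp: E_side_def proj_def D intro!: block_E3_black\<close>)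
  moreover have slanted: "block ((x, 0), E1) = (if ((x, 0), E1) \<in> H then [Bar 3, Bar 1] else [Bar 1])"
    if x: "0 \<le> x" "x < int a" for x
  proof -
    let ?R = "\<lambda>Q. fst Q \<le> x \<and> fst Q - snd Q \<le> x - 0 \<and>
      coord (surface p) E1 Q \<le> coord (surface p) E1 (x, 0) \<and> surface p (x, 0) \<le> surface p Q"
    have "linked ?R (x, 0) (0, 0)"
      by (rule walk_E1) (use x along_E1[of _ x 0] in \<open>auto simp: D is_edge_def\<close>)
    moreover have "linked ?R (0 + 0, 0 + 0) (0 + - int a, 0 + - int a)"
      by (rule walk_E3) (use x along_E1[of 0 x 0] along_E3[of _ 0] in \<open>fastforce simp: D is_edge_def\<close>)+
    ultimately have "linked ?R (x, 0) (- int a, - int a)"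
      using linked_trans by (metis (no_types, lifting) add_0)
    then show ?thesis using x by (intro block_E1) (auto simp: D)
  qed
  have "map block (map (\<lambda>i. (proj i 0 0, E1)) (rev [0..<a])) =
    map (\<lambda>i. if (proj i 0 0, E1) \<in> H then [Bar 3, Bar 1] else [Bar 1]) (rev [0..<a])"
    unfolding map_map by (rule map_cong[OF refl]) (auto simp: proj_def slanted)
  moreover have "map block (map (\<lambda>k. (proj 0 0 k, E3)) [0..<a]) =
    map (\<lambda>k. if (proj 0 0 k, E3) \<in> H then [Plain 3, Plain 4] else [Plain 4]) [0..<a]"
    unfolding map_map by (rule map_cong[OF refl]) (auto simp: proj_def vertical)
  ultimately show ?thesis
    unfolding CSPP_word_def W F0 boundary_word_block map_append
    by (simp add: NE_side_def E_side_def)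
qed

lemma TSPP_word_eq:
  assumes "plane_partition a a a p" "1 \<le> a"
  shows "TSPP_word a p = replicate a [Plain 1] @
    map (\<lambda>i. if (proj i 0 i, E2) \<in> hourglasses (pp_web a a a p) then [Plain 2, Plain 3] else [Plain 2]) (rev [1..<a + 1]) @
    map (\<lambda>k. if (proj 0 0 k, E3) \<in> hourglasses (pp_web a a a p) then [Plain 3, Plain 4] else [Plain 4]) [0..<a]"
proof -
  interpret boxed_partition "a" "a" "a" p by unfold_locales (rule assms)
  define D :: "point set" where "D = {(x, y). y \<le> x \<and> x \<le> 0 \<and> - int a \<le> y}"
  have D: "(x, y) \<in> D \<longleftrightarrow> y \<le> x \<and> x \<le> 0 \<and> - int a \<le> y" for x y
    by (simp add: D_def)
  have hex: "hexagon a a a \<inter> sector (pi / 3) = D"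
    by (auto simp: hexagon_iff sector_60 D)
  have sub: "P \<in> hexagon a a a" if "P \<in> D" for P using that hex by blast
  interpret stepped_web "surface p" D H by (rule stepped_web_surface) (use hex in blast)
  interpret cut_web "surface p" D H "int a" "int a + int a + int a" False
  proof (rule cut_web_surface)
    show "D \<subseteq> hexagon a a a" using hex by blast
  next
    fix x y u assume "corners (black_of ((x, y), u)) \<subseteq> D" "\<not> corners (white_of ((x, y), u)) \<subseteq> D"
    then show "u = E3 \<and> ((x, y), u) \<notin> H \<or> u = E1 \<and> False \<and> y = 0 \<and> 0 \<le> x"
      using E_side_simple[OF sub sub, of x y] by (cases u) (auto simp: D)
  qed (auto simp: D)
  have W: "restrict_web (pp_web a a a p) (sector (pi / 3)) = W" by (rule restrict_web_eq[OF hex])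
  have F0: "Around (proj 0 0 a) = F0" by (simp add: F0_def proj_def)
  have vertical: "block ((t, t), E3) = (if ((t, t), E3) \<in> H then [Plain 3, Plain 4] else [Plain 4])"
    if "- int a < t" "t \<le> 0" for t
    using that assms(2) by (intro block_vertical) (auto simp: D)
  have "map block (NE_side a a) = replicate (length (NE_side a a)) [Plain 1]"
    by (rule map_eq_replicate) (auto simp: NE_side_def proj_def D intro!: block_NE[unfolded One_nat_def])
  moreover have slanted: "block ((0, y), E2) = (if ((0, y), E2) \<in> H then [Plain 2, Plain 3] else [Plain 2])"
    if y: "- int a \<le> y" "y < 0" for y
  proof -
    let ?R = "\<lambda>Q. snd Q \<le> y \<and> coord (surface p) E2 Q \<le> coord (surface p) E2 (0, y) \<and> surface p (0, y) \<le> surface p Q"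
    have "(0, y) \<in> D" using y by (simp add: D)
    note bounds = in_box(1)[OF this, of E2] in_box(2)[OF this]
    have "linked ?R (0, y) (0, - int a)"
      by (rule walk_E2) (use y along_E2[of _ y 0] in \<open>auto simp: D is_edge_def\<close>)
    moreover have "linked ?R (0, - int a) (- int a, - int a)"
    proof (rule walk_E1)
      fix t :: int assume "- int a \<le> t" "t \<le> 0"
      then have "(t, - int a) \<in> D" by (simp add: D)
      from NE_values[OF this] show "?R (t, - int a)" using bounds y by simp
    qed (auto simp: D is_edge_def)
    ultimately have "linked ?R (0, y) (- int a, - int a)"
      by (rule linked_trans)
    then show ?thesis using y by (intro block_E2) (auto simp: D)
  qed
  have "map block (map (\<lambda>i. (proj i 0 i, E2)) (rev [1..<a + 1])) =
    map (\<lambda>i. if (proj i 0 i, E2) \<in> H then [Plain 2, Plain 3] else [Plain 2]) (rev [1..<a + 1])"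
    unfolding map_map by (rule map_cong[OF refl]) (auto simp: proj_def slanted)
  moreover have "map block (map (\<lambda>k. (proj 0 0 k, E3)) [0..<a]) =
    map (\<lambda>k. if (proj 0 0 k, E3) \<in> H then [Plain 3, Plain 4] else [Plain 4]) [0..<a]"
    unfolding map_map by (rule map_cong[OF refl]) (auto simp: proj_def vertical)
  ultimately show ?thesis
    unfolding TSPP_word_def W F0 boundary_word_block map_append
    by (simp add: NE_side_def)
qed

lemma butlast_zigzag:
  assumes "1 \<le> d"
  shows "butlast (concat (map (\<lambda>i. [f i, g i]) (rev [1..<d + 1]))) =
    concat (map (\<lambda>i. [f i, g i]) (rev [2..<d + 1])) @ [f (1::nat)]"
proof -
  have "[1..<d + 1] = 1 # [2..<d + 1]" using assms by (simp add: upt_conv_Cons numeral_2_eq_2)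
  then show ?thesis by (simp add: butlast_append)
qed

lemma concat_replicate_alternating:
  "concat (replicate k [x, y]) @ [x] = map (\<lambda>n. if even n then x else y) [0..<2 * k + 1]"
proof (induction k)
  case (Suc k)
  have "x # y # concat (replicate k [x, y]) = concat (replicate k [x, y]) @ [x, y]"
    by (induction k) auto
  then have "concat (replicate (Suc k) [x, y]) @ [x] = (concat (replicate k [x, y]) @ [x]) @ [y, x]"
    by simp
  then show ?case using Suc by simp
qed simp

text \<open>The assumption says that the slanted cut runs along hourglasses. It forces the heights at the points of the zigzag
  boundary (\<open>zigzag\<close> in the proof), so that all zigzag sides are simple edges.\<close>

lemma TSSCPP_word_eq:
  assumes "plane_partition (2 * d) (2 * d) (2 * d) p" "1 \<le> 2 * d"
    and "\<And>i. 1 \<le> i \<Longrightarrow> i \<le> int d \<Longrightarrow> surface p (1 - i, 1 - 2 * i) = surface p (- i, 1 - 2 * i) - 1"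
  shows "TSSCPP_word d p = replicate d [Plain 1] @ map (\<lambda>n. if even n then [Plain 2] else [Bar 4]) [0..<2 * d - 1] @
    map (\<lambda>k. if (proj 0 0 k, E3) \<in> hourglasses (pp_web (2 * d) (2 * d) (2 * d) p) then [Plain 3, Plain 4] else [Plain 4]) [1..<2 * d]"
proof -
  interpret boxed_partition "2 * d" "2 * d" "2 * d" p by unfold_locales (rule assms)
  define D :: "point set" where "D = {(x, y). y \<le> x \<and> 2 * x \<le> y \<and> - 2 * int d \<le> y}"
  have D: "(x, y) \<in> D \<longleftrightarrow> y \<le> x \<and> 2 * x \<le> y \<and> - 2 * int d \<le> y" for x y
    by (simp add: D_def)
  have hex: "hexagon (2 * d) (2 * d) (2 * d) \<inter> sector (pi / 6) = D"
    by (auto simp: hexagon_iff sector_30 D)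
  have sub: "P \<in> hexagon (2 * d) (2 * d) (2 * d)" if "P \<in> D" for P using that hex by blast
  interpret stepped_web "surface p" D H by (rule stepped_web_surface) (use hex in blast)
  have zigzag: "surface p (x - 1, 2 * x - 1) = surface p (x, 2 * x) + 1"
    "surface p (x - 1, 2 * x - 1) = surface p (x - 1, 2 * x - 2)" if "- int d < x" "x \<le> 0" for x
  proof -
    have "surface p (x, 2 * x - 1) = surface p (x - 1, 2 * x - 1) - 1"
      using assms(3)[of "1 - x"] that by (simp add: algebra_simps)
    moreover have "surface p (x, 2 * x) = surface p (x, 2 * x - 1) \<or> surface p (x, 2 * x) = surface p (x, 2 * x - 1) - 1"
      using stepped_sides(2)[of x "2 * x - 1"] by simp
    moreover have "surface p (x - 1, 2 * x - 1) = surface p (x, 2 * x) \<or> surface p (x - 1, 2 * x - 1) = surface p (x, 2 * x) + 1"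
      using stepped_sides(1)[of x "2 * x"] by simp
    moreover have "surface p (x - 1, 2 * x - 2) = surface p (x, 2 * x - 1) \<or> surface p (x - 1, 2 * x - 2) = surface p (x, 2 * x - 1) + 1"
      using stepped_sides(1)[of x "2 * x - 1"] by simp
    moreover have "surface p (x - 1, 2 * x - 1) = surface p (x - 1, 2 * x - 2) \<or> surface p (x - 1, 2 * x - 1) = surface p (x - 1, 2 * x - 2) - 1"
      using stepped_sides(2)[of "x - 1" "2 * x - 2"] by simp
    ultimately show "surface p (x - 1, 2 * x - 1) = surface p (x, 2 * x) + 1"
      "surface p (x - 1, 2 * x - 1) = surface p (x - 1, 2 * x - 2)"
      by linarith+
  qed
  have zig: "((x, 2 * x), E3) \<notin> H" if "(x, 2 * x) \<in> D" "(x - 1, 2 * x - 1) \<in> D" for x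
    using hourglass_sides(1)[OF that] zigzag(1)[of x] that by (auto simp: D)
  interpret cut_web "surface p" D H "int (2 * d)" "int (2 * d) + int (2 * d) + int (2 * d)" False
  proof (rule cut_web_surface)
    show "D \<subseteq> hexagon (2 * d) (2 * d) (2 * d)" using hex by blast
  next
    fix x y u assume "corners (black_of ((x, y), u)) \<subseteq> D" "\<not> corners (white_of ((x, y), u)) \<subseteq> D"
    then show "u = E3 \<and> ((x, y), u) \<notin> H \<or> u = E1 \<and> False \<and> y = 0 \<and> 0 \<le> x"
      using zig[of x] by (cases u) (auto simp: D)
  qed (auto simp: D)
  have W: "restrict_web (pp_web (2 * d) (2 * d) (2 * d) p) (sector (pi / 6)) = W" by (rule restrict_web_eq[OF hex])
  have F0: "Around (proj 0 0 (2 * d)) = F0" unfolding F0_def by (simp add: proj_def)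
  have vertical: "block ((t, t), E3) = (if ((t, t), E3) \<in> H then [Plain 3, Plain 4] else [Plain 4])"
    if "- int (2 * d) < t" "t \<le> -1" for t
    using that assms(2) by (intro block_vertical) (auto simp: D)
  have "map block (NE_side d (2 * d)) = replicate (length (NE_side d (2 * d))) [Plain 1]"
    by (rule map_eq_replicate) (auto simp: NE_side_def proj_def D intro!: block_NE[unfolded One_nat_def, simplified])
  moreover have zigzag_E2: "block ((- int i, - 2 * int i), E2) = [Plain 2]" if i: "1 \<le> i" "i \<le> d" for i
  proof -
    let ?R = "\<lambda>i Q. snd Q \<le> - 2 * int i \<and> coord (surface p) E2 Q \<le> coord (surface p) E2 (- int i, - 2 * int i) \<and>
      surface p (- int i, - 2 * int i) \<le> surface p Q"
    have "linked (?R (d - m)) (- int (d - m), - 2 * int (d - m)) (- int (2 * d), - int (2 * d))" if "m < d" for m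
      using that
    proof (induction m)
      case 0
      have inD: "(- int d, - 2 * int d) \<in> D" by (simp add: D)
      have "linked (?R d) (- int d, - 2 * int d) (- int (2 * d), - 2 * int d)"
      proof (rule walk_E1)
        fix t assume "- int (2 * d) \<le> t" "t \<le> - int d"
        then have "(t, - 2 * int d) \<in> D" by (simp add: D)
        then show "?R d (t, - 2 * int d)" using NE_values[of t] NE_values[of "- int d"] inD by simp
      qed (auto simp: D is_edge_def)
      then show ?case by simp
    next
      case (Suc m)
      define j where "j = d - Suc m"
      have j: "1 \<le> j" "d - m = j + 1" "j < d" using Suc.prems by (auto simp: j_def)
      let ?P = "(- int j, - 2 * int j)" and ?M = "(- int j - 1, - 2 * int j - 1)" and ?P' = "(- int j - 1, - 2 * int j - 2)"
      have K: "surface p ?M = surface p ?P + 1" "surface p ?M = surface p ?P'"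
        using zigzag[of "- int j"] j by simp_all
      have "is_edge (?P, E3)" "is_edge (?P', E2)" using j by (auto simp: D is_edge_def)
      moreover have "?P + vec E3 = ?M" "?P' + vec E2 = ?M" by simp_all
      ultimately have adj: "adjacent ?P ?M" "adjacent ?M ?P'"
        using adjacent_edge[of ?P E3] adjacent_edge[of ?P' E2] adjacent_sym[of ?M ?P] by (simp_all only: simp_thms)
      have "linked (?R j) ?P ?M" by (rule linked_adjacent) (use K adj in auto)
      moreover have "linked (?R j) ?M ?P'" by (rule linked_adjacent) (use K adj in auto)
      moreover have succ: "- int (j + 1) = - int j - 1" "- 2 * int (j + 1) = - 2 * int j - 2" by simp_all
      have "m < d" using Suc.prems by simp
      from Suc.IH[OF this] have "linked (\<lambda>Q. snd Q \<le> - 2 * int j - 2 \<and>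
          coord (surface p) E2 Q \<le> coord (surface p) E2 ?P' \<and> surface p ?P' \<le> surface p Q)
        ?P' (- int (2 * d), - int (2 * d))"
        unfolding j(2) succ .
      then have "linked (?R j) ?P' (- int (2 * d), - int (2 * d))"
        by (rule linked_mono) (use K in auto)
      ultimately show ?case
        unfolding j_def[symmetric] using linked_trans by blast
    qed
    from this[of "d - i"] have walk: "linked (?R i) (- int i, - 2 * int i) (- int (2 * d), - int (2 * d))"
      using i by simp
    have "((- int i, - 2 * int i), E2) \<notin> H"
      using hourglass_sides(2)[of "- int i" "- 2 * int i"] zigzag(2)[of "1 - int i"] i
      by (simp add: D algebra_simps)
    then show ?thesis
      using block_E2[OF _ _ _ walk] i by (auto simp: D)
  qed
  moreover have zigzag_E3: "block ((1 - int i, 2 - 2 * int i), E3) = [Bar 4]" if "2 \<le> i" "i \<le> d" for i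
    using that by (intro block_E3_black) (auto simp: D)
  have "map block (butlast (concat (map (\<lambda>i. [(proj i 0 (2 * i), E2), (proj (i - 1) 0 (2 * (i - 1)), E3)])
        (rev [1..<d + 1])))) = map (\<lambda>n. if even n then [Plain 2] else [Bar 4]) [0..<2 * d - 1]"
  proof -
    have d: "1 \<le> d" using assms(2) by simp
    have "map block (concat (map (\<lambda>i. [(proj i 0 (2 * i), E2), (proj (i - 1) 0 (2 * (i - 1)), E3)]) (rev [2..<d + 1])))
      = concat (map (\<lambda>i. [[Plain 2], [Bar 4]]) (rev [2..<d + 1]))"
      unfolding map_concat map_map
      by (intro arg_cong[of _ _ concat] map_cong[OF refl])
        (use zigzag_E2 zigzag_E3 in \<open>auto simp: proj_def of_nat_diff algebra_simps\<close>)
    also have "\<dots> = concat (replicate (d - 1) [[Plain 2], [Bar 4]])"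
    proof -
      have "length (rev [2..<d + 1]) = d - 1" unfolding length_rev length_upt by simp
      then show ?thesis by (simp only: map_replicate_const)
    qed
    finally have rest: "map block (concat (map (\<lambda>i. [(proj i 0 (2 * i), E2), (proj (i - 1) 0 (2 * (i - 1)), E3)]) (rev [2..<d + 1])))
      = concat (replicate (d - 1) [[Plain 2], [Bar 4]])" .
    have last: "block (proj 1 0 (2 * 1), E2) = [Plain 2]"
      using zigzag_E2[of 1] d by (simp add: proj_def)
    have len: "2 * (d - 1) + 1 = 2 * d - 1" using d by simp
    show ?thesis
      unfolding butlast_zigzag[OF d] map_append list.map rest last concat_replicate_alternating len ..
  qed
  moreover have "map block (map (\<lambda>k. (proj 0 0 k, E3)) [1..<2 * d]) =
    map (\<lambda>k. if (proj 0 0 k, E3) \<in> H then [Plain 3, Plain 4] else [Plain 4]) [1..<2 * d]"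
    unfolding map_map by (rule map_cong[OF refl]) (use vertical in \<open>auto simp: proj_def\<close>)
  ultimately show ?thesis
    unfolding TSSCPP_word_def W F0 boundary_word_block map_append
    by (simp add: NE_side_def)
qed

section \<open>Diagonals of symmetric plane partitions\<close>

lemma initial_segment:
  fixes S :: "nat set"
  assumes "finite S" "0 \<notin> S" "\<And>i j. j \<in> S \<Longrightarrow> 1 \<le> i \<Longrightarrow> i \<le> j \<Longrightarrow> i \<in> S"
  shows "S = {1..card S}"
proof (cases "S = {}")
  case False
  have "S = {1..Max S}"
  proof
    show "S \<subseteq> {1..Max S}" using assms(1,2) by (auto simp: Suc_le_eq intro: gr0I)
    show "{1..Max S} \<subseteq> S" using assms(3)[of "Max S"] Max_in[OF assms(1) False] by auto
  qed
  moreover from this have "card S = Max S" by (metis card_atLeastAtMost diff_Suc_1 Suc_eq_plus1)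
  ultimately show ?thesis by simp
qed simp

context boxed_partition
begin

lemma in_p_iff_height: "(i, j, k) \<in> p \<longleftrightarrow> 1 \<le> k \<and> k \<le> height p i j"
proof -
  have "{k. (i, j, k) \<in> p} = {1..card {k. (i, j, k) \<in> p}}"
  proof (rule initial_segment)
    show "finite {k. (i, j, k) \<in> p}" by (rule finite_subset[of _ "{1..c}"]) (use in_p_bounds in auto)
    show "0 \<notin> {k. (i, j, k) \<in> p}" using in_p_bounds by force
    show "i' \<in> {k. (i, j, k) \<in> p}" if "j' \<in> {k. (i, j, k) \<in> p}" "1 \<le> i'" "i' \<le> j'" for i' j'
      using that in_p_bounds[of i j j'] by (auto intro: in_p_mono)
  qed
  then show ?thesis unfolding height_def by (metis (mono_tags) atLeastAtMost_iff mem_Collect_eq)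
qed

lemma height_le: "height p i j \<le> c"
  using in_p_iff_height[of i j "height p i j"] in_p_bounds[of i j "height p i j"]
  by (cases "height p i j = 0") auto

lemma height_antimono:
  assumes "1 \<le> i" "i \<le> i'" "1 \<le> j" "j \<le> j'"
  shows "height p i' j' \<le> height p i j"
proof (cases "height p i' j' = 0")
  case False
  then have "(i', j', height p i' j') \<in> p" by (simp add: in_p_iff_height)
  then have "(i, j, height p i' j') \<in> p" by (rule in_p_mono) (use assms False in auto)
  then show ?thesis by (simp add: in_p_iff_height)
qed simp

end

lemma boxed: "plane_partition a b c p \<Longrightarrow> boxed_partition a b c p"
  by unfold_locales

lemma SPP_iff: "p \<in> SPP a c \<longleftrightarrow> plane_partition a a c p \<and> (\<forall>i j k. (i, j, k) \<in> p \<longrightarrow> (j, i, k) \<in> p)"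
proof (cases "plane_partition a a c p")
  case True
  then interpret boxed_partition a a c p by (rule boxed)
  have "(\<forall>i\<in>{1..a}. \<forall>j\<in>{1..a}. height p i j = height p j i) \<longleftrightarrow> (\<forall>i j k. (i, j, k) \<in> p \<longrightarrow> (j, i, k) \<in> p)"
  proof
    assume *: "\<forall>i\<in>{1..a}. \<forall>j\<in>{1..a}. height p i j = height p j i"
    show "\<forall>i j k. (i, j, k) \<in> p \<longrightarrow> (j, i, k) \<in> p"
      using in_p_bounds * by (metis in_p_iff_height)
  next
    assume *: "\<forall>i j k. (i, j, k) \<in> p \<longrightarrow> (j, i, k) \<in> p"
    then have "{k. (i, j, k) \<in> p} = {k. (j, i, k) \<in> p}" for i j by blast
    then show "\<forall>i\<in>{1..a}. \<forall>j\<in>{1..a}. height p i j = height p j i" by (simp add: height_def)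
  qed
  then show ?thesis using True by (simp add: SPP_def)
qed (simp add: SPP_def)

text \<open>The number of \<open>m\<close> with \<open>j \<le> p\<^sub>i\<^sub>m\<close> counts the cubes \<open>(i, m, j)\<close>, and \<open>p\<^sub>j\<^sub>i\<close> counts the cubes \<open>(j, i, m)\<close>. Both sets of \<open>m\<close> are initial
  segments, so equality of the numbers means equality of the sets.\<close>

lemma CSPP_iff: "p \<in> CSPP a \<longleftrightarrow> plane_partition a a a p \<and> (\<forall>i j k. (i, j, k) \<in> p \<longrightarrow> (j, k, i) \<in> p)"
proof (cases "plane_partition a a a p")
  case True
  then interpret boxed_partition a a a p by (rule boxed)
  have conj: "conjugate a (\<lambda>n. height p i n) j = card {m. (i, m, j) \<in> p}" if "1 \<le> j" for i j
  proof -
    have "{m \<in> {1..a}. j \<le> height p i m} = {m. (i, m, j) \<in> p}"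
      using that in_p_bounds in_p_iff_height by blast
    then show ?thesis by (simp add: conjugate_def)
  qed
  have seg: "{m. (i, m, j) \<in> p} = {1..card {m. (i, m, j) \<in> p}}" for i j
  proof (rule initial_segment)
    show "finite {m. (i, m, j) \<in> p}" by (rule finite_subset[of _ "{1..a}"]) (use in_p_bounds in auto)
    show "0 \<notin> {m. (i, m, j) \<in> p}" using in_p_bounds by force
    show "i' \<in> {m. (i, m, j) \<in> p}" if "j' \<in> {m. (i, m, j) \<in> p}" "1 \<le> i'" "i' \<le> j'" for i' j'
      using that in_p_bounds[of i j' j] by (auto intro: in_p_mono)
  qed
  have "(\<forall>i\<in>{1..a}. \<forall>j\<in>{1..a}. conjugate a (\<lambda>n. height p i n) j = height p j i) \<longleftrightarrow>
    (\<forall>i j k. (i, j, k) \<in> p \<longrightarrow> (j, k, i) \<in> p)"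
  proof
    assume *: "\<forall>i\<in>{1..a}. \<forall>j\<in>{1..a}. conjugate a (\<lambda>n. height p i n) j = height p j i"
    have "(k, i, j) \<in> p" if ijk: "(i, j, k) \<in> p" for i j k
    proof -
      have b: "i \<in> {1..a}" "k \<in> {1..a}" using in_p_bounds[OF ijk] by auto
      have "j \<in> {1..card {m. (i, m, k) \<in> p}}" using ijk seg[of i k] by blast
      also have "card {m. (i, m, k) \<in> p} = height p k i" using * b conj by simp
      finally show ?thesis by (simp add: in_p_iff_height)
    qed
    then show "\<forall>i j k. (i, j, k) \<in> p \<longrightarrow> (j, k, i) \<in> p" by blast
  next
    assume *: "\<forall>i j k. (i, j, k) \<in> p \<longrightarrow> (j, k, i) \<in> p"
    then have eq: "{m. (i, m, j) \<in> p} = {m. (j, i, m) \<in> p}" for i j by blast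
    show "\<forall>i\<in>{1..a}. \<forall>j\<in>{1..a}. conjugate a (\<lambda>n. height p i n) j = height p j i"
    proof (intro ballI)
      fix i j assume "i \<in> {1..a}" "j \<in> {1..a}"
      then have "conjugate a (\<lambda>n. height p i n) j = card {m. (i, m, j) \<in> p}" by (intro conj) simp
      also have "\<dots> = height p j i" by (simp only: eq height_def)
      finally show "conjugate a (\<lambda>n. height p i n) j = height p j i" .
    qed
  qed
  then show ?thesis using True by (simp add: CSPP_def)
qed (simp add: CSPP_def)

text \<open>The numbers \<open>p\<^sub>i\<^sub>i - i\<close> decrease strictly, so their set determines the diagonal. They are the positions of the
  diagonal lozenges on the vertical axis, measured from the projection of the origin.\<close>

definition beta :: "nat \<Rightarrow> (nat \<times> nat \<times> nat) set \<Rightarrow> nat \<Rightarrow> int" where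
  "beta a p i = int (height p i i) - int i"

definition beta_set :: "nat \<Rightarrow> (nat \<times> nat \<times> nat) set \<Rightarrow> int set" where
  "beta_set a p = beta a p ` {1..a}"

lemma vertical_hourglass_iff:
  assumes "plane_partition a a c p"
  shows "((- q, - q), E3) \<in> hourglasses (pp_web a a c p) \<longleftrightarrow> q \<in> beta_set a p"
proof -
  interpret boxed_partition a a c p using assms by (rule boxed)
  show ?thesis
  proof
    assume "((- q, - q), E3) \<in> H"
    then obtain i j k where *: "(- q, - q) = proj i j k" "i \<in> {1..a}" "solid p i j k" "\<not> solid p i j (k + 1)"
      by (auto simp: pp_web_def)
    then have "j = i" "q = int k - int i" by (auto simp: proj_def)
    moreover have "height p i i = k"
      using * \<open>j = i\<close> in_p_iff_height[of i i k] in_p_iff_height[of i i "k + 1"] by (auto simp: solid_def)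
    ultimately show "q \<in> beta_set a p" using *(2) by (auto simp: beta_set_def beta_def)
  next
    assume "q \<in> beta_set a p"
    then obtain i where i: "i \<in> {1..a}" "q = int (height p i i) - int i" by (auto simp: beta_set_def beta_def)
    have "(- q, - q) = proj i i (height p i i)" using i by (simp add: proj_def)
    moreover have "solid p i i (height p i i)" "\<not> solid p i i (height p i i + 1)" "height p i i \<le> c"
      using i in_p_iff_height[of i i] height_le by (auto simp: solid_def)
    ultimately show "((- q, - q), E3) \<in> H" using i(1) unfolding pp_web_def by simp blast
  qed
qed

lemma CSPP_hourglass_iff:
  assumes "p \<in> CSPP a" "0 \<le> q"
  shows "((q, 0), E1) \<in> hourglasses (pp_web a a a p) \<longleftrightarrow> q \<in> beta_set a p"
proof -
  have pp: "plane_partition a a a p" and cyc: "(i, j, k) \<in> p \<longleftrightarrow> (j, k, i) \<in> p" for i j k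
    using assms(1) unfolding CSPP_iff by blast+
  interpret boxed_partition a a a p using pp by (rule boxed)
  show ?thesis
  proof
    assume "((q, 0), E1) \<in> H"
    then obtain i j k where *: "(q, 0) = proj i j k" "j \<in> {1..a}" "solid p i j k" "\<not> solid p (i + 1) j k"
      by (auto simp: pp_web_def)
    then have "k = j" "q = int i - int j" by (auto simp: proj_def)
    moreover have "height p j j = i"
      using * \<open>k = j\<close> in_p_iff_height[of j j i] in_p_iff_height[of j j "i + 1"] assms(2) \<open>q = _\<close>
        cyc[of i j j] cyc[of "i + 1" j j] by (auto simp: solid_def)
    ultimately show "q \<in> beta_set a p" using *(2) by (auto simp: beta_set_def beta_def)
  next
    assume "q \<in> beta_set a p"
    then obtain j where j: "j \<in> {1..a}" "q = int (height p j j) - int j" by (auto simp: beta_set_def beta_def)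
    let ?i = "height p j j"
    have "(q, 0) = proj ?i j j" using j by (simp add: proj_def)
    moreover have "solid p ?i j j" "\<not> solid p (?i + 1) j j" "?i \<le> a"
      using j in_p_iff_height[of j j] height_le cyc[of _ j j] by (auto simp: solid_def)
    ultimately show "((q, 0), E1) \<in> H" using j(1) unfolding pp_web_def by simp blast
  qed
qed

lemma TSPP_iff:
  "p \<in> TSPP a \<longleftrightarrow> plane_partition a a a p \<and> (\<forall>i j k. (i, j, k) \<in> p \<longrightarrow> (j, i, k) \<in> p \<and> (j, k, i) \<in> p)"
  unfolding TSPP_def Int_iff SPP_iff CSPP_iff by blast

lemma TSPP_hourglass_iff:
  assumes "p \<in> TSPP a"
  shows "((0, - q), E2) \<in> hourglasses (pp_web a a a p) \<longleftrightarrow> - q \<in> beta_set a p"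
proof -
  have pp: "plane_partition a a a p" and swap: "(i, j, i) \<in> p \<longleftrightarrow> (i, i, j) \<in> p" for i j
    using assms(1) unfolding TSPP_iff by blast+
  interpret boxed_partition a a a p using pp by (rule boxed)
  show ?thesis
  proof
    assume "((0, - q), E2) \<in> H"
    then obtain i j k where *: "(0, - q) = proj i j k" "i \<in> {1..a}" "solid p i j k" "\<not> solid p i (j + 1) k"
      by (auto simp: pp_web_def)
    then have "k = i" "- q = int j - int i" by (auto simp: proj_def)
    moreover have "height p i i = j"
      using * \<open>k = i\<close> in_p_iff_height[of i i j] in_p_iff_height[of i i "j + 1"] swap[of i j] swap[of i "j + 1"]
      by (auto simp: solid_def)
    ultimately show "- q \<in> beta_set a p" using *(2) by (auto simp: beta_set_def beta_def)
  next
    assume "- q \<in> beta_set a p"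
    then obtain i where i: "i \<in> {1..a}" "- q = int (height p i i) - int i" by (auto simp: beta_set_def beta_def)
    let ?j = "height p i i"
    have "(0, - q) = proj i ?j i" using i by (simp add: proj_def)
    moreover have "solid p i ?j i" "\<not> solid p i (?j + 1) i" "?j \<le> a"
      using i in_p_iff_height[of i i] height_le swap[of i] by (auto simp: solid_def)
    ultimately show "((0, - q), E2) \<in> H" using i(1) unfolding pp_web_def by simp blast
  qed
qed

text \<open>On the antidiagonal \<open>j + j' = 2d + 1\<close>, symmetry and self-complementarity give \<open>2 p\<^sub>j\<^sub>j\<^sub>' = 2d\<close>. So all these heights
  are \<open>d\<close>, and by total symmetry there are faces orthogonal to the first axis at \<open>i = d\<close> above the slanted cut.\<close>

lemma TSSCPP_zigzag:
  assumes "p \<in> TSSCPP (2 * d)" "1 \<le> i" "i \<le> int d"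
  shows "surface p (1 - i, 1 - 2 * i) = surface p (- i, 1 - 2 * i) - 1"
proof -
  have "p \<in> TSPP (2 * d)" and sc: "\<And>i j. i \<in> {1..2 * d} \<Longrightarrow> j \<in> {1..2 * d} \<Longrightarrow>
      height p i j + height p (2 * d + 1 - i) (2 * d + 1 - j) = 2 * d"
    using assms(1) by (auto simp: TSSCPP_def)
  then have pp: "plane_partition (2 * d) (2 * d) (2 * d) p" and swap: "(i, j, k) \<in> p \<longleftrightarrow> (j, i, k) \<in> p"
    and rot: "(i, j, k) \<in> p \<longleftrightarrow> (j, k, i) \<in> p" for i j k
    unfolding TSPP_iff by blast+
  interpret boxed_partition "2 * d" "2 * d" "2 * d" p using pp by (rule boxed)
  define n where "n = nat i"
  have n: "i = int n" "1 \<le> n" "n \<le> d" using assms by (auto simp: n_def)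
  define J where "J = d + 1 - n"
  define M where "M = d + n"
  have JM: "J \<in> {1..2 * d}" "M \<in> {1..2 * d}" "2 * d + 1 - J = M" "2 * d + 1 - M = J"
    using n by (auto simp: J_def M_def)
  have "{k. (J, M, k) \<in> p} = {k. (M, J, k) \<in> p}" using swap by blast
  then have "height p J M = height p M J" by (simp add: height_def)
  then have h: "height p J M = d" using sc[OF JM(1,2)] JM by simp
  have "(d, J, M) \<in> p" "(d + 1, J, M) \<notin> p"
    using rot[of d J M] rot[of "d + 1" J M] in_p_iff_height[of J M] h n by auto
  then have f: "filled p (int d) (int J) (int M)" "\<not> filled p (int d + 1) (int J) (int M)"
    using JM n by (auto simp: filled_def nat_add_distrib)
  have J: "int J = int d + 1 - int n" "int M = int d + int n" using n by (auto simp: J_def M_def)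
  have "surface p (- i, 1 - 2 * i) = int M"
  proof (rule surface_eqI)
    show "filled p (- i + int M) (1 - 2 * i + int M) (int M)"
      using f(1) J by (simp add: n algebra_simps)
    show "\<not> filled p (- i + int M + 1) (1 - 2 * i + int M + 1) (int M + 1)"
      using f(2) filled_mono[of "- i + int M + 1" "1 - 2 * i + int M + 1" "int M + 1" "int d + 1" "int J" "int M"] J n
      by auto
  qed
  moreover have "surface p (1 - i, 1 - 2 * i) = int M - 1"
  proof (rule surface_eqI)
    show "filled p (1 - i + (int M - 1)) (1 - 2 * i + (int M - 1)) (int M - 1)"
      by (rule filled_mono[OF f(1)]) (use J n in auto)
    show "\<not> filled p (1 - i + (int M - 1) + 1) (1 - 2 * i + (int M - 1) + 1) (int M - 1 + 1)"
      using f(2) J by (simp add: n algebra_simps)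
  qed
  ultimately show ?thesis by simp
qed

subsection \<open>Which diagonals occur\<close>

lemma beta_less:
  assumes "plane_partition a a c p" "1 \<le> i" "i < j"
  shows "beta a p j < beta a p i"
proof -
  interpret boxed_partition a a c p using assms(1) by (rule boxed)
  show ?thesis using height_antimono[of i j i j] assms by (simp add: beta_def)
qed

lemma inj_on_beta:
  assumes "plane_partition a a c p"
  shows "inj_on (beta a p) {1..a}"
proof (rule inj_onI)
  fix i j assume "i \<in> {1..a}" "j \<in> {1..a}" "beta a p i = beta a p j"
  then show "i = j" using beta_less[OF assms, of i j] beta_less[OF assms, of j i]
    by (cases i j rule: linorder_cases) auto
qed

lemma beta_set_bounds:
  assumes "plane_partition a a c p"
  shows "beta_set a p \<subseteq> {- int a..<int c}" "card (beta_set a p) = a" "finite (beta_set a p)"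
proof -
  interpret boxed_partition a a c p using assms by (rule boxed)
  show "beta_set a p \<subseteq> {- int a..<int c}"
  proof
    fix s assume "s \<in> beta_set a p"
    then obtain i where i: "1 \<le> i" "i \<le> a" "s = int (height p i i) - int i" by (auto simp: beta_set_def beta_def)
    have "int (height p i i) \<le> int c" using height_le by simp
    then show "s \<in> {- int a..<int c}" using i by auto
  qed
  show "card (beta_set a p) = a" using card_image[OF inj_on_beta[OF assms]] by (simp add: beta_set_def)
  show "finite (beta_set a p)" by (simp add: beta_set_def)
qed

text \<open>If the window contained the numbers for all \<open>i\<close> from \<open>s\<close> to \<open>t \<ge> s + n + 1\<close>, then \<open>p\<^sub>t\<^sub>t \<ge> t - n - 1 \<ge> s\<close>. Hence \<open>(t, t, s)\<close>, by
  symmetry \<open>(s, t, t)\<close>, and therefore \<open>(s, s, t)\<close> would belong to \<open>p\<close>, contrary to \<open>p\<^sub>s\<^sub>s \<le> s + n < t\<close>.\<close>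

lemma TSPP_window:
  assumes "p \<in> TSPP a"
  shows "card (beta_set a p \<inter> {- int n - 1..int n}) \<le> n + 1"
proof (rule ccontr)
  assume "\<not> card (beta_set a p \<inter> {- int n - 1..int n}) \<le> n + 1"
  have pp: "plane_partition a a a p" and rot: "(i, i, j) \<in> p \<longleftrightarrow> (j, i, i) \<in> p" for i j
    using assms unfolding TSPP_iff by blast+
  interpret boxed_partition a a a p using pp by (rule boxed)
  define I where "I = {i \<in> {1..a}. beta a p i \<in> {- int n - 1..int n}}"
  have "beta_set a p \<inter> {- int n - 1..int n} = beta a p ` I" by (auto simp: beta_set_def I_def)
  moreover have "inj_on (beta a p) I" using inj_on_beta[OF pp] by (rule inj_on_subset) (auto simp: I_def)
  ultimately have card: "n + 2 \<le> card I" using \<open>\<not> _\<close> by (simp add: card_image)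
  have fin: "finite I" by (simp add: I_def)
  have "I \<noteq> {}" using card by auto
  note fin = fin this
  define s t where "s = Min I" and "t = Max I"
  have st: "s \<in> I" "t \<in> I" using fin by (simp_all add: s_def t_def)
  have "I \<subseteq> {s..t}" using fin by (auto simp: s_def t_def)
  then have "card I \<le> card {s..t}" by (intro card_mono) auto
  then have len: "s + n + 1 \<le> t" using card by simp
  have "s \<le> height p t t" "height p s s \<le> s + n" "1 \<le> s"
    using st len by (auto simp: I_def beta_def)
  then have "(t, t, s) \<in> p" by (simp add: in_p_iff_height)
  then have "(s, t, t) \<in> p" by (simp add: rot)
  then have "(s, s, t) \<in> p" by (rule in_p_mono) (use len \<open>1 \<le> s\<close> in auto)
  then have "t \<le> height p s s" by (simp add: in_p_iff_height)
  then show False using len \<open>height p s s \<le> s + n\<close> by simp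
qed

lemma decreasing_enumeration:
  fixes B :: "int set"
  assumes "finite B" "card B = a"
  obtains d where "\<And>i j. 1 \<le> i \<Longrightarrow> i < j \<Longrightarrow> j \<le> a \<Longrightarrow> d j < d i" "d ` {1..a} = B"
proof -
  define l where "l = rev (sorted_list_of_set B)"
  have len: "length l = a" using assms by (simp add: l_def)
  have "sorted_wrt (>) l" by (simp add: l_def sorted_wrt_rev)
  then have dec: "l ! n < l ! m" if "m < n" "n < a" for m n
    using that len by (simp add: sorted_wrt_iff_nth_less)
  have "(\<lambda>i. l ! (i - 1)) ` {1..a} = (!) l ` {..<a}"
    by (force simp: image_iff Bex_def intro: exI[of _ "Suc _"])
  also have "\<dots> = set l" using len by (auto simp: set_conv_nth)
  also have "\<dots> = B" using assms by (simp add: l_def)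
  finally show thesis using dec by (intro that[of "\<lambda>i. l ! (i - 1)"]) auto
qed

text \<open>A candidate for the sequence \<open>p\<^sub>i\<^sub>i - i\<close>, with the diagonal \<open>lam\<close> that it prescribes.\<close>

locale diagonal =
  fixes a c :: nat and d :: "nat \<Rightarrow> int"
  assumes dec: "1 \<le> i \<Longrightarrow> i < j \<Longrightarrow> j \<le> a \<Longrightarrow> d j < d i"
    and range: "i \<in> {1..a} \<Longrightarrow> - int a \<le> d i \<and> d i < int c"
begin

lemma gap:
  assumes "1 \<le> i" "i \<le> j" "j \<le> a"
  shows "d j + int j \<le> d i + int i"
  using assms(2,3)
proof (induction j rule: dec_induct)
  case (step n)
  then show ?case using dec[of n "Suc n"] assms(1) by simp
qed simp

definition lam :: "nat \<Rightarrow> nat" where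
  "lam i = nat (d i + int i)"

lemma lam: "i \<in> {1..a} \<Longrightarrow> int (lam i) = d i + int i"
  using gap[of i a] range[of a] by (auto simp: lam_def)

lemma lam_antimono: "1 \<le> i \<Longrightarrow> i \<le> j \<Longrightarrow> j \<le> a \<Longrightarrow> lam j \<le> lam i"
  using gap[of i j] by (simp add: lam_def nat_mono)

lemma lam_le: "i \<in> {1..a} \<Longrightarrow> lam i \<le> c"
  using gap[of 1 i] range[of 1] lam[of i] by auto

lemma beta_set_eqI:
  assumes "\<And>i. i \<in> {1..a} \<Longrightarrow> height p i i = lam i"
  shows "beta_set a p = d ` {1..a}"
proof -
  have "beta a p i = d i" if "i \<in> {1..a}" for i
    using assms[OF that] lam[OF that] by (simp add: beta_def)
  then show ?thesis unfolding beta_set_def by (rule image_cong[OF refl])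
qed

lemma SPP_realised: "\<exists>p\<in>SPP a c. beta_set a p = d ` {1..a}"
proof -
  define p where "p = {(i, j, k). i \<in> {1..a} \<and> j \<in> {1..a} \<and> 1 \<le> k \<and> k \<le> lam (max i j)}"
  have "k \<le> c" if "(i, j, k) \<in> p" for i j k
    using that lam_le[of "max i j"] by (auto simp: p_def max_def split: if_splits)
  then have sub: "p \<subseteq> {1..a} \<times> {1..a} \<times> {1..c}" by (auto simp: p_def)
  have "(i, j, k) \<in> p" if "(n, m, l) \<in> p" "i \<in> {1..n}" "j \<in> {1..m}" "k \<in> {1..l}" for n m l i j k
  proof -
    have "lam (max n m) \<le> lam (max i j)" using that by (intro lam_antimono) (auto simp: p_def)
    then show ?thesis using that by (auto simp: p_def)
  qed
  then have pp: "plane_partition a a c p" using sub unfolding plane_partition_def by blast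
  then have "p \<in> SPP a c" by (auto simp: SPP_iff p_def max.commute)
  moreover have "height p i i = lam i" if "i \<in> {1..a}" for i
  proof -
    have "{k. (i, i, k) \<in> p} = {1..lam i}" using that by (auto simp: p_def)
    then show ?thesis by (simp add: height_def)
  qed
  ultimately show ?thesis using beta_set_eqI by blast
qed

end

locale windowed_diagonal = diagonal a a d for a d +
  assumes window: "n < a \<Longrightarrow> card (d ` {1..a} \<inter> {- int n - 1..int n}) \<le> n + 1"
begin

definition below :: "nat \<Rightarrow> nat \<Rightarrow> nat \<Rightarrow> bool" where
  "below x y z \<longleftrightarrow> (\<exists>i\<in>{1..a}. x \<le> i \<and> y \<le> i \<and> z \<le> lam i)"

text \<open>The order ideal generated by all permutations of the points \<open>(i, i, lam i)\<close>.\<close>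

definition low :: "nat \<Rightarrow> nat \<Rightarrow> nat \<Rightarrow> bool" where
  "low x y z \<longleftrightarrow> below x y z \<or> below x z y \<or> below y z x"

lemma below_mono: "below x' y' z' \<Longrightarrow> x \<le> x' \<Longrightarrow> y \<le> y' \<Longrightarrow> z \<le> z' \<Longrightarrow> below x y z"
  unfolding below_def by (meson le_trans)

lemma low_mono: "low x' y' z' \<Longrightarrow> x \<le> x' \<Longrightarrow> y \<le> y' \<Longrightarrow> z \<le> z' \<Longrightarrow> low x y z"
  unfolding low_def by (meson below_mono)

lemma below_swap: "below x y z \<longleftrightarrow> below y x z"
  by (auto simp: below_def)

lemma low_swap: "low x y z \<longleftrightarrow> low y x z" and low_rotate: "low x y z \<longleftrightarrow> low y z x"
  unfolding low_def using below_swap by blast+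

lemma low_le: "low x y z \<Longrightarrow> x \<le> a \<and> y \<le> a \<and> z \<le> a"
proof -
  have "x \<le> a \<and> y \<le> a \<and> z \<le> a" if below: "below x y z" for x y z
  proof -
    obtain i where "i \<in> {1..a}" "x \<le> i" "y \<le> i" "z \<le> lam i" using below by (auto simp: below_def)
    then show ?thesis using lam_le[of i] by auto
  qed
  then show "low x y z \<Longrightarrow> x \<le> a \<and> y \<le> a \<and> z \<le> a" unfolding low_def by blast
qed

text \<open>The ideal does not overshoot the prescribed diagonal. Since \<open>lam\<close> is weakly decreasing, \<open>(i, i, lam i + 1)\<close> could only be below
  \<open>(j, lam j, j)\<close> for some \<open>j > i\<close> with \<open>lam i < j\<close> and \<open>i \<le> lam j\<close>. Then the window for \<open>n = j - i - 1\<close> would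
  contain the \<open>n + 2\<close> numbers \<open>d i, \<dots>, d j\<close>.\<close>

lemma not_low_above:
  assumes i: "i \<in> {1..a}"
  shows "\<not> low i i (lam i + 1)"
proof -
  have "\<not> below i i (lam i + 1)"
    using lam_antimono[of i] i by (fastforce simp: below_def)
  moreover have "\<not> below i (lam i + 1) i"
  proof
    assume "below i (lam i + 1) i"
    then obtain j where j: "j \<in> {1..a}" "i \<le> j" "lam i + 1 \<le> j" "i \<le> lam j"
      by (auto simp: below_def)
    have "i \<noteq> j" using j by auto
    then have ij: "i < j" using j by simp
    define n where "n = j - i - 1"
    have "d k \<in> {- int n - 1..int n}" if "k \<in> {i..j}" for k
    proof -
      have "d j \<le> d k" "d k \<le> d i"
        using that dec[of k j] dec[of i k] i j by (cases "k = j"; cases "k = i"; force)+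
      then show ?thesis using lam[OF i] lam[OF j(1)] j ij by (auto simp: n_def)
    qed
    then have "d ` {i..j} \<subseteq> d ` {1..a} \<inter> {- int n - 1..int n}" using i j by auto
    moreover have "card (d ` {i..j}) = n + 2"
    proof -
      have "inj_on d {i..j}"
      proof (rule inj_onI)
        fix k l assume "k \<in> {i..j}" "l \<in> {i..j}" "d k = d l"
        then show "k = l" using dec[of k l] dec[of l k] i j by (cases k l rule: linorder_cases) auto
      qed
      then show ?thesis using ij by (simp add: card_image n_def)
    qed
    ultimately have "n + 2 \<le> card (d ` {1..a} \<inter> {- int n - 1..int n})"
      by (metis card_mono finite_Int finite_atLeastAtMost_int)
    moreover have "n < a" using j ij by (simp add: n_def)
    ultimately show False using window[of n] by linarith
  qed
  ultimately show ?thesis by (simp add: low_def)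
qed

lemma low_diagonal:
  assumes "i \<in> {1..a}"
  shows "low i i k \<longleftrightarrow> k \<le> lam i"
proof
  assume "k \<le> lam i"
  then show "low i i k" using assms by (auto simp: low_def below_def)
next
  assume "low i i k"
  then show "k \<le> lam i"
    using not_low_above[OF assms] low_mono[of i i k i i "lam i + 1"] by force
qed

lemma TSPP_realised: "\<exists>p\<in>TSPP a. beta_set a p = d ` {1..a}"
proof -
  define p where "p = {(x, y, z). 1 \<le> x \<and> 1 \<le> y \<and> 1 \<le> z \<and> low x y z}"
  have "plane_partition a a a p"
    unfolding plane_partition_def using low_le low_mono by (fastforce simp: p_def)
  moreover have "(j, i, k) \<in> p \<and> (j, k, i) \<in> p" if "(i, j, k) \<in> p" for i j k
    using that low_swap[of i j k] low_rotate[of i j k] by (simp add: p_def)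
  ultimately have "p \<in> TSPP a" unfolding TSPP_iff by blast
  moreover have "height p i i = lam i" if "i \<in> {1..a}" for i
  proof -
    have "(i, i, k) \<in> p \<longleftrightarrow> k \<in> {1..lam i}" for k
      using that by (simp add: p_def low_diagonal[OF that])
    then have "{k. (i, i, k) \<in> p} = {1..lam i}" by blast
    then show ?thesis by (simp add: height_def)
  qed
  ultimately show ?thesis using beta_set_eqI by blast
qed

text \<open>By the symmetry of the diagonal and \<open>not_low_above\<close>, the ideal \<open>low\<close> is disjoint from its antipode. The points in neither
  of them are distributed by \<open>half\<close>, which contains one of each pair of antipodes.\<close>

lemma TSSCPP_realised:
  assumes a: "a = 2 * m" and sym: "\<And>i. i \<in> {1..a} \<Longrightarrow> d (a + 1 - i) = - 1 - d i"
  shows "\<exists>p\<in>TSSCPP a. beta_set a p = d ` {1..a}"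
proof -
  \<comment> \<open>at least two of the three coordinates are in the lower half\<close>
  define half where "half x y z \<longleftrightarrow> x \<le> m \<and> y \<le> m \<or> x \<le> m \<and> z \<le> m \<or> y \<le> m \<and> z \<le> m" for x y z :: nat
  define p where "p = {(x, y, z). x \<in> {1..a} \<and> y \<in> {1..a} \<and> z \<in> {1..a} \<and>
    (low x y z \<or> half x y z) \<and> \<not> low (a + 1 - x) (a + 1 - y) (a + 1 - z)}"
  have lam_sym: "lam (a + 1 - i) = a - lam i" if "i \<in> {1..a}" for i
  proof -
    have i': "a + 1 - i \<in> {1..a}" using that by auto
    have "int (lam (a + 1 - i)) = int a - int (lam i)"
      using lam[OF that] lam[OF i'] sym[OF that] that by auto
    then show ?thesis using lam_le[OF that] by linarith
  qed
  have below_disjoint: False if below: "below (a + 1 - x) (a + 1 - y) (a + 1 - z)" "low x y z"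
    "x \<in> {1..a}" "y \<in> {1..a}" "z \<in> {1..a}" for x y z
  proof -
    obtain i where i: "i \<in> {1..a}" "a + 1 - x \<le> i" "a + 1 - y \<le> i" "a + 1 - z \<le> lam i"
      using below by (auto simp: below_def)
    define i' where "i' = a + 1 - i"
    have i': "i' \<in> {1..a}" "i' \<le> x" "i' \<le> y" "lam i' + 1 \<le> z"
      using i lam_sym[OF i(1)] lam_le[OF i(1)] that by (auto simp: i'_def)
    then have "low i' i' (lam i' + 1)" using low_mono[OF that(2)] by blast
    then show False using not_low_above[OF i'(1)] by blast
  qed
  have disjoint: False if "low (a + 1 - x) (a + 1 - y) (a + 1 - z)" "low x y z"
    "x \<in> {1..a}" "y \<in> {1..a}" "z \<in> {1..a}" for x y z
  proof -
    have "low x z y" "low y z x" using that(2) low_swap low_rotate by blast+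
    then show False
      using that(1) below_disjoint[of x y z] below_disjoint[of x z y] below_disjoint[of y z x] that(2-)
      unfolding low_def[of "a + 1 - x"] by blast
  qed
  have compl: "(a + 1 - x, a + 1 - y, a + 1 - z) \<in> p \<longleftrightarrow> (x, y, z) \<notin> p"
    if xyz: "x \<in> {1..a}" "y \<in> {1..a}" "z \<in> {1..a}" for x y z
  proof -
    have "half (a + 1 - x) (a + 1 - y) (a + 1 - z) \<longleftrightarrow> \<not> half x y z"
      using xyz by (auto simp: half_def a)
    moreover have "a + 1 - (a + 1 - x) = x" "a + 1 - (a + 1 - y) = y" "a + 1 - (a + 1 - z) = z"
      using xyz by auto
    moreover have "a + 1 - x \<in> {1..a}" "a + 1 - y \<in> {1..a}" "a + 1 - z \<in> {1..a}" using xyz by auto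
    ultimately show ?thesis
      using xyz disjoint[OF _ _ xyz] unfolding p_def by simp blast
  qed
  have pp: "plane_partition a a a p"
    unfolding plane_partition_def
  proof (intro conjI allI impI)
    show "p \<subseteq> {1..a} \<times> {1..a} \<times> {1..a}" by (auto simp: p_def)
  next
    fix n k l x y z assume *: "(n, k, l) \<in> p \<and> x \<in> {1..n} \<and> y \<in> {1..k} \<and> z \<in> {1..l}"
    then have "low x y z \<or> half x y z"
      using low_mono[of n k l x y z] by (auto simp: p_def half_def)
    moreover have "\<not> low (a + 1 - x) (a + 1 - y) (a + 1 - z)"
    proof
      assume "low (a + 1 - x) (a + 1 - y) (a + 1 - z)"
      then have "low (a + 1 - n) (a + 1 - k) (a + 1 - l)"
        by (rule low_mono) (use * in \<open>auto intro: diff_le_mono2\<close>)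
      then show False using * by (simp add: p_def)
    qed
    ultimately show "(x, y, z) \<in> p" using * by (auto simp: p_def)
  qed
  then interpret boxed_partition a a a p by (rule boxed)
  have "(j, i, k) \<in> p \<and> (j, k, i) \<in> p" if "(i, j, k) \<in> p" for i j k
    using that low_swap[of i j k] low_rotate[of i j k] low_swap[of "a + 1 - i" "a + 1 - j" "a + 1 - k"]
      low_rotate[of "a + 1 - i" "a + 1 - j" "a + 1 - k"] by (auto simp: p_def half_def)
  then have "p \<in> TSPP a" using pp unfolding TSPP_iff by blast
  moreover have "height p i j + height p (a + 1 - i) (a + 1 - j) = a"
    if ij: "i \<in> {1..a}" "j \<in> {1..a}" for i j
  proof -
    have "{k. (a + 1 - i, a + 1 - j, k) \<in> p} = {1..a - height p i j}"
    proof (intro set_eqI iffI)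
      fix k assume "k \<in> {k. (a + 1 - i, a + 1 - j, k) \<in> p}"
      then have k: "(a + 1 - i, a + 1 - j, k) \<in> p" by simp
      then have "k \<in> {1..a}" using in_p_bounds by blast
      then have k': "a + 1 - k \<in> {1..a}" "a + 1 - (a + 1 - k) = k" by auto
      have "(i, j, a + 1 - k) \<notin> p" using compl[OF ij k'(1)] k unfolding k'(2) by blast
      then show "k \<in> {1..a - height p i j}" using \<open>k \<in> {1..a}\<close> by (auto simp: in_p_iff_height)
    next
      fix k assume k: "k \<in> {1..a - height p i j}"
      then have "a + 1 - k \<in> {1..a}" "a + 1 - (a + 1 - k) = k" by auto
      moreover have "(i, j, a + 1 - k) \<notin> p" using k by (auto simp: in_p_iff_height)
      ultimately show "k \<in> {k. (a + 1 - i, a + 1 - j, k) \<in> p}" using compl[OF ij, of "a + 1 - k"] by (metis mem_Collect_eq)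
    qed
    then have "height p (a + 1 - i) (a + 1 - j) = a - height p i j" by (simp add: height_def)
    then show ?thesis using height_le[of i j] by simp
  qed
  ultimately have "p \<in> TSSCPP a" by (simp add: TSSCPP_def)
  moreover have "height p i i = lam i" if i: "i \<in> {1..a}" for i
  proof -
    have mem: "(i, i, k) \<in> p \<longleftrightarrow> k \<le> lam i" if k: "k \<in> {1..a}" for k
    proof
      assume "k \<le> lam i"
      then have "low i i k" using low_diagonal[OF i] by simp
      then show "(i, i, k) \<in> p" using disjoint[OF _ _ i i k] i k by (auto simp: p_def)
    next
      assume "(i, i, k) \<in> p"
      show "k \<le> lam i"
      proof (rule ccontr)
        assume "\<not> k \<le> lam i"
        then have "a + 1 - k \<le> lam (a + 1 - i)" using lam_sym[OF i] k by auto
        moreover have "a + 1 - i \<in> {1..a}" using i by auto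
        ultimately have "low (a + 1 - i) (a + 1 - i) (a + 1 - k)"
          using low_diagonal by blast
        then show False using \<open>(i, i, k) \<in> p\<close> by (simp add: p_def)
      qed
    qed
    have "(i, i, k) \<in> p \<longleftrightarrow> k \<in> {1..lam i}" for k
    proof (cases "k \<in> {1..a}")
      case True
      then show ?thesis unfolding mem[OF True] by simp
    next
      case False
      then have "k \<notin> {1..lam i}" using lam_le[OF i] by auto
      then show ?thesis using in_p_bounds[of i i k] False by blast
    qed
    then have "{k. (i, i, k) \<in> p} = {1..lam i}" by blast
    then show ?thesis by (simp add: height_def)
  qed
  ultimately show ?thesis using beta_set_eqI by blast
qed

end

section \<open>Words in two letters\<close>

lemma length_filter_upt: "length (filter P [i..<j]) = card {k. i \<le> k \<and> k < j \<and> P k}"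
proof -
  have "length (filter P [i..<j]) = card (set (filter P [i..<j]))"
    by (rule distinct_card[symmetric]) simp
  also have "set (filter P [i..<j]) = {k. i \<le> k \<and> k < j \<and> P k}" by auto
  finally show ?thesis .
qed

lemma count_two_letters:
  assumes "x \<noteq> y"
  shows "count_list (map (\<lambda>k. if P k then x else y) xs) x = length (filter P xs)"
    and "count_list (map (\<lambda>k. if P k then x else y) xs) y = length xs - length (filter P xs)"
proof -
  show "count_list (map (\<lambda>k. if P k then x else y) xs) x = length (filter P xs)"
    using assms by (induction xs) auto
  have "count_list (map (\<lambda>k. if P k then x else y) xs) y + length (filter P xs) = length xs"
    using assms by (induction xs) auto
  then show "count_list (map (\<lambda>k. if P k then x else y) xs) y = length xs - length (filter P xs)" by simp
qed

lemma mset_two_letters: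
  assumes "x \<noteq> y"
  shows "mset v = replicate_mset n y + replicate_mset m x \<longleftrightarrow>
    (\<exists>X\<subseteq>{..<n + m}. card X = m \<and> v = map (\<lambda>k. if k \<in> X then x else y) [0..<n + m])"
proof
  assume v: "mset v = replicate_mset n y + replicate_mset m x"
  have len: "length v = n + m" using arg_cong[OF v, of size] by simp
  have "set v \<subseteq> {x, y}" using arg_cong[OF v, of set_mset] by (auto split: if_splits)
  then have xy: "v ! k = y" if "k < n + m" "v ! k \<noteq> x" for k
  proof -
    have "v ! k \<in> {x, y}" using that(1) len \<open>set v \<subseteq> {x, y}\<close> by (metis nth_mem subsetD)
    then show ?thesis using that(2) by simp
  qed
  define X where "X = {k. k < n + m \<and> v ! k = x}"
  have "count_list v x = m" using arg_cong[OF v, of "\<lambda>M. count M x"] assms by (simp add: count_mset)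
  then have "card X = m"
    unfolding X_def count_list_eq_length_filter length_filter_conv_card len by (simp add: eq_commute)
  moreover have "v = map (\<lambda>k. if k \<in> X then x else y) [0..<n + m]"
    by (rule nth_equalityI) (use len xy in \<open>auto simp: X_def\<close>)
  moreover have "X \<subseteq> {..<n + m}" by (auto simp: X_def)
  ultimately show "\<exists>X\<subseteq>{..<n + m}. card X = m \<and> v = map (\<lambda>k. if k \<in> X then x else y) [0..<n + m]"
    by blast
next
  assume "\<exists>X\<subseteq>{..<n + m}. card X = m \<and> v = map (\<lambda>k. if k \<in> X then x else y) [0..<n + m]"
  then obtain X where X: "X \<subseteq> {..<n + m}" "card X = m" and v: "v = map (\<lambda>k. if k \<in> X then x else y) [0..<n + m]"
    by blast
  have "{k. k < n + m \<and> k \<in> X} = X" using X by auto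
  then have len: "length (filter (\<lambda>k. k \<in> X) [0..<n + m]) = m" using X by (simp add: length_filter_upt)
  show "mset v = replicate_mset n y + replicate_mset m x"
  proof (rule multiset_eqI)
    fix z
    have "z \<notin> set v" if "z \<noteq> x" "z \<noteq> y" using that by (auto simp: v)
    moreover have "count_list v x = m" "count_list v y = n"
      using count_two_letters[OF assms, of "\<lambda>k. k \<in> X" "[0..<n + m]"] by (simp_all only: v len length_upt diff_zero add_diff_cancel_right')
    ultimately show "count (mset v) z = count (replicate_mset n y + replicate_mset m x) z"
      using assms by (cases "z = x"; cases "z = y") (auto simp: count_mset count_list_0_iff)
  qed
qed

section \<open>Diagonals with a given set of shifted parts\<close>

text \<open>The number of members that are at least \<open>d i\<close> is \<open>i\<close>, so the index of a member is determined by the set.\<close>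

lemma decreasing_unique:
  fixes d e :: "nat \<Rightarrow> int"
  assumes d: "\<And>i j. 1 \<le> i \<Longrightarrow> i < j \<Longrightarrow> j \<le> a \<Longrightarrow> d j < d i"
    and e: "\<And>i j. 1 \<le> i \<Longrightarrow> i < j \<Longrightarrow> j \<le> a \<Longrightarrow> e j < e i"
    and im: "d ` {1..a} = e ` {1..a}" and i: "i \<in> {1..a}"
  shows "d i = e i"
proof -
  have rank: "card {t \<in> f ` {1..a}. f i \<le> t} = i"
    if f: "\<And>i j. 1 \<le> i \<Longrightarrow> i < j \<Longrightarrow> j \<le> a \<Longrightarrow> f j < f i" and i: "i \<in> {1..a}" for f :: "nat \<Rightarrow> int" and i
  proof -
    have "f i \<le> f j \<longleftrightarrow> j \<le> i" if "j \<in> {1..a}" for j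
      using f[of i j] f[of j i] i that by (cases i j rule: linorder_cases) auto
    then have "{t \<in> f ` {1..a}. f i \<le> t} = f ` {1..i}" using i by auto
    moreover have "inj_on f {1..i}"
    proof (rule inj_onI)
      fix k l assume "k \<in> {1..i}" "l \<in> {1..i}" "f k = f l"
      then show "k = l" using f[of k l] f[of l k] i by (cases k l rule: linorder_cases) auto
    qed
    ultimately show ?thesis by (simp add: card_image)
  qed
  obtain j where j: "j \<in> {1..a}" "d i = e j" using im i by (metis imageE imageI)
  have "card {t \<in> d ` {1..a}. d i \<le> t} = i" by (rule rank[OF d i])
  moreover have "card {t \<in> e ` {1..a}. e j \<le> t} = j" by (rule rank[OF e j(1)])
  ultimately have "i = j" by (simp only: im j(2))
  then show ?thesis using j by simp
qed

lemma SPP_with_beta_set: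
  assumes "B \<subseteq> {- int a..<int c}" "card B = a"
  shows "\<exists>p\<in>SPP a c. beta_set a p = B"
proof -
  have "finite B" using assms(1) finite_subset by blast
  then obtain d where d: "\<And>i j. 1 \<le> i \<Longrightarrow> i < j \<Longrightarrow> j \<le> a \<Longrightarrow> d j < d i" "d ` {1..a} = B"
    using decreasing_enumeration assms(2) by metis
  interpret diagonal a c d
    by unfold_locales (use d assms(1) in \<open>blast, metis atLeastLessThan_iff image_eqI subsetD\<close>)
  show ?thesis using SPP_realised d(2) by simp
qed

lemma TSPP_with_beta_set:
  assumes "B \<subseteq> {- int a..<int a}" "card B = a"
    and window: "\<And>n. n < a \<Longrightarrow> card (B \<inter> {- int n - 1..int n}) \<le> n + 1"
  shows "\<exists>p\<in>TSPP a. beta_set a p = B"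
    and "a = 2 * m \<Longrightarrow> (\<And>s. s \<in> B \<Longrightarrow> - 1 - s \<in> B) \<Longrightarrow> \<exists>p\<in>TSSCPP a. beta_set a p = B"
proof -
  have "finite B" using assms(1) finite_subset by blast
  then obtain d where d: "\<And>i j. 1 \<le> i \<Longrightarrow> i < j \<Longrightarrow> j \<le> a \<Longrightarrow> d j < d i" "d ` {1..a} = B"
    using decreasing_enumeration assms(2) by metis
  interpret windowed_diagonal a d
    by unfold_locales (use d assms in \<open>blast, metis atLeastLessThan_iff image_eqI subsetD, simp\<close>)
  show "\<exists>p\<in>TSPP a. beta_set a p = B" using TSPP_realised d(2) by simp
  assume a: "a = 2 * m" and sym: "\<And>s. s \<in> B \<Longrightarrow> - 1 - s \<in> B"
  have "d (a + 1 - i) = - 1 - d i" if i: "i \<in> {1..a}" for i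
  proof -
    have "- 1 - d (a + 1 - i) = d i"
    proof (rule decreasing_unique[of a, OF _ d(1) _ i])
      fix i j :: nat assume ij: "1 \<le> i" "i < j" "j \<le> a"
      have "d (a + 1 - i) < d (a + 1 - j)" by (rule d(1)) (use ij in auto)
      then show "- 1 - d (a + 1 - j) < - 1 - d (a + 1 - i)" by simp
    next
      have "(\<lambda>i. - 1 - d (a + 1 - i)) ` {1..a} = (\<lambda>s. - 1 - s) ` d ` (\<lambda>i. a + 1 - i) ` {1..a}"
        by (simp only: image_image)
      also have "(\<lambda>i. a + 1 - i) ` {1..a} = {1..a}"
      proof
        show "{1..a} \<subseteq> (\<lambda>i. a + 1 - i) ` {1..a}"
        proof
          fix i assume "i \<in> {1..a}"
          then show "i \<in> (\<lambda>i. a + 1 - i) ` {1..a}" by (intro image_eqI[of _ _ "a + 1 - i"]) auto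
        qed
      qed auto
      also have "(\<lambda>s. - 1 - s) ` d ` {1..a} = d ` {1..a}"
        unfolding d(2)
      proof
        show "B \<subseteq> (\<lambda>s. - 1 - s) ` B"
        proof
          fix s assume "s \<in> B"
          then show "s \<in> (\<lambda>s. - 1 - s) ` B" using sym by (intro image_eqI[of _ _ "- 1 - s"]) auto
        qed
      qed (use sym in blast)
      finally show "(\<lambda>i. - 1 - d (a + 1 - i)) ` {1..a} = d ` {1..a}" .
    qed
    then show ?thesis by simp
  qed
  from TSSCPP_realised[OF a this] show "\<exists>p\<in>TSSCPP a. beta_set a p = B" by (simp only: d(2))
qed

text \<open>The window consists of \<open>0, \<dots>, n\<close> and of their reflections at \<open>-1/2\<close>, which the two cuts show separately.\<close>

lemma card_window:
  "card (B \<inter> {- int n - 1..int n}) = card {k. k \<le> n \<and> int k \<in> B} + card {k. k \<le> n \<and> - 1 - int k \<in> B}"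
proof -
  have "B \<inter> {- int n - 1..int n} = int ` {k. k \<le> n \<and> int k \<in> B} \<union> (\<lambda>k. - 1 - int k) ` {k. k \<le> n \<and> - 1 - int k \<in> B}"
    (is "?l = ?r")
  proof
    show "?l \<subseteq> ?r"
    proof
      fix s assume s: "s \<in> ?l"
      show "s \<in> ?r"
      proof (cases "0 \<le> s")
        case True
        then have "s = int (nat s)" "nat s \<le> n" using s by auto
        then show ?thesis using s by (metis (mono_tags, lifting) IntD1 UnI1 image_eqI mem_Collect_eq)
      next
        case False
        then have "s = - 1 - int (nat (- 1 - s))" "nat (- 1 - s) \<le> n" using s by auto
        then show ?thesis using s by (metis (mono_tags, lifting) IntD1 UnI2 image_eqI mem_Collect_eq)
      qed
    qed
  qed auto
  moreover have "int ` {k. k \<le> n \<and> int k \<in> B} \<inter> (\<lambda>k. - 1 - int k) ` {k. k \<le> n \<and> - 1 - int k \<in> B} = {}" by auto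
  ultimately show ?thesis
    by (simp add: card_Un_disjoint card_image inj_on_def)
qed

lemma card_beta_set:
  assumes "B \<subseteq> {- int a..<int a}"
  shows "card B = card {k. k < a \<and> int k \<in> B} + card {k. k < a \<and> - 1 - int k \<in> B}"
proof (cases a)
  case 0
  then show ?thesis using assms by simp
next
  case (Suc n)
  then have "B \<inter> {- int n - 1..int n} = B" using assms by auto
  then show ?thesis using card_window[of B n] by (simp add: Suc less_Suc_eq_le)
qed

section \<open>The boundary words of the four symmetry classes\<close>

lemma SPP_words:
  assumes "1 \<le> a" "1 \<le> c"
  shows "SPP_word a c ` SPP a c =
       {replicate a [Plain 1] @ replicate c [Bar 4] @ replicate a [Plain 2] @ v | v.
          mset v = replicate_mset c [Plain 4] + replicate_mset a [Plain 3, Plain 4]}" (is "?l = ?r")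
proof -
  let ?word = "\<lambda>X. replicate a [Plain 1] @ replicate c [Bar 4] @ replicate a [Plain 2] @
    map (\<lambda>k. if k \<in> X then [Plain 3, Plain 4] else [Plain 4]) [0..<c + a]"
  have word: "SPP_word a c p = ?word {k. int k - int a \<in> beta_set a p}" if "p \<in> SPP a c" for p
  proof -
    have pp: "plane_partition a a c p" using that by (simp add: SPP_iff)
    have "(proj a a k, E3) \<in> hourglasses (pp_web a a c p) \<longleftrightarrow> int k - int a \<in> beta_set a p" for k
      using vertical_hourglass_iff[OF pp, of "int k - int a"] by (simp add: proj_def)
    then show ?thesis by (simp add: SPP_word_eq[OF pp assms] add.commute)
  qed
  have r: "?r = {?word X | X. X \<subseteq> {..<c + a} \<and> card X = a}"
    by (subst mset_two_letters) auto
  show ?thesis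
  proof
    show "?l \<subseteq> ?r"
    proof
      fix w assume "w \<in> ?l"
      then obtain p where p: "p \<in> SPP a c" "w = SPP_word a c p" by blast
      have pp: "plane_partition a a c p" using p by (simp add: SPP_iff)
      define X where "X = {k. k < c + a \<and> int k - int a \<in> beta_set a p}"
      have "(\<lambda>k. int k - int a) ` X = beta_set a p"
      proof
        show "beta_set a p \<subseteq> (\<lambda>k. int k - int a) ` X"
        proof
          fix s assume s: "s \<in> beta_set a p"
          then have "- int a \<le> s" "s < int c" using beta_set_bounds(1)[OF pp] by auto
          then show "s \<in> (\<lambda>k. int k - int a) ` X" using s by (intro image_eqI[of _ _ "nat (s + int a)"]) (auto simp: X_def)
        qed
      qed (auto simp: X_def)
      then have "card X = a" using beta_set_bounds(2)[OF pp] card_image[of "\<lambda>k. int k - int a" X] by (simp add: inj_on_def)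
      moreover have "w = ?word X" unfolding p(2) word[OF p(1)] by (simp add: X_def)
      ultimately show "w \<in> ?r" unfolding r by (intro CollectI exI[of _ X]) (auto simp: X_def)
    qed
    show "?r \<subseteq> ?l"
    proof
      fix w assume "w \<in> ?r"
      then obtain X where X: "X \<subseteq> {..<c + a}" "card X = a" and w: "w = ?word X" unfolding r by blast
      define B where "B = (\<lambda>k. int k - int a) ` X"
      have "card B = a" using X by (simp add: B_def card_image inj_on_def)
      moreover have "B \<subseteq> {- int a..<int c}" using X by (auto simp: B_def)
      ultimately obtain p where p: "p \<in> SPP a c" "beta_set a p = B" using SPP_with_beta_set by blast
      have "{k. int k - int a \<in> B} = X" by (auto simp: B_def)
      then have "SPP_word a c p = w" unfolding word[OF p(1)] p(2) w by simp
      then show "w \<in> ?l" using p(1) by blast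
    qed
  qed
qed

lemma inj_on_reflect:
  assumes "Y \<subseteq> {..<a}"
  shows "inj_on (\<lambda>i. a - 1 - i) Y" "inj_on (\<lambda>i. - 1 - int (a - 1 - i)) Y"
proof -
  have "i = j" if "i \<in> Y" "j \<in> Y" "a - 1 - i = a - 1 - j" for i j
  proof -
    have "i < a" "j < a" using that assms by auto
    then show ?thesis using that(3) by linarith
  qed
  then show "inj_on (\<lambda>i. a - 1 - i) Y" "inj_on (\<lambda>i. - 1 - int (a - 1 - i)) Y"
    by (auto intro!: inj_onI)
qed

text \<open>The slanted cuts are read towards the centre and the vertical cut away from it; this turns positions around.\<close>

lemma card_reflect:
  fixes a n :: nat
  assumes "n < a"
  shows "card {i. a - 1 - n \<le> i \<and> i < a \<and> P (a - 1 - i)} = card {k. k \<le> n \<and> P k}"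
proof -
  have "(\<lambda>i. a - 1 - i) ` {i. a - 1 - n \<le> i \<and> i < a \<and> P (a - 1 - i)} = {k. k \<le> n \<and> P k}"
  proof
    show "{k. k \<le> n \<and> P k} \<subseteq> (\<lambda>i. a - 1 - i) ` {i. a - 1 - n \<le> i \<and> i < a \<and> P (a - 1 - i)}"
    proof
      fix k assume "k \<in> {k. k \<le> n \<and> P k}"
      moreover from this have "a - 1 - (a - 1 - k) = k" using assms by auto
      ultimately show "k \<in> (\<lambda>i. a - 1 - i) ` {i. a - 1 - n \<le> i \<and> i < a \<and> P (a - 1 - i)}"
        using assms by (intro image_eqI[of _ _ "a - 1 - k"]) auto
    qed
  qed auto
  moreover have "inj_on (\<lambda>i. a - 1 - i) {i. a - 1 - n \<le> i \<and> i < a \<and> P (a - 1 - i)}"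
    by (rule inj_on_reflect) auto
  ultimately show ?thesis
    using card_image[of "\<lambda>i. a - 1 - i" "{i. a - 1 - n \<le> i \<and> i < a \<and> P (a - 1 - i)}"] by simp
qed

lemma card_reflect_all: "card {i. i < (a::nat) \<and> P (a - 1 - i)} = card {k. k < a \<and> P k}"
proof (cases a)
  case (Suc n)
  then show ?thesis using card_reflect[of n a P] by (simp add: less_Suc_eq_le)
qed simp

lemma rev_upt_conv: "rev [0..<n] = map (\<lambda>i. n - 1 - i) [0..<n]"
  by (rule nth_equalityI) (auto simp: rev_nth)

lemma vertical_cut:
  assumes "plane_partition a a a p"
  shows "(proj 0 0 k, E3) \<in> hourglasses (pp_web a a a p) \<longleftrightarrow> int k \<in> beta_set a p"
  using vertical_hourglass_iff[OF assms, of "int k"] by (simp add: proj_def)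

text \<open>The cuts show the same set of hourglasses in opposite orders, so a word is determined by a subset \<open>X\<close> of \<open>{..<a}\<close>. The
  one-sided condition of the theorem forces equality because the multiplicities agree. To realise \<open>X\<close>, add the lowest possible
  negative numbers, which correspond to zero diagonal entries; then the window condition holds trivially.\<close>

lemma CSPP_words:
  assumes "1 \<le> a"
  shows "CSPP_word a ` CSPP a =
       {replicate a [Plain 1] @ replicate a [Bar 4] @ u @ v | u v m.
          m \<le> a \<and>
          mset u = replicate_mset m [Bar 3, Bar 1] + replicate_mset (a - m) [Bar 1] \<and>
          mset v = replicate_mset (a - m) [Plain 4] + replicate_mset m [Plain 3, Plain 4] \<and>
          (\<forall>i<a. u ! i = [Bar 3, Bar 1] \<longrightarrow> v ! (a - i - 1) = [Plain 3, Plain 4])}" (is "?l = ?r")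
proof -
  let ?u = "\<lambda>X. map (\<lambda>i. if i \<in> X then [Bar 3, Bar 1] else [Bar 1]) [0..<a]"
  let ?v = "\<lambda>X. map (\<lambda>k. if k \<in> X then [Plain 3, Plain 4] else [Plain 4]) [0..<a]"
  let ?word = "\<lambda>X. replicate a [Plain 1] @ replicate a [Bar 4] @ ?u {i. a - 1 - i \<in> X} @ ?v X"
  have word: "CSPP_word a p = ?word {k. int k \<in> beta_set a p}" if p: "p \<in> CSPP a" for p
  proof -
    have pp: "plane_partition a a a p" using p by (simp add: CSPP_iff)
    have "(proj i 0 0, E1) \<in> hourglasses (pp_web a a a p) \<longleftrightarrow> int i \<in> beta_set a p" for i
      using CSPP_hourglass_iff[OF p, of "int i"] by (simp add: proj_def)
    then show ?thesis
      by (simp add: CSPP_word_eq[OF pp assms] vertical_cut[OF pp] rev_upt_conv)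
  qed
  have r: "?r = {?word X | X. X \<subseteq> {..<a}}"
  proof
    show "?r \<subseteq> {?word X | X. X \<subseteq> {..<a}}"
    proof
      fix w assume "w \<in> ?r"
      then obtain u v m where w: "w = replicate a [Plain 1] @ replicate a [Bar 4] @ u @ v" and m: "m \<le> a"
        and u: "mset u = replicate_mset (a - m) [Bar 1] + replicate_mset m [Bar 3, Bar 1]"
        and v: "mset v = replicate_mset (a - m) [Plain 4] + replicate_mset m [Plain 3, Plain 4]"
        and uv: "\<forall>i<a. u ! i = [Bar 3, Bar 1] \<longrightarrow> v ! (a - i - 1) = [Plain 3, Plain 4]"
        by (auto simp: add.commute)
      obtain Y where Y: "Y \<subseteq> {..<a}" "card Y = m" "u = ?u Y"
        using u m by (subst (asm) mset_two_letters) auto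
      obtain X where X: "X \<subseteq> {..<a}" "card X = m" "v = ?v X"
        using v m by (subst (asm) mset_two_letters) auto
      have "(\<lambda>i. a - 1 - i) ` Y \<subseteq> X"
      proof
        fix k assume "k \<in> (\<lambda>i. a - 1 - i) ` Y"
        then obtain i where i: "i \<in> Y" "k = a - 1 - i" by blast
        then have "i < a" "k < a" using Y by auto
        then have "v ! k = [Plain 3, Plain 4]" using uv i Y by (auto simp: Y(3) diff_commute)
        then show "k \<in> X" using \<open>k < a\<close> by (auto simp: X(3) split: if_splits)
      qed
      moreover have "inj_on (\<lambda>i. a - 1 - i) Y" using inj_on_reflect Y(1) by blast
      then have "card ((\<lambda>i. a - 1 - i) ` Y) = card X" using X Y by (simp add: card_image)
      moreover have "finite X" using X(1) finite_subset by blast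
      ultimately have eq: "(\<lambda>i. a - 1 - i) ` Y = X" by (intro card_subset_eq)
      have "i \<in> Y \<longleftrightarrow> a - 1 - i \<in> X" if "i < a" for i
      proof
        assume "a - 1 - i \<in> X"
        then obtain j where "j \<in> Y" "a - 1 - j = a - 1 - i" unfolding eq[symmetric] by force
        then show "i \<in> Y" using that Y(1) by (metis diff_diff_cancel lessThan_iff less_Suc_eq_le Suc_diff_1 subsetD gr_implies_not0 not_gr_zero)
      qed (use eq in blast)
      then have "u = ?u {i. a - 1 - i \<in> X}" unfolding Y(3) by (intro map_cong[OF refl]) auto
      then show "w \<in> {?word X | X. X \<subseteq> {..<a}}" using w X by blast
    qed
    show "{?word X | X. X \<subseteq> {..<a}} \<subseteq> ?r"
    proof
      fix w assume "w \<in> {?word X | X. X \<subseteq> {..<a}}"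
      then obtain X where X: "X \<subseteq> {..<a}" and w: "w = ?word X" by blast
      define m where "m = card X"
      define Y where "Y = {i. i < a \<and> a - 1 - i \<in> X}"
      have m: "m \<le> a" using card_mono[of "{..<a}" X] X by (simp add: m_def)
      have "{k. k < a \<and> k \<in> X} = X" using X by auto
      then have Y: "card Y = m" unfolding Y_def m_def using card_reflect_all[of a "\<lambda>k. k \<in> X"] by simp
      have "?u {i. a - 1 - i \<in> X} = ?u Y" by (simp add: Y_def)
      moreover have "mset (?u Y) = replicate_mset (a - m) [Bar 1] + replicate_mset m [Bar 3, Bar 1]"
        using Y m by (subst mset_two_letters) (auto intro!: exI[of _ Y] simp: Y_def)
      moreover have "mset (?v X) = replicate_mset (a - m) [Plain 4] + replicate_mset m [Plain 3, Plain 4]"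
        using X m by (subst mset_two_letters) (auto intro!: exI[of _ X] simp: m_def)
      moreover have "\<forall>i<a. ?u Y ! i = [Bar 3, Bar 1] \<longrightarrow> ?v X ! (a - i - 1) = [Plain 3, Plain 4]"
        by (auto simp: Y_def diff_commute split: if_splits)
      ultimately show "w \<in> ?r" unfolding w using m
        by (intro CollectI, rule_tac x = "?u Y" in exI, rule_tac x = "?v X" in exI, rule_tac x = m in exI)
          (simp add: add.commute)
    qed
  qed
  show ?thesis
  proof
    show "?l \<subseteq> ?r"
    proof
      fix w assume "w \<in> ?l"
      then obtain p where p: "p \<in> CSPP a" "w = CSPP_word a p" by blast
      then have pp: "plane_partition a a a p" by (simp add: CSPP_iff)
      then have "{k. int k \<in> beta_set a p} \<subseteq> {..<a}" using beta_set_bounds(1)[OF pp] by auto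
      then show "w \<in> ?r" unfolding r p(2) word[OF p(1)] by blast
    qed
    show "?r \<subseteq> ?l"
    proof
      fix w assume "w \<in> ?r"
      then obtain X where X: "X \<subseteq> {..<a}" and w: "w = ?word X" unfolding r by blast
      define m where "m = card X"
      \<comment> \<open>the elements below \<open>- m\<close> stand for vanishing diagonal entries\<close>
      define B where "B = int ` X \<union> {- int a..<- int m}"
      have m: "m \<le> a" using card_mono[of "{..<a}" X] X by (simp add: m_def)
      have fin: "finite X" using X finite_subset by blast
      have pos: "int k \<in> B \<longleftrightarrow> k \<in> X" for k by (auto simp: B_def)
      have neg: "- 1 - int k \<in> B \<longleftrightarrow> m \<le> k \<and> k < a" for k by (auto simp: B_def)
      have sub: "B \<subseteq> {- int a..<int a}" using X by (auto simp: B_def)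
      have "{k. k < a \<and> k \<in> X} = X" "{k. k < a \<and> m \<le> k \<and> k < a} = {m..<a}" using X by auto
      then have "card B = a" using card_beta_set[OF sub] m by (simp add: pos neg m_def)
      moreover have "card (B \<inter> {- int n - 1..int n}) \<le> n + 1" if "n < a" for n
      proof -
        have "{k. k \<le> n \<and> m \<le> k \<and> k < a} = {m..<n + 1}" using that by auto
        moreover have "card {k. k \<le> n \<and> k \<in> X} \<le> m" unfolding m_def by (rule card_mono) (use fin in auto)
        moreover have "card {k. k \<le> n \<and> k \<in> X} \<le> card {..n}" by (rule card_mono) auto
        ultimately show ?thesis by (simp add: card_window pos neg)
      qed
      ultimately obtain p where p: "p \<in> TSPP a" "beta_set a p = B" using TSPP_with_beta_set(1)[OF sub] by blast
      then have "p \<in> CSPP a" by (simp add: TSPP_def)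
      moreover have "CSPP_word a p = w" unfolding word[OF calculation] p(2) w by (simp add: pos)
      ultimately show "w \<in> ?l" by blast
    qed
  qed
qed

text \<open>With \<open>B\<close> the set of the numbers \<open>p\<^sub>i\<^sub>i - i\<close>, the last \<open>n + 1\<close> letters of the slanted cut show \<open>B\<close> on \<open>{-n - 1..-1}\<close> and the first \<open>n + 1\<close>
  letters of the vertical cut show it on \<open>{0..n}\<close>, where the letters \<open>4\<close> mark the missing numbers. So the inequality is the
  window condition (\<open>counts\<close> in the proof).\<close>

lemma TSPP_words:
  assumes "1 \<le> a"
  shows "TSPP_word a ` TSPP a =
       {replicate a [Plain 1] @ u @ v | u v m.
          m \<le> a \<and>
          mset u = replicate_mset (a - m) [Plain 2, Plain 3] + replicate_mset m [Plain 2] \<and>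
          mset v = replicate_mset (a - m) [Plain 4] + replicate_mset m [Plain 3, Plain 4] \<and>
          (\<forall>i<a. count_list (drop (a - 1 - i) u) [Plain 2, Plain 3]
                  \<le> count_list (take (i + 1) v) [Plain 4])}" (is "?l = ?r")
proof -
  let ?u = "\<lambda>Y. map (\<lambda>i. if i \<in> Y then [Plain 2, Plain 3] else [Plain 2]) [0..<a]"
  let ?v = "\<lambda>X. map (\<lambda>k. if k \<in> X then [Plain 3, Plain 4] else [Plain 4]) [0..<a]"
  define neg where "neg B = {i. - 1 - int (a - 1 - i) \<in> B}" for B
  define pos where "pos B = {k. int k \<in> B}" for B
  let ?word = "\<lambda>B. replicate a [Plain 1] @ ?u (neg B) @ ?v (pos B)"
  have word: "TSPP_word a p = ?word (beta_set a p)" if p: "p \<in> TSPP a" for p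
  proof -
    have pp: "plane_partition a a a p" using p by (simp only: TSPP_iff)
    have *: "(proj i 0 i, E2) \<in> hourglasses (pp_web a a a p) \<longleftrightarrow> - int i \<in> beta_set a p" for i
      using TSPP_hourglass_iff[OF p, of "int i"] by (simp add: proj_def)
    have "rev [1..<a + 1] = map Suc (rev [0..<a])" by (simp add: rev_map[symmetric] map_Suc_upt)
    then have rev: "rev [1..<a + 1] = map (\<lambda>i. Suc (a - 1 - i)) [0..<a]" by (simp add: rev_upt_conv)
    have "- int (Suc (a - 1 - i)) = - 1 - int (a - 1 - i)" for i by simp
    then show ?thesis
      unfolding TSPP_word_eq[OF pp assms] vertical_cut[OF pp] * rev map_map comp_def neg_def pos_def by simp
  qed
  have counts: "(\<forall>i<a. count_list (drop (a - 1 - i) (?u (neg B))) [Plain 2, Plain 3]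
                  \<le> count_list (take (i + 1) (?v (pos B))) [Plain 4])
    \<longleftrightarrow> (\<forall>n<a. card (B \<inter> {- int n - 1..int n}) \<le> n + 1)" for B
  proof -
    have "count_list (drop (a - 1 - n) (?u (neg B))) [Plain 2, Plain 3] = card {k. k \<le> n \<and> - 1 - int k \<in> B}"
      if "n < a" for n
    proof -
      have "count_list (drop (a - 1 - n) (?u (neg B))) [Plain 2, Plain 3]
        = card {i. a - 1 - n \<le> i \<and> i < a \<and> i \<in> neg B}"
      proof -
        have "drop (a - 1 - n) (?u (neg B)) =
          map (\<lambda>i. if i \<in> neg B then [Plain 2, Plain 3] else [Plain 2]) [a - 1 - n..<a]"
          by (simp only: drop_map drop_upt add_0)
        then show ?thesis by (simp add: count_two_letters length_filter_upt)
      qed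
      also have "\<dots> = card {k. k \<le> n \<and> - 1 - int k \<in> B}"
        unfolding neg_def mem_Collect_eq by (rule card_reflect[OF that])
      finally show ?thesis .
    qed
    moreover have "count_list (take (n + 1) (?v (pos B))) [Plain 4] = n + 1 - card {k. k \<le> n \<and> int k \<in> B}"
      if "n < a" for n
    proof -
      have "take (n + 1) (?v (pos B)) = map (\<lambda>k. if k \<in> pos B then [Plain 3, Plain 4] else [Plain 4]) [0..<n + 1]"
        using that by (simp add: take_map take_upt del: upt_Suc)
      then show ?thesis
        by (simp add: count_two_letters length_filter_upt pos_def less_Suc_eq_le del: upt_Suc)
    qed
    moreover have "card {k. k \<le> n \<and> int k \<in> B} \<le> n + 1" for n
      using card_mono[of "{..n}" "{k. k \<le> n \<and> int k \<in> B}"] by auto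
    ultimately show ?thesis unfolding card_window by (intro all_cong) (simp add: le_diff_conv2 add.commute)
  qed
  have r: "?r = {?word B | B. B \<subseteq> {- int a..<int a} \<and> card B = a \<and> (\<forall>n<a. card (B \<inter> {- int n - 1..int n}) \<le> n + 1)}"
    (is "_ = ?s")
  proof
    show "?r \<subseteq> ?s"
    proof
      fix w assume "w \<in> ?r"
      then obtain u v m where w: "w = replicate a [Plain 1] @ u @ v" and m: "m \<le> a"
        and u: "mset u = replicate_mset m [Plain 2] + replicate_mset (a - m) [Plain 2, Plain 3]"
        and v: "mset v = replicate_mset (a - m) [Plain 4] + replicate_mset m [Plain 3, Plain 4]"
        and uv: "\<forall>i<a. count_list (drop (a - 1 - i) u) [Plain 2, Plain 3] \<le> count_list (take (i + 1) v) [Plain 4]"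
        by (auto simp: add.commute)
      obtain Y where Y: "Y \<subseteq> {..<a}" "card Y = a - m" "u = ?u Y"
        using u m by (subst (asm) mset_two_letters) auto
      obtain X where X: "X \<subseteq> {..<a}" "card X = m" "v = ?v X"
        using v m by (subst (asm) mset_two_letters) auto
      define B where "B = int ` X \<union> (\<lambda>i. - 1 - int (a - 1 - i)) ` Y"
      have sub: "B \<subseteq> {- int a..<int a}" using X Y by (auto simp: B_def)
      have "int ` X \<inter> (\<lambda>i. - 1 - int (a - 1 - i)) ` Y = {}" by auto
      moreover have "inj_on (\<lambda>i. - 1 - int (a - 1 - i)) Y" using inj_on_reflect Y(1) by blast
      moreover have "finite X" "finite Y" using X(1) Y(1) finite_subset by blast+
      ultimately have card: "card B = a"
        using X Y m by (simp add: B_def card_Un_disjoint card_image)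
      have "pos B = X" by (auto simp: pos_def B_def)
      moreover have "i \<in> neg B \<longleftrightarrow> i \<in> Y" if "i < a" for i
      proof -
        have "i = j" if "j \<in> Y" "int (a - 1 - i) = int (a - 1 - j)" for j
          using that Y(1) \<open>i < a\<close> by force
        then show ?thesis by (auto simp: neg_def B_def)
      qed
      then have "?u (neg B) = ?u Y" by (intro map_cong[OF refl]) auto
      ultimately have "w = ?word B" "u = ?u (neg B)" "v = ?v (pos B)" using w X Y by simp_all
      then show "w \<in> ?s" using sub card uv counts[of B] by blast
    qed
    show "?s \<subseteq> ?r"
    proof
      fix w assume "w \<in> ?s"
      then obtain B where B: "B \<subseteq> {- int a..<int a}" "card B = a"
          "\<forall>n<a. card (B \<inter> {- int n - 1..int n}) \<le> n + 1" and w: "w = ?word B" by blast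
      define X where "X = {k. k < a \<and> int k \<in> B}"
      define Y where "Y = {i. i < a \<and> i \<in> neg B}"
      define m where "m = card X"
      have m: "m \<le> a" using card_mono[of "{..<a}" X] by (auto simp: m_def X_def)
      have "card Y = card {k. k < a \<and> - 1 - int k \<in> B}"
        unfolding Y_def neg_def mem_Collect_eq by (rule card_reflect_all)
      then have Y: "card Y = a - m" using card_beta_set[OF B(1)] B(2) by (simp add: m_def X_def)
      have uv: "?u (neg B) = ?u Y" "?v (pos B) = ?v X" by (simp_all add: Y_def X_def pos_def)
      have "mset (?u Y) = replicate_mset m [Plain 2] + replicate_mset (a - m) [Plain 2, Plain 3]"
        using Y m by (subst mset_two_letters) (auto intro!: exI[of _ Y] simp: Y_def)
      then have u: "mset (?u (neg B)) = replicate_mset (a - m) [Plain 2, Plain 3] + replicate_mset m [Plain 2]"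
        by (simp only: uv add.commute)
      have "mset (?v X) = replicate_mset (a - m) [Plain 4] + replicate_mset m [Plain 3, Plain 4]"
        using m by (subst mset_two_letters) (auto intro!: exI[of _ X] simp: m_def X_def)
      then have v: "mset (?v (pos B)) = replicate_mset (a - m) [Plain 4] + replicate_mset m [Plain 3, Plain 4]"
        by (simp only: uv)
      from counts[of B] B(3) u v m show "w \<in> ?r" unfolding w by blast
    qed
  qed
  show ?thesis
  proof
    show "?l \<subseteq> ?r"
    proof
      fix w assume "w \<in> ?l"
      then obtain p where p: "p \<in> TSPP a" "w = TSPP_word a p" by blast
      then have pp: "plane_partition a a a p" by (simp only: TSPP_iff)
      show "w \<in> ?r" unfolding r p(2) word[OF p(1)]
        using beta_set_bounds(1,2)[OF pp] TSPP_window[OF p(1)] by blast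
    qed
    show "?r \<subseteq> ?l"
    proof
      fix w assume "w \<in> ?r"
      then obtain B where B: "B \<subseteq> {- int a..<int a}" "card B = a"
          "\<forall>n<a. card (B \<inter> {- int n - 1..int n}) \<le> n + 1" and w: "w = ?word B" unfolding r by blast
      then obtain p where p: "p \<in> TSPP a" "beta_set a p = B" using TSPP_with_beta_set(1)[of B a] by blast
      have "w = TSPP_word a p" unfolding word[OF p(1)] p(2) w ..
      then show "w \<in> ?l" using p(1) by blast
    qed
  qed
qed

lemma TSSCPP_beta_set:
  assumes p: "p \<in> TSSCPP a" and s: "s \<in> beta_set a p"
  shows "- 1 - s \<in> beta_set a p"
proof -
  obtain i where i: "i \<in> {1..a}" "s = int (height p i i) - int i"
    using s by (auto simp: beta_set_def beta_def)
  have "height p i i + height p (a + 1 - i) (a + 1 - i) = a"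
    using p i(1) by (simp add: TSSCPP_def)
  then have "int (height p i i) + int (height p (a + 1 - i) (a + 1 - i)) = int a"
    by (simp only: of_nat_add[symmetric])
  moreover have "int (a + 1 - i) = int a + 1 - int i" using i(1) by auto
  ultimately have "- 1 - s = beta a p (a + 1 - i)" by (simp add: beta_def i(2))
  moreover have "a + 1 - i \<in> {1..a}" using i(1) by auto
  ultimately show ?thesis by (simp add: beta_set_def)
qed

lemma yamanouchi_iff:
  assumes "x \<noteq> y"
  shows "yamanouchi x y (map (\<lambda>k. if k \<in> S then y else x) [0..<N]) \<longleftrightarrow>
    (\<forall>n\<le>N. 2 * card {k. k < n \<and> k \<in> S} \<le> n)"
proof -
  have "count_list (take n (map (\<lambda>k. if k \<in> S then y else x) [0..<N])) y
      \<le> count_list (take n (map (\<lambda>k. if k \<in> S then y else x) [0..<N])) x \<longleftrightarrow>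
    2 * card {k. k < n \<and> k \<in> S} \<le> n" if "n \<le> N" for n
  proof -
    have "take n (map (\<lambda>k. if k \<in> S then y else x) [0..<N]) = map (\<lambda>k. if k \<in> S then y else x) [0..<n]"
      using that by (simp add: take_map)
    moreover have "card {k. k < n \<and> k \<in> S} \<le> n"
      using card_mono[of "{..<n}" "{k. k < n \<and> k \<in> S}"] by auto
    ultimately show ?thesis
      using assms by (auto simp: count_two_letters length_filter_upt)
  qed
  then show ?thesis by (auto simp: yamanouchi_def)
qed

text \<open>For symmetric \<open>B\<close>, the window condition says that at most half of the first \<open>n + 1\<close> numbers \<open>0, 1, \<dots>\<close> belong to \<open>B\<close>, for all \<open>n\<close>: this is the
  Yamanouchi condition. It forces the first letter, on the discarded side at the centre, to be \<open>4\<close> and the last one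
  to be \<open>(34)\<close>.\<close>

lemma TSSCPP_words:
  assumes "1 \<le> d"
  shows "TSSCPP_word d ` TSSCPP (2 * d) =
       {replicate d [Plain 1] @
          map (\<lambda>n. if even n then [Plain 2] else [Bar 4]) [0..<2 * d - 1] @
          w @ [[Plain 3, Plain 4]] | w.
          mset w = replicate_mset (d - 1) [Plain 4] + replicate_mset (d - 1) [Plain 3, Plain 4] \<and>
          yamanouchi [Plain 4] [Plain 3, Plain 4] ([[Plain 4]] @ w @ [[Plain 3, Plain 4]])}" (is "?l = ?r")
proof -
  let ?f = "\<lambda>S k. if k \<in> S then [Plain 3, Plain 4] else [Plain 4]"
  let ?w = "\<lambda>S. map (?f S) [1..<2 * d - 1]"
  let ?word = "\<lambda>w. replicate d [Plain 1] @ map (\<lambda>n. if even n then [Plain 2] else [Bar 4]) [0..<2 * d - 1] @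
    w @ [[Plain 3, Plain 4]]"
  have intervals: "[0..<2 * d] = 0 # [1..<2 * d - 1] @ [2 * d - 1]" "[1..<2 * d] = [1..<2 * d - 1] @ [2 * d - 1]"
  proof -
    have "[1..<Suc (2 * d - 1)] = [1..<2 * d - 1] @ [2 * d - 1]" using assms by (intro upt_Suc_append) simp
    moreover have "Suc (2 * d - 1) = 2 * d" using assms by simp
    ultimately show "[1..<2 * d] = [1..<2 * d - 1] @ [2 * d - 1]" by simp
    then show "[0..<2 * d] = 0 # [1..<2 * d - 1] @ [2 * d - 1]" using assms upt_conv_Cons[of 0 "2 * d"] by simp
  qed
  have full: "[[Plain 4]] @ ?w S @ [[Plain 3, Plain 4]] = map (?f S) [0..<2 * d]"
    if "0 \<notin> S" "2 * d - 1 \<in> S" for S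
    unfolding intervals using that by simp
  have word: "TSSCPP_word d p = ?word (?w {k. int k \<in> beta_set (2 * d) p})"
    if p: "p \<in> TSSCPP (2 * d)" and last: "int (2 * d - 1) \<in> beta_set (2 * d) p" for p
  proof -
    have pp: "plane_partition (2 * d) (2 * d) (2 * d) p" using p by (simp add: TSSCPP_def TSPP_iff)
    have "1 \<le> 2 * d" using assms by simp
    from TSSCPP_word_eq[OF pp this TSSCPP_zigzag[OF p]] show ?thesis
      unfolding vertical_cut[OF pp] intervals using last by simp
  qed
  define good where "good S \<longleftrightarrow> S \<subseteq> {..<2 * d} \<and> card S = d \<and> (\<forall>n\<le>2 * d. 2 * card {k. k < n \<and> k \<in> S} \<le> n)" for S
  have good_ends: "0 \<notin> S" "2 * d - 1 \<in> S" if "good S" for S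
  proof -
    have S: "S \<subseteq> {..<2 * d}" "card S = d" "\<And>n. n \<le> 2 * d \<Longrightarrow> 2 * card {k. k < n \<and> k \<in> S} \<le> n"
      using that by (auto simp: good_def)
    show "0 \<notin> S"
    proof
      assume "0 \<in> S"
      then have "{k. k < (1::nat) \<and> k \<in> S} = {0}" by auto
      then show False using S(3)[of 1] assms by simp
    qed
    show "2 * d - 1 \<in> S"
    proof (rule ccontr)
      assume n: "2 * d - 1 \<notin> S"
      have "k < 2 * d - 1" if "k \<in> S" for k
      proof -
        have "k < 2 * d" "k \<noteq> 2 * d - 1" using that S(1) n by auto
        then show ?thesis by linarith
      qed
      then have "{k. k < 2 * d - 1 \<and> k \<in> S} = S" by auto
      then show False using S(3)[of "2 * d - 1"] S(2) assms by simp
    qed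
  qed
  have r: "?r = {?word (?w S) | S. good S}"
  proof
    show "?r \<subseteq> {?word (?w S) | S. good S}"
    proof
      fix v assume "v \<in> ?r"
      then obtain w where v: "v = ?word w"
        and w: "mset w = replicate_mset (d - 1) [Plain 4] + replicate_mset (d - 1) [Plain 3, Plain 4]"
        and y: "yamanouchi [Plain 4] [Plain 3, Plain 4] ([[Plain 4]] @ w @ [[Plain 3, Plain 4]])" by blast
      have "mset ([[Plain 4]] @ w @ [[Plain 3, Plain 4]]) = replicate_mset d [Plain 4] + replicate_mset d [Plain 3, Plain 4]"
        using w assms by (cases d) simp_all
      then obtain S where S: "S \<subseteq> {..<d + d}" "card S = d"
          and eq: "[[Plain 4]] @ w @ [[Plain 3, Plain 4]] = map (?f S) [0..<d + d]"
        by (subst (asm) mset_two_letters) auto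
      have "\<forall>n\<le>2 * d. 2 * card {k. k < n \<and> k \<in> S} \<le> n"
        using y unfolding eq by (subst (asm) yamanouchi_iff) (simp_all add: mult_2)
      then have good: "good S" using S by (simp add: good_def mult_2)
      have "[[Plain 4]] @ ?w S @ [[Plain 3, Plain 4]] = [[Plain 4]] @ w @ [[Plain 3, Plain 4]]"
        unfolding full[OF good_ends[OF good]] eq by (simp only: mult_2)
      then have wS: "?w S = w" by simp
      then show "v \<in> {?word (?w S) | S. good S}" using v wS good by blast
    qed
    show "{?word (?w S) | S. good S} \<subseteq> ?r"
    proof
      fix v assume "v \<in> {?word (?w S) | S. good S}"
      then obtain S where S: "good S" and v: "v = ?word (?w S)" by blast
      have S': "S \<subseteq> {..<2 * d}" "card S = d" "\<forall>n\<le>2 * d. 2 * card {k. k < n \<and> k \<in> S} \<le> n"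
        using S by (auto simp: good_def)
      note ends = good_ends[OF S]
      have y: "yamanouchi [Plain 4] [Plain 3, Plain 4] ([[Plain 4]] @ ?w S @ [[Plain 3, Plain 4]])"
        unfolding full[OF ends] by (subst yamanouchi_iff) (use S'(3) in auto)
      have "mset (map (?f S) [0..<d + d]) = replicate_mset d [Plain 4] + replicate_mset d [Plain 3, Plain 4]"
        using S' by (subst mset_two_letters) (auto simp: mult_2)
      then have "mset ([[Plain 4]] @ ?w S @ [[Plain 3, Plain 4]]) = replicate_mset d [Plain 4] + replicate_mset d [Plain 3, Plain 4]"
        unfolding full[OF ends] by (simp only: mult_2)
      then have "mset (?w S) = replicate_mset (d - 1) [Plain 4] + replicate_mset (d - 1) [Plain 3, Plain 4]"
        using assms by (cases d) simp_all
      then show "v \<in> ?r" using v y by blast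
    qed
  qed
  show ?thesis
  proof
    show "?l \<subseteq> ?r"
    proof
      fix v assume "v \<in> ?l"
      then obtain p where p: "p \<in> TSSCPP (2 * d)" "v = TSSCPP_word d p" by blast
      then have t: "p \<in> TSPP (2 * d)" by (simp add: TSSCPP_def)
      then have pp: "plane_partition (2 * d) (2 * d) (2 * d) p" by (simp only: TSPP_iff)
      let ?B = "beta_set (2 * d) p"
      note B = beta_set_bounds[OF pp]
      have sym: "- 1 - s \<in> ?B \<longleftrightarrow> s \<in> ?B" for s
        using TSSCPP_beta_set[OF p(1), of s] TSSCPP_beta_set[OF p(1), of "- 1 - s"] by auto
      \<comment> \<open>the hourglasses on the vertical cut, numbered from the centre\<close>
      define S where "S = {k. int k \<in> ?B}"
      have "S \<subseteq> {..<2 * d}" using B(1) by (auto simp: S_def)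
      moreover have "card S = d"
      proof -
        have "{k. k < 2 * d \<and> int k \<in> ?B} = S" using calculation by (auto simp: S_def)
        then show ?thesis using card_beta_set[OF B(1)] B(2) unfolding sym by simp
      qed
      moreover have "2 * card {k. k < n \<and> k \<in> S} \<le> n" for n
      proof (cases n)
        case (Suc m)
        then show ?thesis
          using TSPP_window[OF t, of m] unfolding card_window sym S_def by (simp add: less_Suc_eq_le)
      qed simp
      ultimately have S: "good S" by (simp add: good_def)
      then have "int (2 * d - 1) \<in> ?B" using good_ends(2) by (auto simp: S_def)
      from word[OF p(1) this] S show "v \<in> ?r" unfolding r p(2) S_def by blast
    qed
    show "?r \<subseteq> ?l"
    proof
      fix v assume "v \<in> ?r"
      then obtain S where S: "good S" and v: "v = ?word (?w S)" unfolding r by blast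
      have S': "S \<subseteq> {..<2 * d}" "card S = d" "\<forall>n\<le>2 * d. 2 * card {k. k < n \<and> k \<in> S} \<le> n"
        using S by (auto simp: good_def)
      define B where "B = int ` S \<union> (\<lambda>k. - 1 - int k) ` S"
      have pos: "int k \<in> B \<longleftrightarrow> k \<in> S" and neg: "- 1 - int k \<in> B \<longleftrightarrow> k \<in> S" for k
        by (auto simp: B_def)
      have sub: "B \<subseteq> {- int (2 * d)..<int (2 * d)}" using S'(1) by (auto simp: B_def)
      have "{k. k < 2 * d \<and> k \<in> S} = S" using S'(1) by auto
      then have "card B = 2 * d" using card_beta_set[OF sub] S'(2) unfolding pos neg by simp
      moreover have "card (B \<inter> {- int n - 1..int n}) \<le> n + 1" if "n < 2 * d" for n
        using S'(3)[rule_format, of "n + 1"] that by (simp add: card_window pos neg less_Suc_eq_le)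
      moreover have "- 1 - s \<in> B" if "s \<in> B" for s using that by (auto simp: B_def)
      ultimately obtain p where p: "p \<in> TSSCPP (2 * d)" "beta_set (2 * d) p = B"
        using TSPP_with_beta_set(2)[OF sub, of d] by blast
      have "int (2 * d - 1) \<in> beta_set (2 * d) p" using good_ends(2)[OF S] pos p(2) by blast
      from word[OF p(1) this] have "TSSCPP_word d p = v" unfolding p(2) v by (simp only: pos Collect_mem_eq)
      then show "v \<in> ?l" using p(1) by blast
    qed
  qed
qed

theorem theorem1p2:
  fixes a c d :: nat
  assumes "a \<ge> 1" and "c \<ge> 1" and "d \<ge> 1"
  shows
    "SPP_word a c ` SPP a c =
       {replicate a [Plain 1] @ replicate c [Bar 4] @ replicate a [Plain 2] @ v | v.
          mset v = replicate_mset c [Plain 4] + replicate_mset a [Plain 3, Plain 4]}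
     \<and>
     CSPP_word a ` CSPP a =
       {replicate a [Plain 1] @ replicate a [Bar 4] @ u @ v | u v m.
          m \<le> a \<and>
          mset u = replicate_mset m [Bar 3, Bar 1] + replicate_mset (a - m) [Bar 1] \<and>
          mset v = replicate_mset (a - m) [Plain 4] + replicate_mset m [Plain 3, Plain 4] \<and>
          (\<forall>i<a. u ! i = [Bar 3, Bar 1] \<longrightarrow> v ! (a - i - 1) = [Plain 3, Plain 4])}
     \<and>
     TSPP_word a ` TSPP a =
       {replicate a [Plain 1] @ u @ v | u v m.
          m \<le> a \<and>
          mset u = replicate_mset (a - m) [Plain 2, Plain 3] + replicate_mset m [Plain 2] \<and>
          mset v = replicate_mset (a - m) [Plain 4] + replicate_mset m [Plain 3, Plain 4] \<and>
          (\<forall>i<a. count_list (drop (a - 1 - i) u) [Plain 2, Plain 3]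
                  \<le> count_list (take (i + 1) v) [Plain 4])}
     \<and>
     TSSCPP_word d ` TSSCPP (2 * d) =
       {replicate d [Plain 1] @
          map (\<lambda>n. if even n then [Plain 2] else [Bar 4]) [0..<2 * d - 1] @
          w @ [[Plain 3, Plain 4]] | w.
          mset w = replicate_mset (d - 1) [Plain 4] + replicate_mset (d - 1) [Plain 3, Plain 4] \<and>
          yamanouchi [Plain 4] [Plain 3, Plain 4] ([[Plain 4]] @ w @ [[Plain 3, Plain 4]])}"
  using SPP_words[OF assms(1,2)] CSPP_words[OF assms(1)] TSPP_words[OF assms(1)] TSSCPP_words[OF assms(3)]
  by (intro conjI)

end
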